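(* Let $d\ge 1$ be fixed. There exists a constant $C=C(d)$ such that the following holds for every $\beta\ge 0$ with $$\tanh(\beta)<\frac{1}{e^{2}d}.$$ Let $G$ be a random graph distributed as $G(n,d/n)$. Then, with probability $1-o(1)$ over $G$ as $n\to\infty$, the mixing time of the Glauber dynamics (Gibbs sampler) for the Ising model on $G$ is $O(n^{C})$, where the implied constant in $O(\cdot)$ may depend on $\beta$ (and $d$). This holds both for the homogeneous Ising model with inverse temperature $\beta$ and for the inhomogeneous Ising model with interactions $\beta_{u,v}\ge 0$, $\max_{u,v}\beta_{u,v}=\beta$, and external fields $h_v$ satisfying $|h_v|\le 100\,\beta n$ for all vertices $v$.
   Context: $G(n,p)$ is the Erdős–Rényi random graph on $n$ vertices in which each potential edge is present independently with probability $p$. Ising model. For a finite graph $G=(V,E)$, interactions $\beta_{u,v}\ge 0$ (one for each edge $\{u,v\}\in E$) and external fields $h_v\in\mathbb{R}$ ($v\in V$), the inhomogeneous Ising model is the probability distribution on $\{\pm\}^V$ (with $\pm$ identified with $\pm1$) $$P(\sigma)=\frac1Z\exp\Big(\sum_{\{u,v\}\in E}\beta_{u,v}\sigma(u)\sigma(v)+\sum_{v\in V}h_v\sigma(v)\Big),$$ $Z$ being the normalizing constant; one writes $\beta=\max_{u,v}\beta_{u,v}$. The homogeneous Ising model with inverse temperature $\beta$ is the case $\beta_{u,v}=\beta$ for every edge and $h_v=0$ for every $v$. Gibbs sampler (Glauber dynamics). The discrete-time Markov chain on $\{\pm\}^V$ that, from state $\sigma$, picks $v\in V$ uniformly at random,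 leaves all other spins unchanged, and sets the spin at $v$ to $+$ with probability $\frac{e^{x}}{e^{x}+e^{-x}}$, where $x=h_v+\sum_{u:\{u,v\}\in E}\beta_{u,v}\sigma(u)$, and to $-$ otherwise. Its stationary distribution is $P$. Mixing time. The smallest number of steps after which the chain, from an arbitrary starting state, is within total variation distance $1/(2e)$ of $P$. *)

theory Defs
  imports "HOL-Probability.Probability"
begin

text \<open>A simple graph consists of a vertex set \<open>V\<close> and a set \<open>E\<close> of two-element subsets of \<open>V\<close>.\<close>

definition potential_edges :: "'a set \<Rightarrow> 'a set set" where
  "potential_edges V = {e. e \<subseteq> V \<and> card e = 2}"

text \<open>The random edge set of \<open>G(n,p)\<close> on the vertices \<open>{..<n}\<close>. For \<open>p > 1\<close> (which happens for
  \<open>p = d / n\<close> with \<open>n < d\<close>), \<^const>\<open>bernoulli_pmf\<close> clamps the parameter to 1.\<close>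

definition gnp :: "nat \<Rightarrow> real \<Rightarrow> nat set set pmf" where
  "gnp n p = map_pmf (\<lambda>present. {e \<in> potential_edges {..<n}. present e})
     (Pi_pmf (potential_edges {..<n}) False (\<lambda>_. bernoulli_pmf p))"

text \<open>Spins are the real numbers 1 and -1. Functions are extensional, so that each element of
  \<open>{+,-}\<^sup>V\<close> has exactly one representative.\<close>

definition configs :: "'a set \<Rightarrow> ('a \<Rightarrow> real) set" where
  "configs V = V \<rightarrow>\<^sub>E {-1, 1}"

text \<open>The interactions \<open>J\<close> are indexed by edges. For \<open>e = {u, v}\<close> with \<open>u \<noteq> v\<close> the product over \<open>e\<close> is
  \<open>\<sigma> u * \<sigma> v\<close>.\<close>

definition ising_weight ::
  "'a set \<Rightarrow> 'a set set \<Rightarrow> ('a set \<Rightarrow> real) \<Rightarrow> ('a \<Rightarrow> real) \<Rightarrow> ('a \<Rightarrow> real) \<Rightarrow> real" where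
  "ising_weight V E J h \<sigma> = exp ((\<Sum>e\<in>E. J e * (\<Prod>v\<in>e. \<sigma> v)) + (\<Sum>v\<in>V. h v * \<sigma> v))"

definition partition_function ::
  "'a set \<Rightarrow> 'a set set \<Rightarrow> ('a set \<Rightarrow> real) \<Rightarrow> ('a \<Rightarrow> real) \<Rightarrow> real" where
  "partition_function V E J h = (\<Sum>\<sigma>\<in>configs V. ising_weight V E J h \<sigma>)"

definition ising_pmf ::
  "'a set \<Rightarrow> 'a set set \<Rightarrow> ('a set \<Rightarrow> real) \<Rightarrow> ('a \<Rightarrow> real) \<Rightarrow> ('a \<Rightarrow> real) pmf" where
  "ising_pmf V E J h = embed_pmf (\<lambda>\<sigma>.
     if \<sigma> \<in> configs V then ising_weight V E J h \<sigma> / partition_function V E J h else 0)"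

lemma finite_configs: "finite V \<Longrightarrow> finite (configs V)"
  by (simp add: configs_def finite_PiE)

lemma configs_nonempty: "configs V \<noteq> {}"
  by (simp add: configs_def PiE_eq_empty_iff)

lemma partition_function_pos: "finite V \<Longrightarrow> partition_function V E J h > 0"
  unfolding partition_function_def
  by (intro sum_pos finite_configs configs_nonempty) (simp_all add: ising_weight_def)

lemma pmf_ising_pmf:
  assumes "finite V"
  shows "pmf (ising_pmf V E J h) \<sigma> =
    (if \<sigma> \<in> configs V then ising_weight V E J h \<sigma> / partition_function V E J h else 0)"
  unfolding ising_pmf_def
proof (rule pmf_embed_pmf)
  let ?f = "\<lambda>\<sigma>. if \<sigma> \<in> configs V then ising_weight V E J h \<sigma> / partition_function V E J h else 0"
  note fin = finite_configs[OF assms] and pos = partition_function_pos[OF assms, of E J h]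
  show nn: "0 \<le> ?f \<sigma>" for \<sigma>
    using pos by (simp add: ising_weight_def)
  have "(\<integral>\<^sup>+ \<sigma>. ennreal (?f \<sigma>) \<partial>count_space UNIV) = (\<Sum>\<sigma>\<in>configs V. ennreal (?f \<sigma>))"
    by (rule nn_integral_count_space') (use fin in auto)
  also have "\<dots> = ennreal (\<Sum>\<sigma>\<in>configs V. ?f \<sigma>)"
    using nn by (intro sum_ennreal) blast
  also have "(\<Sum>\<sigma>\<in>configs V. ?f \<sigma>) = 1"
    using pos by (simp add: partition_function_def flip: sum_divide_distrib)
  finally show "(\<integral>\<^sup>+ \<sigma>. ennreal (?f \<sigma>) \<partial>count_space UNIV) = 1"
    by simp
qed

definition local_field ::
  "'a set \<Rightarrow> 'a set set \<Rightarrow> ('a set \<Rightarrow> real) \<Rightarrow> ('a \<Rightarrow> real) \<Rightarrow> ('a \<Rightarrow> real) \<Rightarrow> 'a \<Rightarrow> real" where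
  "local_field V E J h \<sigma> v = h v + (\<Sum>u | u \<in> V \<and> {u, v} \<in> E. J {u, v} * \<sigma> u)"

definition glauber_step ::
  "'a set \<Rightarrow> 'a set set \<Rightarrow> ('a set \<Rightarrow> real) \<Rightarrow> ('a \<Rightarrow> real) \<Rightarrow> ('a \<Rightarrow> real) \<Rightarrow> ('a \<Rightarrow> real) pmf" where
  "glauber_step V E J h \<sigma> =
     do {
       v \<leftarrow> pmf_of_set V;
       plus \<leftarrow> bernoulli_pmf
         (let x = local_field V E J h \<sigma> v in exp x / (exp x + exp (- x)));
       return_pmf (\<sigma>(v := if plus then 1 else -1))
     }"

definition tv_dist :: "'s pmf \<Rightarrow> 's pmf \<Rightarrow> real" where
  "tv_dist p q = (SUP A. \<bar>measure_pmf.prob p A - measure_pmf.prob q A\<bar>)"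

definition chain_pmf :: "('s \<Rightarrow> 's pmf) \<Rightarrow> nat \<Rightarrow> 's \<Rightarrow> 's pmf" where
  "chain_pmf K t x = ((\<lambda>p. bind_pmf p K) ^^ t) (return_pmf x)"

text \<open>The value is \<open>\<infinity>\<close> if there is no such number of steps.\<close>

definition mixing_time :: "'s set \<Rightarrow> ('s \<Rightarrow> 's pmf) \<Rightarrow> 's pmf \<Rightarrow> enat" where
  "mixing_time S K \<pi> =
     Inf (enat ` {t. \<forall>x\<in>S. tv_dist (chain_pmf K t x) \<pi> \<le> 1 / (2 * exp 1)})"

definition glauber_mixing_time ::
  "'a set \<Rightarrow> 'a set set \<Rightarrow> ('a set \<Rightarrow> real) \<Rightarrow> ('a \<Rightarrow> real) \<Rightarrow> enat" where
  "glauber_mixing_time V E J h =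
     mixing_time (configs V) (glauber_step V E J h) (ising_pmf V E J h)"

end

theory Submission
  imports Defs "HOL-Real_Asymp.Real_Asymp"
begin

text \<open>The argument is functional: distributions enter only through the kernel acting on observables.
  Let \<open>a\<^sub>v(t)\<close> be the difference of the expected spins at \<open>v\<close> after \<open>t\<close> steps from the all-plus and the
  all-minus state. By monotonicity the total variation distance at time \<open>t\<close> is at most the sum of all
  \<open>a\<^sub>v(t)\<close>. By the censoring principle of Peres and Winkler, \<open>a\<^sub>v\<close> only grows if during \<open>\<tau>\<close> further steps
  all updates outside a block \<open>B\<close> around \<open>v\<close> are ignored. If \<open>\<tau>\<close> is so large that the block relaxes, then
  \<open>a\<^sub>v(t + \<tau>)\<close> is at most the influence of the boundary of \<open>B\<close> on \<open>v\<close> times the maximum of the \<open>a\<^sub>u(t)\<close>,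
  up to a tiny error.

  In \<open>G(n, d/n)\<close> the block is the ball of radius about \<open>2 ln (ln n)\<close> around \<open>v\<close>. Every vertex set of
  that order of size spans at most as many edges as it has vertices, so the ball is a tree with at most
  one additional edge, and removing an endpoint of that edge leaves a forest. On a forest the Poincare
  constant is at most exponential in the sum of the degrees along a path to the root, which is
  \<open>O(ln n)\<close>: this gives the polynomial. The influence of the boundary is at most
  \<open>2 tanh \<beta>\<close> from the removed vertex plus \<open>tanh \<beta>\<^sup>r\<close> for each vertex at distance \<open>r\<close>, of
  which there are at most \<open>3 (2 d)\<^sup>r ln n\<close>; as \<open>tanh \<beta> < 1 / (e\<^sup>2 d)\<close>, the total is below \<open>1/2\<close>.\<close>

section \<open>Spin blocks and local variances\<close>

text \<open>For \<open>\<beta> > 0\<close> a row-sum condition such as Dobrushin's fails at the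
  vertices of large degree, and degrees in \<open>G(n, d/n)\<close> are unbounded. So contraction
  has to be measured across a block. What stays of order \<open>ln n\<close> is the sum of the
  degrees along a short path, which is why the Poincare inequality carries a separate weight for
  each vertex. External fields of order \<open>n\<close> are harmless: the block estimates see the
  weight only through odds ratios of two spins and through \<open>tanh \<beta>\<close>, neither of
  which involves the fields. Fields enter only where variance decay becomes a pointwise bound. There
  the smallest weight costs a factor \<open>exp (O(n^2))\<close>, hence only a polynomial factor in
  the number of steps. The hypothesis on \<open>tanh \<beta>\<close> is used twice. It gives
  \<open>2 d tanh \<beta> \<le> 1/e\<close>, so that the sphere contributes only
  \<open>O(1 / ln n)\<close>. It also gives \<open>tanh \<beta> \<le> 1/5\<close>, which leaves room
  for the removed vertex and yields \<open>exp (4 \<beta>) \<le> 4\<close>, the interaction bound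
  behind the Poincare constant. The exponent obtained does not depend on \<open>d\<close>.\<close>

definition block :: "'a set \<Rightarrow> ('a \<Rightarrow> real) \<Rightarrow> ('a \<Rightarrow> real) set" where
  "block B \<eta> = {\<sigma>. (\<forall>x\<in>B. \<sigma> x = 1 \<or> \<sigma> x = -1) \<and> (\<forall>x. x \<notin> B \<longrightarrow> \<sigma> x = \<eta> x)}"

lemma block_empty [simp]: "block {} \<eta> = {\<eta>}"
  by (auto simp: block_def)

lemma block_insert:
  assumes "z \<notin> B"
  shows "block (insert z B) \<eta> = (\<lambda>\<sigma>. \<sigma>(z := 1)) ` block B \<eta> \<union> (\<lambda>\<sigma>. \<sigma>(z := -1)) ` block B \<eta>"
proof (rule set_eqI, rule iffI)
  fix \<sigma> assume s: "\<sigma> \<in> block (insert z B) \<eta>"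
  define \<tau> where "\<tau> = \<sigma>(z := \<eta> z)"
  have t: "\<tau> \<in> block B \<eta>" using s assms by (auto simp: block_def \<tau>_def)
  have "\<sigma> z = 1 \<or> \<sigma> z = -1" using s by (auto simp: block_def)
  hence "\<sigma> = \<tau>(z := 1) \<or> \<sigma> = \<tau>(z := -1)" by (auto simp: \<tau>_def)
  with t show "\<sigma> \<in> (\<lambda>\<sigma>. \<sigma>(z := 1)) ` block B \<eta> \<union> (\<lambda>\<sigma>. \<sigma>(z := -1)) ` block B \<eta>" by blast
next
  fix \<sigma> assume "\<sigma> \<in> (\<lambda>\<sigma>. \<sigma>(z := 1)) ` block B \<eta> \<union> (\<lambda>\<sigma>. \<sigma>(z := -1)) ` block B \<eta>"
  then obtain \<tau> c where t: "\<tau> \<in> block B \<eta>" "\<sigma> = \<tau>(z := c)" "c = 1 \<or> c = -1" by blast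
  show "\<sigma> \<in> block (insert z B) \<eta>" unfolding t(2) using t(1,3) by (simp add: block_def)
qed

lemma finite_block [simp]: "finite B \<Longrightarrow> finite (block B \<eta>)"
  by (induction rule: finite_induct) (simp_all add: block_insert)

lemma inj_on_upd_block:
  assumes "z \<notin> B" shows "inj_on (\<lambda>\<sigma>. \<sigma>(z := c)) (block B \<eta>)"
proof (rule inj_onI)
  fix \<sigma> \<tau> assume "\<sigma> \<in> block B \<eta>" "\<tau> \<in> block B \<eta>" and e: "\<sigma>(z := c) = \<tau>(z := c)"
  hence "\<sigma> z = \<tau> z" using assms by (auto simp: block_def)
  thus "\<sigma> = \<tau>" using e by (metis fun_upd_triv fun_upd_upd)
qed

lemma sum_block_insert:
  fixes F :: "('a \<Rightarrow> real) \<Rightarrow> real"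
  assumes "finite B" "z \<notin> B"
  shows "sum F (block (insert z B) \<eta>) = (\<Sum>\<sigma>\<in>block B \<eta>. F (\<sigma>(z := 1)) + F (\<sigma>(z := -1)))"
proof -
  have disj: "(\<lambda>\<sigma>. \<sigma>(z := 1)) ` block B \<eta> \<inter> (\<lambda>\<sigma>. \<sigma>(z := -1)) ` block B \<eta> = {}"
  proof (rule ccontr)
    assume "\<not> ?thesis"
    then obtain \<sigma> \<tau> where "\<sigma>(z := 1) = \<tau>(z := (-1::real))" by blast
    hence "(1::real) = -1" by (metis fun_upd_same)
    thus False by simp
  qed
  show ?thesis unfolding block_insert[OF assms(2)]
    using assms disj
    by (subst sum.union_disjoint) (simp_all add: sum.reindex inj_on_upd_block sum.distrib)
qed

text \<open>Moves the spin at \<open>z\<close> into the boundary condition, so that both halves are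
  again sums over blocks. This is the form for conditioning; \<open>sum_block_insert\<close> keeps
  one boundary condition and suits summing out.\<close>

lemma sum_block_insert':
  fixes F :: "('a \<Rightarrow> real) \<Rightarrow> real"
  assumes "finite B" "z \<notin> B"
  shows "sum F (block (insert z B) \<eta>) = sum F (block B (\<eta>(z := 1))) + sum F (block B (\<eta>(z := -1)))"
proof -
  have im: "(\<lambda>\<sigma>. \<sigma>(z := c)) ` block B \<eta> = block B (\<eta>(z := c))" for c
  proof (rule set_eqI, rule iffI)
    fix \<sigma> assume s: "\<sigma> \<in> block B (\<eta>(z := c))"
    have "\<sigma>(z := \<eta> z) \<in> block B \<eta>" "\<sigma> = (\<sigma>(z := \<eta> z))(z := c)"
      using s assms(2) by (auto simp: block_def)
    thus "\<sigma> \<in> (\<lambda>\<sigma>. \<sigma>(z := c)) ` block B \<eta>" by blast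
  next
    fix \<sigma> assume "\<sigma> \<in> (\<lambda>\<sigma>. \<sigma>(z := c)) ` block B \<eta>"
    then obtain \<tau> where t: "\<tau> \<in> block B \<eta>" "\<sigma> = \<tau>(z := c)" by blast
    have "\<forall>x\<in>B. x \<noteq> z" using assms(2) by blast
    thus "\<sigma> \<in> block B (\<eta>(z := c))" unfolding t(2) using t(1) by (simp add: block_def)
  qed
  show ?thesis
    unfolding sum_block_insert[OF assms] sum.distrib im[symmetric]
    using assms by (simp add: sum.reindex inj_on_upd_block)
qed

definition heat :: "(('a \<Rightarrow> real) \<Rightarrow> real) \<Rightarrow> 'a \<Rightarrow> (('a \<Rightarrow> real) \<Rightarrow> real) \<Rightarrow> ('a \<Rightarrow> real) \<Rightarrow> real" where
  "heat w x f \<sigma> = (w (\<sigma>(x := 1)) * f (\<sigma>(x := 1)) + w (\<sigma>(x := -1)) * f (\<sigma>(x := -1)))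
      / (w (\<sigma>(x := 1)) + w (\<sigma>(x := -1)))"

text \<open>The conditional variance of \<open>f\<close> at \<open>x\<close> given the other spins,
  times the total weight of the two configurations. So normalised, it can be summed over the
  remaining spins without division.\<close>

definition site_var :: "(('a \<Rightarrow> real) \<Rightarrow> real) \<Rightarrow> 'a \<Rightarrow> (('a \<Rightarrow> real) \<Rightarrow> real) \<Rightarrow> ('a \<Rightarrow> real) \<Rightarrow> real" where
  "site_var w x f \<sigma> = w (\<sigma>(x := 1)) * w (\<sigma>(x := -1)) / (w (\<sigma>(x := 1)) + w (\<sigma>(x := -1)))
      * (f (\<sigma>(x := 1)) - f (\<sigma>(x := -1)))\<^sup>2"

section \<open>Variance inequalities on two and four points\<close>

lemma two_point_var:
  fixes a b F G :: real
  assumes "a > 0" "b > 0"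
  shows "a * F\<^sup>2 + b * G\<^sup>2 = (a + b) * ((a * F + b * G) / (a + b))\<^sup>2 + a * b / (a + b) * (F - G)\<^sup>2"
proof -
  have s: "a + b \<noteq> 0" using assms by simp
  have "(a + b) * (a * F\<^sup>2 + b * G\<^sup>2) = (a * F + b * G)\<^sup>2 + a * b * (F - G)\<^sup>2"
    by (simp add: power2_eq_square algebra_simps)
  hence "a * F\<^sup>2 + b * G\<^sup>2 = ((a * F + b * G)\<^sup>2 + a * b * (F - G)\<^sup>2) / (a + b)"
    using s by (simp add: field_simps)
  also have "\<dots> = (a * F + b * G)\<^sup>2 / (a + b) + a * b / (a + b) * (F - G)\<^sup>2"
    by (simp add: add_divide_distrib)
  also have "(a * F + b * G)\<^sup>2 / (a + b) = (a + b) * ((a * F + b * G) / (a + b))\<^sup>2"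
    using s by (simp add: power_divide power2_eq_square)
  finally show ?thesis .
qed

lemma site_var_nonneg: "(\<And>\<sigma>. w \<sigma> > 0) \<Longrightarrow> 0 \<le> site_var w x f \<sigma>"
  by (simp add: site_var_def less_imp_le add_nonneg_nonneg)

text \<open>The weights \<open>a\<close>, \<open>b\<close>, \<open>c\<close>, \<open>d\<close> form
  a 2 by 2 table, rows for one spin and columns for the other. If \<open>a * d = b * c\<close>, the
  table is a product: both rows average over the columns with the same probability \<open>q\<close>,
  and convexity of the square gives the claim.\<close>

lemma four_point_indep:
  fixes a b c d F1 F2 F3 F4 :: real
  assumes "a > 0" "b > 0" "c > 0" "d > 0" "a * d = b * c"
  shows "(a + b) * (c + d) / ((a + b) + (c + d)) * ((a*F1 + b*F2) / (a+b) - (c*F3 + d*F4) / (c+d))\<^sup>2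
    \<le> a * c / (a + c) * (F1 - F3)\<^sup>2 + b * d / (b + d) * (F2 - F4)\<^sup>2"
proof -
  define q where "q = a / (a + b)"
  define X where "X = F1 - F3"
  define Y where "Y = F2 - F4"
  have q1: "1 - q = b / (a + b)" using assms by (simp add: q_def field_simps)
  have q2: "q = c / (c + d)" using assms by (simp add: q_def field_simps)
  have q3: "1 - q = d / (c + d)" unfolding q2 using assms by (simp add: field_simps)
  have q01: "0 \<le> q" "0 \<le> 1 - q" using assms by (simp_all add: q1) (simp add: q_def)
  have e: "(a*F1 + b*F2) / (a+b) - (c*F3 + d*F4) / (c+d) = q * X + (1 - q) * Y"
  proof -
    have "(a*F1 + b*F2) / (a+b) = q * F1 + (1 - q) * F2" unfolding q1 by (simp add: q_def add_divide_distrib)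
    moreover have "(c*F3 + d*F4) / (c+d) = q * F3 + (1 - q) * F4" unfolding q3 unfolding q2 by (simp add: add_divide_distrib)
    ultimately show ?thesis by (simp add: X_def Y_def algebra_simps)
  qed
  have "(q * X + (1 - q) * Y)\<^sup>2 + q * (1 - q) * (X - Y)\<^sup>2 = q * X\<^sup>2 + (1 - q) * Y\<^sup>2"
    by (simp add: power2_eq_square algebra_simps)
  moreover have "0 \<le> q * (1 - q) * (X - Y)\<^sup>2" using q01 by simp
  ultimately have conv: "(q * X + (1 - q) * Y)\<^sup>2 \<le> q * X\<^sup>2 + (1 - q) * Y\<^sup>2" by linarith
  have c1: "(a + b) * (c + d) / ((a + b) + (c + d)) * q = a * c / (a + c)"
  proof -
    have "(c + d) * (a + c) = c * (a + b + c + d)" using assms(5) by (simp add: algebra_simps)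
    moreover have "(a + b) * (c + d) / ((a + b) + (c + d)) * q = a * (c + d) / (a + b + c + d)"
      using assms by (simp add: q_def add.assoc mult.commute)
    moreover have "a * (c + d) / (a + b + c + d) = a * c / (a + c)"
      using assms calculation(1) by (simp add: frac_eq_eq mult.assoc)
    ultimately show ?thesis by simp
  qed
  have c2: "(a + b) * (c + d) / ((a + b) + (c + d)) * (1 - q) = b * d / (b + d)"
  proof -
    have "(c + d) * (b + d) = d * (a + b + c + d)" using assms(5) by (simp add: algebra_simps)
    moreover have "(a + b) * (c + d) / ((a + b) + (c + d)) * (1 - q) = b * (c + d) / (a + b + c + d)"
      using assms by (simp add: q1 add.assoc mult.commute)
    moreover have "b * (c + d) / (a + b + c + d) = b * d / (b + d)"
      using assms calculation(1) by (simp add: frac_eq_eq mult.assoc)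
    ultimately show ?thesis by simp
  qed
  have "(a + b) * (c + d) / ((a + b) + (c + d)) * (q * X + (1 - q) * Y)\<^sup>2
    \<le> (a + b) * (c + d) / ((a + b) + (c + d)) * (q * X\<^sup>2 + (1 - q) * Y\<^sup>2)"
    using assms by (intro mult_left_mono conv) simp
  also have "\<dots> = a * c / (a + c) * X\<^sup>2 + b * d / (b + d) * Y\<^sup>2"
    unfolding c1[symmetric] c2[symmetric] by (simp only: distrib_left mult.assoc)
  finally show ?thesis unfolding e X_def Y_def .
qed

text \<open>A path argument: the diagonal pair is compared with two sides of the table through the
  corner of weight \<open>b\<close>. The last hypothesis gives \<open>a * d \<le> L * b * S\<close>
  for the total weight \<open>S\<close>, so this corner is no bottleneck.\<close>

lemma four_point_diag:
  fixes a b d s L F G H :: real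
  assumes "a > 0" "b > 0" "d > 0" "c > 0" "L \<ge> 0" "a * d \<le> L * (b * c)"
  shows "a * d / (a + b + c + d) * (F - H)\<^sup>2
     \<le> 2 * (1 + L) * (a * b / (a + b) * (F - G)\<^sup>2 + b * d / (b + d) * (G - H)\<^sup>2)"
proof -
  define S where "S = a + b + c + d"
  have S: "S > 0" "b \<le> S" "c \<le> S" "d \<le> S" "a \<le> S" using assms by (auto simp: S_def)
  have sq: "(F - H)\<^sup>2 \<le> 2 * (F - G)\<^sup>2 + 2 * (G - H)\<^sup>2"
  proof -
    have "2 * (F - G)\<^sup>2 + 2 * (G - H)\<^sup>2 - (F - H)\<^sup>2 = (F - G - (G - H))\<^sup>2"
      by (simp add: power2_eq_square algebra_simps)
    thus ?thesis by (smt (verit) zero_le_power2)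
  qed
  have Lc: "a * d \<le> L * b * S"
  proof -
    have "L * (b * c) \<le> L * (b * S)" using assms S by (intro mult_left_mono) auto
    thus ?thesis using assms(6) by (simp add: mult.assoc)
  qed
  have k1: "a * d / S \<le> (1 + L) * (a * b / (a + b))"
  proof -
    have "d * (a + b) \<le> (1 + L) * b * S"
    proof -
      have "d * b \<le> S * b" using S assms by (intro mult_right_mono) auto
      thus ?thesis using Lc by (simp add: algebra_simps)
    qed
    hence "a * (d * (a + b)) \<le> a * ((1 + L) * b * S)" using assms by (intro mult_left_mono) auto
    thus ?thesis using S assms by (simp add: field_simps)
  qed
  have k2: "a * d / S \<le> (1 + L) * (b * d / (b + d))"
  proof -
    have "a * (b + d) \<le> (1 + L) * b * S"
    proof -
      have "a * b \<le> S * b" using S assms by (intro mult_right_mono) auto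
      thus ?thesis using Lc by (simp add: algebra_simps)
    qed
    hence "d * (a * (b + d)) \<le> d * ((1 + L) * b * S)" using assms by (intro mult_left_mono) auto
    thus ?thesis using S assms by (simp add: field_simps)
  qed
  have "a * d / S * (F - H)\<^sup>2 \<le> a * d / S * (2 * (F - G)\<^sup>2 + 2 * (G - H)\<^sup>2)"
    using assms S by (intro mult_left_mono sq) auto
  also have "\<dots> = 2 * (a * d / S * (F - G)\<^sup>2) + 2 * (a * d / S * (G - H)\<^sup>2)"
    by (simp add: algebra_simps)
  also have "\<dots> \<le> 2 * ((1 + L) * (a * b / (a + b)) * (F - G)\<^sup>2) + 2 * ((1 + L) * (b * d / (b + d)) * (G - H)\<^sup>2)"
    using mult_right_mono[OF k1, of "(F - G)\<^sup>2"] mult_right_mono[OF k2, of "(G - H)\<^sup>2"] by simp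
  finally show ?thesis by (simp add: S_def algebra_simps)
qed

text \<open>The left-hand side is a variance of conditional expectations, hence at most the total
  variance, which splits into the six pairs of corners. Four pairs are sides of the table. Both
  diagonals are routed over the side from \<open>a\<close> to \<open>b\<close>, which is thus used
  once directly and twice with the factor \<open>2 * (1 + L)\<close>; this is the constant
  \<open>5 + 4 * L\<close>.\<close>

lemma four_point_dep:
  fixes a b c d F1 F2 F3 F4 L :: real
  assumes "a > 0" "b > 0" "c > 0" "d > 0" "L \<ge> 1" "a * d \<le> L * (b * c)" "b * c \<le> L * (a * d)"
  shows "(a + b) * (c + d) / ((a + b) + (c + d)) * ((a*F1 + b*F2) / (a+b) - (c*F3 + d*F4) / (c+d))\<^sup>2
    \<le> (5 + 4 * L) * (a * c / (a + c) * (F1 - F3)\<^sup>2 + b * d / (b + d) * (F2 - F4)\<^sup>2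
         + a * b / (a + b) * (F1 - F2)\<^sup>2 + c * d / (c + d) * (F3 - F4)\<^sup>2)"
    (is "?lhs \<le> (5 + 4 * L) * (?A + ?B + ?C + ?D)")
proof -
  define S where "S = a + b + c + d"
  have S: "S > 0" using assms by (auto simp: S_def)
  have nn: "?A \<ge> 0" "?B \<ge> 0" "?C \<ge> 0" "?D \<ge> 0" using assms by auto
  define U where "U = (a*F1 + b*F2) / (a+b)"
  define W where "W = (c*F3 + d*F4) / (c+d)"
  define T where "T = (a*F1 + b*F2 + c*F3 + d*F4) / S"
  \<comment> \<open>the left-hand side is at most the total variance over the four points\<close>
  have v: "?lhs \<le> a * F1\<^sup>2 + b * F2\<^sup>2 + c * F3\<^sup>2 + d * F4\<^sup>2 - S * T\<^sup>2"
  proof -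
    have "(a + b) * U\<^sup>2 + (c + d) * W\<^sup>2 = (a + b + (c + d)) * (((a + b) * U + (c + d) * W) / (a + b + (c + d)))\<^sup>2 + ?lhs"
      using two_point_var[of "a+b" "c+d" U W] assms by (simp add: U_def W_def)
    moreover have "((a + b) * U + (c + d) * W) / (a + b + (c + d)) = T"
    proof -
      have "(a + b) * U = a*F1 + b*F2" "(c + d) * W = c*F3 + d*F4"
        using assms by (simp_all add: U_def W_def)
      thus ?thesis by (simp add: T_def S_def add.assoc)
    qed
    moreover have "(a + b) * U\<^sup>2 \<le> a * F1\<^sup>2 + b * F2\<^sup>2"
      using two_point_var[of a b F1 F2] assms nn by (simp add: U_def)
    moreover have "(c + d) * W\<^sup>2 \<le> c * F3\<^sup>2 + d * F4\<^sup>2"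
      using two_point_var[of c d F3 F4] assms nn by (simp add: W_def)
    ultimately show ?thesis by (simp add: S_def add.assoc)
  qed
  have pairs: "a * F1\<^sup>2 + b * F2\<^sup>2 + c * F3\<^sup>2 + d * F4\<^sup>2 - S * T\<^sup>2 =
     a * c / S * (F1 - F3)\<^sup>2 + b * d / S * (F2 - F4)\<^sup>2 + a * b / S * (F1 - F2)\<^sup>2 + c * d / S * (F3 - F4)\<^sup>2
     + a * d / S * (F1 - F4)\<^sup>2 + b * c / S * (F2 - F3)\<^sup>2" (is "?l = ?r")
  proof -
    have ST: "S * T = a*F1 + b*F2 + c*F3 + d*F4" using S by (simp add: T_def)
    have "S * ?l = S * (a * F1\<^sup>2 + b * F2\<^sup>2 + c * F3\<^sup>2 + d * F4\<^sup>2) - (S * T)\<^sup>2"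
      by (simp add: power2_eq_square algebra_simps)
    also have "\<dots> = a * c * (F1 - F3)\<^sup>2 + b * d * (F2 - F4)\<^sup>2 + a * b * (F1 - F2)\<^sup>2 + c * d * (F3 - F4)\<^sup>2
     + a * d * (F1 - F4)\<^sup>2 + b * c * (F2 - F3)\<^sup>2"
      unfolding ST by (simp add: S_def power2_eq_square algebra_simps)
    also have "\<dots> = S * ?r" using S by (simp add: algebra_simps)
    finally show ?thesis using S by simp
  qed
  have e: "p * q / S * X\<^sup>2 \<le> p * q / (p + q) * X\<^sup>2" if "p > 0" "q > 0" "p + q \<le> S" for p q X
    using that by (intro mult_right_mono divide_left_mono) auto
  have e1: "a * c / S * (F1 - F3)\<^sup>2 \<le> ?A" "b * d / S * (F2 - F4)\<^sup>2 \<le> ?B"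
    "a * b / S * (F1 - F2)\<^sup>2 \<le> ?C" "c * d / S * (F3 - F4)\<^sup>2 \<le> ?D"
    by (rule e; use assms in \<open>simp add: S_def\<close>)+
  have d1: "a * d / S * (F1 - F4)\<^sup>2 \<le> 2 * (1 + L) * (?C + ?B)"
    using four_point_diag[of a b d c L F1 F4 F2] assms by (simp add: S_def)
  have d2: "b * c / S * (F2 - F3)\<^sup>2 \<le> 2 * (1 + L) * (?C + ?A)"
    using four_point_diag[of b a c d L F2 F3 F1] assms by (simp add: S_def power2_commute ac_simps)
  have *: "(5 + 4 * L) * (p + q + r + s) = p + q + r + s + 2 * (1 + L) * (r + q) + 2 * (1 + L) * (r + p)
     + (2 * (1 + L) * (p + q) + 4 * (1 + L) * s)" for p q r s
    by (simp add: algebra_simps)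
  have "2 * (1 + L) * (?A + ?B) + 4 * (1 + L) * ?D \<ge> 0"
    using nn assms by (intro add_nonneg_nonneg mult_nonneg_nonneg) auto
  thus ?thesis unfolding * using v pairs e1 d1 d2 by linarith
qed

section \<open>A Poincare inequality on forests\<close>

text \<open>The odds ratio of the spins at \<open>x\<close> and \<open>z\<close>, all others being
  fixed. A factor of \<open>w\<close> that depends on only one of the two spins cancels, so external
  fields leave no trace.\<close>

definition cross_ratio :: "(('a \<Rightarrow> real) \<Rightarrow> real) \<Rightarrow> 'a \<Rightarrow> 'a \<Rightarrow> ('a \<Rightarrow> real) \<Rightarrow> real" where
  "cross_ratio w x z \<sigma> = w (\<sigma>(x := 1, z := 1)) * w (\<sigma>(x := -1, z := -1))
     / (w (\<sigma>(x := 1, z := -1)) * w (\<sigma>(x := -1, z := 1)))"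

lemma cross_ratio_commute: "cross_ratio w x z \<sigma> = cross_ratio w z x \<sigma>"
proof (cases "x = z")
  case False
  thus ?thesis by (simp add: cross_ratio_def fun_upd_twist mult.commute)
qed simp

definition marg :: "'a \<Rightarrow> (('a \<Rightarrow> real) \<Rightarrow> real) \<Rightarrow> ('a \<Rightarrow> real) \<Rightarrow> real" where
  "marg z w \<sigma> = w (\<sigma>(z := 1)) + w (\<sigma>(z := -1))"

text \<open>As \<open>x1\<close> and \<open>z\<close> do not interact, summing over the spin at
  \<open>z\<close> multiplies \<open>w\<close> by a factor that does not depend on the spin at
  \<open>x1\<close>. A factor that depends on the spin at \<open>x2\<close> alone cancels in the
  odds ratio.\<close>

lemma cross_ratio_marg:
  assumes pos: "\<And>\<sigma>. w \<sigma> > 0" and d: "x1 \<noteq> x2" "x1 \<noteq> z" "x2 \<noteq> z"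
    and one: "\<And>\<sigma>. cross_ratio w x1 z \<sigma> = 1"
  shows "cross_ratio (marg z w) x1 x2 \<sigma> = cross_ratio w x1 x2 (\<sigma>(z := 1))"
proof -
  have *: "(a+a')*(d+d')/((b+b')*(c+c')) = a*d/(b*c)"
    if "a > 0" "b > 0" "c > 0" "d > 0" "a' > 0" "b' > 0" "c' > 0" "d' > 0"
      "a*c'/(a'*c) = 1" "b*d'/(b'*d) = 1" for a b c d a' b' c' d' :: real
  proof -
    have "a + a' = a * (1 + c'/c)" "c + c' = c * (1 + c'/c)" "b + b' = b * (1 + d'/d)" "d + d' = d * (1 + d'/d)"
      using that by (simp_all add: field_simps)
    moreover have "1 + c'/c > 0" "1 + d'/d > 0" using that by (simp_all add: add_pos_pos)
    ultimately show ?thesis using that(1-4) by simp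
  qed
  have o: "w (\<sigma>(x2 := s, x1 := 1, z := 1)) * w (\<sigma>(x2 := s, x1 := -1, z := -1))
     / (w (\<sigma>(x2 := s, x1 := 1, z := -1)) * w (\<sigma>(x2 := s, x1 := -1, z := 1))) = 1" for s
    using one[of "\<sigma>(x2 := s)"] unfolding cross_ratio_def .
  have tw: "\<sigma>(z := 1, x1 := s, x2 := s') = \<sigma>(x2 := s', x1 := s, z := 1)"
    "\<sigma>(x1 := s, x2 := s', z := s'') = \<sigma>(x2 := s', x1 := s, z := s'')" for s s' s''
    using d by (auto simp: fun_eq_iff)
  show ?thesis unfolding cross_ratio_def marg_def tw
    by (rule *) (rule pos o)+
qed

text \<open>Bounding cross ratios, instead of prescribing an explicit Ising weight, gives a class that is
  visibly closed under summing out a leaf of the forest. The parent of \<open>z\<close> is \<open>par z\<close>, which is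
  meaningless if \<open>lev z = 0\<close>.\<close>

definition forest_weight ::
  "('a \<Rightarrow> 'a) \<Rightarrow> ('a \<Rightarrow> nat) \<Rightarrow> real \<Rightarrow> 'a set \<Rightarrow> (('a \<Rightarrow> real) \<Rightarrow> real) \<Rightarrow> bool" where
  "forest_weight par lev L B w \<longleftrightarrow> (\<forall>\<sigma>. w \<sigma> > 0) \<and>
    (\<forall>x\<in>B. \<forall>z\<in>B. x \<noteq> z \<longrightarrow> (\<forall>\<sigma>. cross_ratio w x z \<sigma> \<le> L \<and> 1 \<le> L * cross_ratio w x z \<sigma> \<and>
       (\<not> (lev z \<ge> 1 \<and> par z = x) \<and> \<not> (lev x \<ge> 1 \<and> par x = z) \<longrightarrow> cross_ratio w x z \<sigma> = 1)))"

lemma forest_weightD: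
  assumes "forest_weight par lev L B w" "x \<in> B" "z \<in> B" "x \<noteq> z"
  shows "cross_ratio w x z \<sigma> \<le> L" "1 \<le> L * cross_ratio w x z \<sigma>"
    "\<not> (lev z \<ge> 1 \<and> par z = x) \<Longrightarrow> \<not> (lev x \<ge> 1 \<and> par x = z) \<Longrightarrow> cross_ratio w x z \<sigma> = 1"
  using assms unfolding forest_weight_def by blast+

definition kids :: "('a \<Rightarrow> 'a) \<Rightarrow> ('a \<Rightarrow> nat) \<Rightarrow> 'a set \<Rightarrow> 'a \<Rightarrow> nat" where
  "kids par lev B y = card {z \<in> B. lev z \<ge> 1 \<and> par z = y}"

text \<open>The iterates of \<open>par\<close> may leave \<open>B\<close>; only the children are
  counted inside \<open>B\<close>. So removing vertices from \<open>B\<close> never increases the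
  exponent.\<close>

definition chain_kids :: "('a \<Rightarrow> 'a) \<Rightarrow> ('a \<Rightarrow> nat) \<Rightarrow> 'a set \<Rightarrow> 'a \<Rightarrow> nat" where
  "chain_kids par lev B x = (\<Sum>j\<le>lev x. 1 + kids par lev B ((par ^^ j) x))"

lemma kids_mono: "finite B \<Longrightarrow> A \<subseteq> B \<Longrightarrow> kids par lev A y \<le> kids par lev B y"
  unfolding kids_def by (intro card_mono) auto

lemma chain_kids_mono: "finite B \<Longrightarrow> A \<subseteq> B \<Longrightarrow> chain_kids par lev A y \<le> chain_kids par lev B y"
  unfolding chain_kids_def by (intro sum_mono add_mono kids_mono) auto

lemma site_var_marg_indep:
  assumes pos: "\<And>\<sigma>. w \<sigma> > 0" and ne: "x \<noteq> z" and one: "cross_ratio w x z \<sigma> = 1"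
  shows "site_var (marg z w) x (heat w z f) \<sigma> \<le> site_var w x f (\<sigma>(z := 1)) + site_var w x f (\<sigma>(z := -1))"
proof -
  have tw: "\<sigma>(z := s, x := s') = \<sigma>(x := s', z := s)" for s s' using ne by (simp add: fun_upd_twist)
  have "w (\<sigma>(x := 1, z := 1)) * w (\<sigma>(x := -1, z := -1)) = w (\<sigma>(x := 1, z := -1)) * w (\<sigma>(x := -1, z := 1))"
    using one pos[of "\<sigma>(x := 1, z := -1)"] pos[of "\<sigma>(x := -1, z := 1)"] by (simp add: cross_ratio_def)
  from four_point_indep[OF pos pos pos pos this]
  show ?thesis unfolding site_var_def heat_def marg_def tw by simp
qed

lemma site_var_marg_dep:
  assumes pos: "\<And>\<sigma>. w \<sigma> > 0" and ne: "x \<noteq> z" and L: "L \<ge> 1" "cross_ratio w x z \<sigma> \<le> L" "1 \<le> L * cross_ratio w x z \<sigma>"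
  shows "site_var (marg z w) x (heat w z f) \<sigma> \<le> (5 + 4 * L) *
     ((site_var w x f (\<sigma>(z := 1)) + site_var w x f (\<sigma>(z := -1)))
      + (site_var w z f (\<sigma>(x := 1)) + site_var w z f (\<sigma>(x := -1))))"
proof -
  have tw: "\<sigma>(z := s, x := s') = \<sigma>(x := s', z := s)" for s s' using ne by (simp add: fun_upd_twist)
  have p: "w (\<sigma>(x := 1, z := -1)) * w (\<sigma>(x := -1, z := 1)) > 0" using pos by simp
  have "w (\<sigma>(x := 1, z := 1)) * w (\<sigma>(x := -1, z := -1)) \<le> L * (w (\<sigma>(x := 1, z := -1)) * w (\<sigma>(x := -1, z := 1)))"
    using L(2) p by (simp add: cross_ratio_def divide_le_eq)
  moreover have "w (\<sigma>(x := 1, z := -1)) * w (\<sigma>(x := -1, z := 1)) \<le> L * (w (\<sigma>(x := 1, z := 1)) * w (\<sigma>(x := -1, z := -1)))"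
    using L(3) p by (simp add: cross_ratio_def le_divide_eq)
  ultimately show ?thesis using four_point_dep[OF pos pos pos pos L(1)]
    unfolding site_var_def heat_def marg_def tw by (simp add: add.assoc)
qed

text \<open>By \<open>top\<close>, \<open>z\<close> has no child in \<open>B\<close>. So of any two
  vertices of \<open>B\<close> at most one, the parent, interacts with \<open>z\<close>, and
  \<open>cross_ratio_marg\<close> applies with the other one as \<open>x1\<close>.\<close>

lemma forest_weight_marg:
  assumes fw: "forest_weight par lev L (insert z B) w" and z: "z \<notin> B"
    and top: "\<And>x. x \<in> B \<Longrightarrow> lev x \<ge> 1 \<Longrightarrow> par x \<noteq> z"
  shows "forest_weight par lev L B (marg z w)"
proof -
  have pos: "w \<sigma> > 0" for \<sigma> using fw by (auto simp: forest_weight_def)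
  have cr: "\<exists>\<tau>. cross_ratio (marg z w) x1 x2 \<sigma> = cross_ratio w x1 x2 \<tau>"
    if x: "x1 \<in> B" "x2 \<in> B" "x1 \<noteq> x2" for x1 x2 \<sigma>
  proof (cases "lev z \<ge> 1 \<and> par z = x1")
    case True
    have "cross_ratio w x2 z \<tau> = 1" for \<tau>
      by (rule forest_weightD(3)[OF fw]) (use True x z top[of x2] in auto)
    hence "cross_ratio (marg z w) x2 x1 \<sigma> = cross_ratio w x2 x1 (\<sigma>(z := 1))"
      using x z by (intro cross_ratio_marg pos) auto
    thus ?thesis by (metis cross_ratio_commute)
  next
    case False
    have "cross_ratio w x1 z \<tau> = 1" for \<tau>
      by (rule forest_weightD(3)[OF fw]) (use False x z top[of x1] in auto)
    hence "cross_ratio (marg z w) x1 x2 \<sigma> = cross_ratio w x1 x2 (\<sigma>(z := 1))"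
      using x z by (intro cross_ratio_marg pos) auto
    thus ?thesis by blast
  qed
  show ?thesis
    unfolding forest_weight_def
  proof (intro conjI ballI impI allI)
    show "marg z w \<sigma> > 0" for \<sigma> using pos by (simp add: marg_def add_pos_pos)
  next
    fix x1 x2 \<sigma> assume x: "x1 \<in> B" "x2 \<in> B" "x1 \<noteq> x2"
    obtain \<tau> where t: "cross_ratio (marg z w) x1 x2 \<sigma> = cross_ratio w x1 x2 \<tau>" using cr[OF x] by blast
    show "cross_ratio (marg z w) x1 x2 \<sigma> \<le> L" "1 \<le> L * cross_ratio (marg z w) x1 x2 \<sigma>"
      unfolding t using x by (auto intro!: forest_weightD[OF fw])
    show "cross_ratio (marg z w) x1 x2 \<sigma> = 1" if "\<not> (lev x2 \<ge> 1 \<and> par x2 = x1) \<and> \<not> (lev x1 \<ge> 1 \<and> par x1 = x2)"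
      unfolding t by (rule forest_weightD(3)[OF fw]) (use x that in auto)
  qed
qed

text \<open>This is \<open>Z^2\<close> times the variance, where \<open>Z\<close> is the weight of
  the block, and \<open>dirichlet\<close> is \<open>Z\<close> times the weighted sum of the expected
  conditional variances. Hence \<open>block_var \<le> Z * dirichlet\<close> is the usual Poincare
  inequality, written without division.\<close>

definition block_var :: "(('a \<Rightarrow> real) \<Rightarrow> real) \<Rightarrow> 'a set \<Rightarrow> ('a \<Rightarrow> real) \<Rightarrow> (('a \<Rightarrow> real) \<Rightarrow> real) \<Rightarrow> real" where
  "block_var w B \<eta> f = sum w (block B \<eta>) * (\<Sum>\<sigma>\<in>block B \<eta>. w \<sigma> * (f \<sigma>)\<^sup>2) - (\<Sum>\<sigma>\<in>block B \<eta>. w \<sigma> * f \<sigma>)\<^sup>2"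

definition dirichlet ::
  "(('a \<Rightarrow> real) \<Rightarrow> real) \<Rightarrow> 'a set \<Rightarrow> ('a \<Rightarrow> real) \<Rightarrow> ('a \<Rightarrow> real) \<Rightarrow> (('a \<Rightarrow> real) \<Rightarrow> real) \<Rightarrow> real" where
  "dirichlet w B c \<eta> f = (\<Sum>x\<in>B. c x * (\<Sum>\<sigma>\<in>block (B - {x}) \<eta>. site_var w x f \<sigma>))"

text \<open>Leaves are added one at a time. The leaf costs a factor only at its parent, because every other
  vertex is conditionally independent of it; hence the weight of \<open>x\<close> collects one factor for every
  vertex on the path from \<open>x\<close> to the root and one for every child of such a vertex.\<close>

theorem poincare_forest:
  assumes fin: "finite B" and L: "L \<ge> 1"
    and lev: "\<And>z. z \<in> B \<Longrightarrow> lev z \<ge> 1 \<Longrightarrow> lev z = Suc (lev (par z))"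
    and fw: "forest_weight par lev L B w"
  shows "block_var w B \<eta> f \<le> sum w (block B \<eta>) * dirichlet w B (\<lambda>x. (10 + 8 * L) ^ chain_kids par lev B x) \<eta> f"
  using fin lev fw unfolding block_var_def dirichlet_def
proof (induction "card B" arbitrary: B w f)
  case 0
  hence "B = {}" by simp
  thus ?case by (simp add: power2_eq_square)
next
  case (Suc n)
  define Q where "Q = 10 + 8 * L"
  have Q: "Q = 2 * (5 + 4 * L)" "Q \<ge> 1" using L by (simp_all add: Q_def)
  have Bne: "B \<noteq> {}" using Suc.hyps(2) by auto
  \<comment> \<open>Children lie one level above their parent, so a vertex of maximal level is
    nobody's parent within \<open>B\<close>.\<close>
  have "Max (lev ` B) \<in> lev ` B" using Bne Suc.prems(1) by (intro Max_in) auto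
  then obtain z where z: "z \<in> B" "Max (lev ` B) = lev z" by auto
  have zmax: "lev x \<le> lev z" if "x \<in> B" for x using that Suc.prems(1) by (simp flip: z(2))
  define B' where "B' = B - {z}"
  have B: "B = insert z B'" "z \<notin> B'" "finite B'" using z Suc.prems(1) by (auto simp: B'_def)
  have cB': "n = card B'" using Suc.hyps(2) B by simp
  have pos: "w \<sigma> > 0" for \<sigma> using Suc.prems(3) by (auto simp: forest_weight_def)
  have top: "par x \<noteq> z" if "x \<in> B'" "lev x \<ge> 1" for x
    using Suc.prems(2)[of x] zmax[of x] that B(1) by auto
  have fw': "forest_weight par lev L B' (marg z w)"
    using forest_weight_marg[OF Suc.prems(3)[unfolded B(1)] B(2) top] .
  define f' where "f' = heat w z f"
  define T where "T x = (\<Sum>\<sigma>\<in>block (B' - {x}) \<eta>. site_var (marg z w) x f' \<sigma>)" for x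
  define D where "D x = (\<Sum>\<sigma>\<in>block (B - {x}) \<eta>. site_var w x f \<sigma>)" for x
  define e where "e = chain_kids par lev B"
  define e' where "e' = chain_kids par lev B'"
  have D0: "D x \<ge> 0" for x unfolding D_def by (intro sum_nonneg site_var_nonneg pos)
  have IH: "sum (marg z w) (block B' \<eta>) * (\<Sum>\<sigma>\<in>block B' \<eta>. marg z w \<sigma> * (f' \<sigma>)\<^sup>2) - (\<Sum>\<sigma>\<in>block B' \<eta>. marg z w \<sigma> * f' \<sigma>)\<^sup>2
    \<le> sum (marg z w) (block B' \<eta>) * (\<Sum>x\<in>B'. Q ^ e' x * T x)"
    unfolding T_def e'_def Q_def by (rule Suc.hyps(1)[OF cB' B(3) _ fw']) (use Suc.prems(2) B in auto)
  have s1: "sum w (block B \<eta>) = sum (marg z w) (block B' \<eta>)"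
    unfolding B(1) by (subst sum_block_insert) (use B in \<open>auto simp: marg_def\<close>)
  have ne: "w (\<sigma>(z := 1)) + w (\<sigma>(z := -1)) \<noteq> 0" for \<sigma>
    using pos[of "\<sigma>(z := 1)"] pos[of "\<sigma>(z := -1)"] by simp
  have s2: "(\<Sum>\<sigma>\<in>block B \<eta>. w \<sigma> * f \<sigma>) = (\<Sum>\<sigma>\<in>block B' \<eta>. marg z w \<sigma> * f' \<sigma>)"
    unfolding B(1) by (subst sum_block_insert) (use B ne in \<open>auto simp: marg_def f'_def heat_def\<close>)
  \<comment> \<open>The law of total variance: mass and mean pass unchanged to the marginal on
    \<open>B'\<close>, and the second moment loses exactly the site variance at
    \<open>z\<close>.\<close>
  have s3: "(\<Sum>\<sigma>\<in>block B \<eta>. w \<sigma> * (f \<sigma>)\<^sup>2) = (\<Sum>\<sigma>\<in>block B' \<eta>. marg z w \<sigma> * (f' \<sigma>)\<^sup>2) + D z"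
  proof -
    have "(\<Sum>\<sigma>\<in>block B \<eta>. w \<sigma> * (f \<sigma>)\<^sup>2) = (\<Sum>\<sigma>\<in>block B' \<eta>. marg z w \<sigma> * (f' \<sigma>)\<^sup>2 + site_var w z f \<sigma>)"
      unfolding B(1) by (subst sum_block_insert)
        (use B two_point_var[OF pos pos] in \<open>auto simp: marg_def f'_def heat_def site_var_def\<close>)
    moreover have "B - {z} = B'" using B by auto
    ultimately show ?thesis by (simp add: sum.distrib D_def)
  qed
  have De: "D x = (\<Sum>\<sigma>\<in>block (B' - {x}) \<eta>. site_var w x f (\<sigma>(z := 1)) + site_var w x f (\<sigma>(z := -1)))" if "x \<in> B'" for x
  proof -
    have "B - {x} = insert z (B' - {x})" using that B by auto
    thus ?thesis unfolding D_def by (simp only:) (subst sum_block_insert, use B in auto)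
  qed
  have Dz: "D z = (\<Sum>\<sigma>\<in>block (B' - {x}) \<eta>. site_var w z f (\<sigma>(x := 1)) + site_var w z f (\<sigma>(x := -1)))" if "x \<in> B'" for x
  proof -
    have "B - {z} = insert x (B' - {x})" using that B by auto
    thus ?thesis unfolding D_def by (simp only:) (subst sum_block_insert, use B in auto)
  qed
  have Tindep: "T x \<le> D x" if x: "x \<in> B'" "\<not> (lev z \<ge> 1 \<and> par z = x)" for x
    unfolding De[OF x(1)] T_def f'_def
  proof (intro sum_mono site_var_marg_indep pos)
    show "x \<noteq> z" using x B by auto
    show "cross_ratio w x z \<sigma> = 1" for \<sigma>
      by (rule forest_weightD(3)[OF Suc.prems(3)]) (use x top[of x] B in auto)
  qed
  have Tdep: "T x \<le> (5 + 4 * L) * (D x + D z)" if x: "x \<in> B'" for x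
    unfolding De[OF x(1)] Dz[OF x] T_def f'_def sum.distrib[symmetric] sum_distrib_left
  proof (intro sum_mono site_var_marg_dep pos L)
    show "x \<noteq> z" using x B by auto
    thus "cross_ratio w x z \<sigma> \<le> L" "1 \<le> L * cross_ratio w x z \<sigma>" for \<sigma>
      using x B(1) by (auto intro!: forest_weightD[OF Suc.prems(3)])
  qed
  have ee: "e' x \<le> e x" for x unfolding e_def e'_def using Suc.prems(1) B(1) by (intro chain_kids_mono) auto
  have Qe: "Q ^ e' x \<le> Q ^ e x" for x using Q ee by (intro power_increasing) auto
  have key: "(\<Sum>x\<in>B'. Q ^ e' x * T x) + D z \<le> (\<Sum>x\<in>B. Q ^ e x * D x)"
  proof (cases "lev z \<ge> 1 \<and> par z \<in> B'")
    case False
    have "(\<Sum>x\<in>B'. Q ^ e' x * T x) \<le> (\<Sum>x\<in>B'. Q ^ e x * D x)"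
    proof (rule sum_mono)
      fix x assume x: "x \<in> B'"
      hence "Q ^ e' x * T x \<le> Q ^ e' x * D x" using False Q by (intro mult_left_mono Tindep) auto
      also have "\<dots> \<le> Q ^ e x * D x" using Qe D0 by (intro mult_right_mono) auto
      finally show "Q ^ e' x * T x \<le> Q ^ e x * D x" .
    qed
    moreover have "D z \<le> Q ^ e z * D z"
      using mult_right_mono[OF one_le_power[OF Q(2), of "e z"] D0[of z]] by simp
    ultimately show ?thesis unfolding B(1) using B by simp
  next
    case True
    define y where "y = par z"
    have y: "y \<in> B'" "lev z \<ge> 1" using True by (auto simp: y_def)
    have levz: "lev z = Suc (lev y)" using Suc.prems(2)[OF z(1) y(2)] by (simp add: y_def)
    \<comment> \<open>The new child raises the exponent of its parent \<open>y\<close> by one. This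
      additional factor \<open>Q\<close> absorbs the \<open>5 + 4 * L\<close> that
      \<open>Tdep\<close> costs at \<open>y\<close>.\<close>
    have "Suc (kids par lev B' y) \<le> kids par lev B y"
    proof -
      have "{x \<in> B. lev x \<ge> 1 \<and> par x = y} = insert z {x \<in> B'. lev x \<ge> 1 \<and> par x = y}"
        using B y by (auto simp: y_def)
      thus ?thesis unfolding kids_def using B by simp
    qed
    hence "(\<Sum>j\<le>lev y. (1 + kids par lev B' ((par ^^ j) y)) + (if j = 0 then 1 else 0)) \<le> e y"
      unfolding e_def chain_kids_def using Suc.prems(1) B(1)
      by (intro sum_mono) (auto intro!: kids_mono)
    hence ey: "Suc (e' y) \<le> e y" unfolding e'_def chain_kids_def sum.distrib by simp
    have "e z = 1 + kids par lev B z + e y"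
      unfolding e_def chain_kids_def levz sum.atMost_Suc_shift by (simp add: funpow_swap1 y_def)
    hence ez: "Suc (e y) \<le> e z" by simp
    have Qy: "Q ^ e' y * (5 + 4 * L) \<le> Q ^ e y"
    proof -
      have "Q ^ e' y * (5 + 4 * L) \<le> Q ^ e' y * Q" using Q L by (intro mult_left_mono) auto
      also have "\<dots> \<le> Q ^ e y" using power_increasing[OF ey Q(2)] by (simp add: mult.commute)
      finally show ?thesis .
    qed
    \<comment> \<open>\<open>D z\<close> has to be paid for twice, once for summing out
      \<open>z\<close> and once for what \<open>y\<close> passes on. The exponent of
      \<open>z\<close> exceeds that of \<open>y\<close>, and one more factor
      \<open>Q \<ge> 2\<close> covers both.\<close>
    have Qz: "Q ^ e' y * (5 + 4 * L) + 1 \<le> Q ^ e z"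
    proof -
      have "1 \<le> Q ^ e y" using Q by simp
      hence "Q ^ e' y * (5 + 4 * L) + 1 \<le> 2 * Q ^ e y" using Qy by linarith
      also have "\<dots> \<le> Q * Q ^ e y" using Q L by (intro mult_right_mono) auto
      also have "\<dots> \<le> Q ^ e z" using power_increasing[OF ez Q(2)] by simp
      finally show ?thesis .
    qed
    have "(\<Sum>x\<in>B'. Q ^ e' x * T x) \<le> (\<Sum>x\<in>B'. Q ^ e x * D x + (if x = y then Q ^ e' y * (5 + 4 * L) * D z else 0))"
    proof (rule sum_mono)
      fix x assume x: "x \<in> B'"
      show "Q ^ e' x * T x \<le> Q ^ e x * D x + (if x = y then Q ^ e' y * (5 + 4 * L) * D z else 0)"
      proof (cases "x = y")
        case True
        have "Q ^ e' y * T y \<le> Q ^ e' y * ((5 + 4 * L) * (D y + D z))"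
          using Q by (intro mult_left_mono Tdep y) auto
        also have "\<dots> = Q ^ e' y * (5 + 4 * L) * D y + Q ^ e' y * (5 + 4 * L) * D z"
          by (simp add: algebra_simps)
        also have "\<dots> \<le> Q ^ e y * D y + Q ^ e' y * (5 + 4 * L) * D z"
          using mult_right_mono[OF Qy D0[of y]] by simp
        finally show ?thesis using True by simp
      next
        case False
        hence "Q ^ e' x * T x \<le> Q ^ e' x * D x" using Q x by (intro mult_left_mono Tindep) (auto simp: y_def)
        also have "\<dots> \<le> Q ^ e x * D x" using Qe D0 by (intro mult_right_mono) auto
        finally show ?thesis using False by simp
      qed
    qed
    also have "\<dots> = (\<Sum>x\<in>B'. Q ^ e x * D x) + Q ^ e' y * (5 + 4 * L) * D z"
      using y B by (simp add: sum.distrib)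
    finally have "(\<Sum>x\<in>B'. Q ^ e' x * T x) + D z \<le> (\<Sum>x\<in>B'. Q ^ e x * D x) + (Q ^ e' y * (5 + 4 * L) + 1) * D z"
      by (simp add: algebra_simps)
    also have "\<dots> \<le> (\<Sum>x\<in>B'. Q ^ e x * D x) + Q ^ e z * D z"
      using mult_right_mono[OF Qz D0[of z]] by simp
    finally show ?thesis unfolding B(1) using B by (simp add: add.commute)
  qed
  have Z0: "sum w (block B \<eta>) \<ge> 0" using pos by (intro sum_nonneg) (auto simp: less_imp_le)
  have "sum w (block B \<eta>) * (\<Sum>\<sigma>\<in>block B \<eta>. w \<sigma> * (f \<sigma>)\<^sup>2) - (\<Sum>\<sigma>\<in>block B \<eta>. w \<sigma> * f \<sigma>)\<^sup>2
     \<le> sum w (block B \<eta>) * ((\<Sum>x\<in>B'. Q ^ e' x * T x) + D z)"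
    using IH unfolding s3 s2 s1 by (simp add: algebra_simps)
  also have "\<dots> \<le> sum w (block B \<eta>) * (\<Sum>x\<in>B. Q ^ e x * D x)"
    by (intro mult_left_mono key Z0)
  finally show ?case unfolding e_def D_def Q_def .
qed

section \<open>Relaxation and influence inside a block\<close>

text \<open>The action on observables of a step that picks one of \<open>n\<close> sites uniformly
  and does nothing if the site lies outside \<open>B\<close>. For \<open>B = V\<close> and
  \<open>n = card V\<close> this is the Glauber step; for smaller \<open>B\<close> it is the
  censored dynamics, with the spins outside \<open>B\<close> frozen.\<close>

definition block_kernel ::
  "(('a \<Rightarrow> real) \<Rightarrow> real) \<Rightarrow> nat \<Rightarrow> 'a set \<Rightarrow> (('a \<Rightarrow> real) \<Rightarrow> real) \<Rightarrow> ('a \<Rightarrow> real) \<Rightarrow> real" where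
  "block_kernel w n B f \<sigma> = ((\<Sum>x\<in>B. heat w x f \<sigma>) + (real n - real (card B)) * f \<sigma>) / real n"

lemma heat_upd: "heat w x f (\<sigma>(x := c)) = heat w x f \<sigma>"
  by (simp add: heat_def)

lemma heat_diff_const:
  assumes "\<And>\<sigma>. w \<sigma> > 0"
  shows "heat w x (\<lambda>\<sigma>. f \<sigma> - c) \<sigma> = heat w x f \<sigma> - c"
proof -
  have "w (\<sigma>(x := 1)) + w (\<sigma>(x := -1)) > 0" using assms by (simp add: add_pos_pos)
  thus ?thesis by (simp add: heat_def field_simps)
qed

text \<open>\<open>heat w x\<close> is the orthogonal projection onto the functions that do not
  depend on the spin at \<open>x\<close>: it keeps the mean, and by Pythagoras the second moment
  drops by the site variance.\<close>

lemma sum_heat: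
  assumes pos: "\<And>\<sigma>. w \<sigma> > 0" and "finite B" "x \<in> B"
  shows "(\<Sum>\<sigma>\<in>block B \<eta>. w \<sigma> * heat w x f \<sigma>) = (\<Sum>\<sigma>\<in>block B \<eta>. w \<sigma> * f \<sigma>)"
    "(\<Sum>\<sigma>\<in>block B \<eta>. w \<sigma> * (heat w x f \<sigma>)\<^sup>2) =
     (\<Sum>\<sigma>\<in>block B \<eta>. w \<sigma> * (f \<sigma>)\<^sup>2) - (\<Sum>\<sigma>\<in>block (B - {x}) \<eta>. site_var w x f \<sigma>)"
proof -
  have B: "B = insert x (B - {x})" using assms by auto
  have ne: "w (\<sigma>(x := 1)) + w (\<sigma>(x := -1)) > 0" for \<sigma> using pos by (simp add: add_pos_pos)
  have split: "sum F (block B \<eta>) = (\<Sum>\<sigma>\<in>block (B - {x}) \<eta>. F (\<sigma>(x := 1)) + F (\<sigma>(x := -1)))" for F :: "_ \<Rightarrow> real"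
    by (subst B, subst sum_block_insert) (use assms in auto)
  show "(\<Sum>\<sigma>\<in>block B \<eta>. w \<sigma> * heat w x f \<sigma>) = (\<Sum>\<sigma>\<in>block B \<eta>. w \<sigma> * f \<sigma>)"
    unfolding split heat_upd distrib_right[symmetric] using ne
    by (intro sum.cong refl) (simp add: heat_def less_imp_neq[symmetric])
  have "w (\<sigma>(x := 1)) * (f (\<sigma>(x := 1)))\<^sup>2 + w (\<sigma>(x := -1)) * (f (\<sigma>(x := -1)))\<^sup>2
      = (w (\<sigma>(x := 1)) + w (\<sigma>(x := -1))) * (heat w x f \<sigma>)\<^sup>2 + site_var w x f \<sigma>" for \<sigma>
    unfolding heat_def site_var_def by (rule two_point_var[OF pos pos])
  thus "(\<Sum>\<sigma>\<in>block B \<eta>. w \<sigma> * (heat w x f \<sigma>)\<^sup>2) =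
     (\<Sum>\<sigma>\<in>block B \<eta>. w \<sigma> * (f \<sigma>)\<^sup>2) - (\<Sum>\<sigma>\<in>block (B - {x}) \<eta>. site_var w x f \<sigma>)"
    unfolding split heat_upd distrib_right[symmetric] by (simp add: sum.distrib)
qed

lemma square_avg_le:
  fixes a :: "'a \<Rightarrow> real"
  assumes "finite B" "card B \<le> n" "n > 0"
  shows "(((\<Sum>x\<in>B. a x) + (real n - real (card B)) * b) / real n)\<^sup>2
     \<le> ((\<Sum>x\<in>B. (a x)\<^sup>2) + (real n - real (card B)) * b\<^sup>2) / real n"
proof -
  define u where "u = ((\<Sum>x\<in>B. a x) + (real n - real (card B)) * b) / real n"
  have un: "real n * u = (\<Sum>x\<in>B. a x) + (real n - real (card B)) * b"
    using assms by (simp add: u_def)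
  have tan: "2 * y * u - u\<^sup>2 \<le> y\<^sup>2" for y
    using zero_le_power2[of "y - u"] by (simp add: power2_eq_square algebra_simps)
  have "(\<Sum>x\<in>B. 2 * a x * u - u\<^sup>2) + (real n - real (card B)) * (2 * b * u - u\<^sup>2)
     \<le> (\<Sum>x\<in>B. (a x)\<^sup>2) + (real n - real (card B)) * b\<^sup>2"
    using assms by (intro add_mono sum_mono mult_left_mono tan) auto
  also have "(\<Sum>x\<in>B. 2 * a x * u - u\<^sup>2) + (real n - real (card B)) * (2 * b * u - u\<^sup>2)
     = 2 * u * ((\<Sum>x\<in>B. a x) + (real n - real (card B)) * b) - real n * u\<^sup>2"
    by (simp add: sum_subtractf sum_distrib_left sum_distrib_right algebra_simps)
  also have "\<dots> = real n * u\<^sup>2" unfolding un[symmetric] by (simp add: power2_eq_square)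
  finally show ?thesis using assms unfolding u_def[symmetric]
    by (simp add: pos_le_divide_eq mult.commute)
qed

text \<open>By Jensen and \<open>sum_heat\<close>, one step takes at least \<open>D / n\<close> from
  the second moment of the centred observable, and the Poincare inequality turns this into the
  factor \<open>1 - 1 / (n * W)\<close>. Keeping only the term of \<open>\<eta>\<close> makes the
  bound pointwise, at the price of the weight of the block relative to
  \<open>w \<eta>\<close>.\<close>

lemma block_relaxation:
  assumes pos: "\<And>\<sigma>. w \<sigma> > 0" and fin: "finite B" "card B \<le> n" "n > 0" and W: "W \<ge> 1"
    and poincare: "\<And>f. block_var w B \<eta> f \<le> sum w (block B \<eta>) * dirichlet w B (\<lambda>_. W) \<eta> f"
    and \<eta>: "\<eta> \<in> block B \<eta>" and f1: "\<And>\<sigma>. \<sigma> \<in> block B \<eta> \<Longrightarrow> \<bar>f \<sigma>\<bar> \<le> 1"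
  shows "w \<eta> * ((block_kernel w n B ^^ t) f \<eta> - (\<Sum>\<sigma>\<in>block B \<eta>. w \<sigma> * f \<sigma>) / sum w (block B \<eta>))\<^sup>2
    \<le> (1 - 1 / (real n * W)) ^ t * sum w (block B \<eta>)"
proof -
  define Z where "Z = sum w (block B \<eta>)"
  define m where "m = (\<Sum>\<sigma>\<in>block B \<eta>. w \<sigma> * f \<sigma>) / Z"
  define h where "h t = (\<lambda>\<sigma>. (block_kernel w n B ^^ t) f \<sigma> - m)" for t
  have Z: "Z > 0" unfolding Z_def using pos fin \<eta> by (intro sum_pos) auto
  have ne: "w (\<sigma>(x := 1)) + w (\<sigma>(x := -1)) > 0" for \<sigma> x using pos by (simp add: add_pos_pos)
  have hS: "h (Suc t) = block_kernel w n B (h t)" for t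
    using fin by (simp add: h_def block_kernel_def fun_eq_iff heat_diff_const[OF pos] sum_subtractf field_simps)
  have mean0: "(\<Sum>\<sigma>\<in>block B \<eta>. w \<sigma> * h t \<sigma>) = 0" for t
  proof (induction t)
    case 0
    have "(\<Sum>\<sigma>\<in>block B \<eta>. w \<sigma> * h 0 \<sigma>) = (\<Sum>\<sigma>\<in>block B \<eta>. w \<sigma> * f \<sigma>) - Z * m"
      by (simp add: h_def right_diff_distrib sum_subtractf sum_distrib_right Z_def)
    thus ?case using Z by (simp add: m_def)
  next
    case (Suc t)
    have "(\<Sum>\<sigma>\<in>block B \<eta>. w \<sigma> * h (Suc t) \<sigma>) =
      (\<Sum>\<sigma>\<in>block B \<eta>. ((\<Sum>x\<in>B. w \<sigma> * heat w x (h t) \<sigma>) + (real n - real (card B)) * (w \<sigma> * h t \<sigma>)) / real n)"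
      unfolding hS block_kernel_def by (simp add: sum_distrib_left algebra_simps)
    also have "\<dots> = ((\<Sum>x\<in>B. \<Sum>\<sigma>\<in>block B \<eta>. w \<sigma> * heat w x (h t) \<sigma>)
       + (real n - real (card B)) * (\<Sum>\<sigma>\<in>block B \<eta>. w \<sigma> * h t \<sigma>)) / real n"
      by (subst sum.swap) (simp add: sum_divide_distrib[symmetric] sum.distrib sum_distrib_left)
    also have "\<dots> = 0" using Suc by (simp add: sum_heat(1)[OF pos fin(1)])
    finally show ?case .
  qed
  define \<gamma> where "\<gamma> = 1 - 1 / (real n * W)"
  have g0: "\<gamma> \<ge> 0" using W fin by (simp add: \<gamma>_def field_simps) (smt (verit) mult_le_cancel_left1 of_nat_1 of_nat_mono Suc_leI One_nat_def)
  have step: "(\<Sum>\<sigma>\<in>block B \<eta>. w \<sigma> * (h (Suc t) \<sigma>)\<^sup>2) \<le> \<gamma> * (\<Sum>\<sigma>\<in>block B \<eta>. w \<sigma> * (h t \<sigma>)\<^sup>2)" for t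
  proof -
    define S where "S = (\<Sum>\<sigma>\<in>block B \<eta>. w \<sigma> * (h t \<sigma>)\<^sup>2)"
    define D where "D = (\<Sum>x\<in>B. \<Sum>\<sigma>\<in>block (B - {x}) \<eta>. site_var w x (h t) \<sigma>)"
    have SD: "S \<le> W * D"
      using poincare[of "h t"] Z
      by (simp add: block_var_def dirichlet_def mean0 S_def D_def flip: Z_def sum_distrib_left)
    have "(\<Sum>\<sigma>\<in>block B \<eta>. w \<sigma> * (h (Suc t) \<sigma>)\<^sup>2)
      \<le> (\<Sum>\<sigma>\<in>block B \<eta>. w \<sigma> * (((\<Sum>x\<in>B. (heat w x (h t) \<sigma>)\<^sup>2) + (real n - real (card B)) * (h t \<sigma>)\<^sup>2) / real n))"
      unfolding hS block_kernel_def using pos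
      by (intro sum_mono mult_left_mono square_avg_le fin) (auto simp: less_imp_le)
    also have "\<dots> = (\<Sum>\<sigma>\<in>block B \<eta>. ((\<Sum>x\<in>B. w \<sigma> * (heat w x (h t) \<sigma>)\<^sup>2) + (real n - real (card B)) * (w \<sigma> * (h t \<sigma>)\<^sup>2)) / real n)"
      by (simp add: sum_distrib_left algebra_simps)
    also have "\<dots> = ((\<Sum>x\<in>B. \<Sum>\<sigma>\<in>block B \<eta>. w \<sigma> * (heat w x (h t) \<sigma>)\<^sup>2)
       + (real n - real (card B)) * S) / real n"
      unfolding S_def by (subst sum.swap) (simp add: sum_divide_distrib[symmetric] sum.distrib sum_distrib_left)
    also have "\<dots> = S - D / real n"
      using fin by (simp add: sum_heat(2)[OF pos fin(1)] sum_subtractf S_def[symmetric] D_def[symmetric] field_simps)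
    also have "\<dots> \<le> \<gamma> * S"
      using SD W fin by (simp add: \<gamma>_def field_simps)
    finally show ?thesis unfolding S_def .
  qed
  have dec: "(\<Sum>\<sigma>\<in>block B \<eta>. w \<sigma> * (h t \<sigma>)\<^sup>2) \<le> \<gamma> ^ t * (\<Sum>\<sigma>\<in>block B \<eta>. w \<sigma> * (h 0 \<sigma>)\<^sup>2)" for t
  proof (induction t)
    case (Suc t)
    show ?case using step[of t] mult_left_mono[OF Suc g0] by (simp add: mult.assoc)
  qed simp
  have base: "(\<Sum>\<sigma>\<in>block B \<eta>. w \<sigma> * (h 0 \<sigma>)\<^sup>2) \<le> Z"
  proof -
    have "(\<Sum>\<sigma>\<in>block B \<eta>. w \<sigma> * (h 0 \<sigma>)\<^sup>2) = (\<Sum>\<sigma>\<in>block B \<eta>. w \<sigma> * (f \<sigma>)\<^sup>2) - 2 * m * (\<Sum>\<sigma>\<in>block B \<eta>. w \<sigma> * f \<sigma>) + m\<^sup>2 * Z"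
      unfolding Z_def sum_distrib_left sum_subtractf[symmetric] sum.distrib[symmetric]
      by (intro sum.cong refl) (simp add: h_def power2_eq_square algebra_simps)
    also have "(\<Sum>\<sigma>\<in>block B \<eta>. w \<sigma> * f \<sigma>) = m * Z" using Z by (simp add: m_def)
    also have "(\<Sum>\<sigma>\<in>block B \<eta>. w \<sigma> * (f \<sigma>)\<^sup>2) - 2 * m * (m * Z) + m\<^sup>2 * Z \<le> (\<Sum>\<sigma>\<in>block B \<eta>. w \<sigma> * (f \<sigma>)\<^sup>2)"
      using Z by (simp add: power2_eq_square)
    also have "\<dots> \<le> (\<Sum>\<sigma>\<in>block B \<eta>. w \<sigma> * 1)"
      using f1 pos by (intro sum_mono mult_left_mono) (auto simp: abs_square_le_1 less_imp_le)
    finally show ?thesis by (simp add: Z_def)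
  qed
  have "w \<eta> * (h t \<eta>)\<^sup>2 \<le> (\<Sum>\<sigma>\<in>block B \<eta>. w \<sigma> * (h t \<sigma>)\<^sup>2)"
    using \<eta> fin pos by (intro member_le_sum) (auto simp: less_imp_le)
  also have "\<dots> \<le> \<gamma> ^ t * Z"
    using dec[of t] mult_left_mono[OF base, of "\<gamma> ^ t"] g0 by simp
  finally show ?thesis unfolding h_def m_def Z_def \<gamma>_def .
qed

section \<open>Influence of a single site on the mean spin at the root\<close>

definition mean :: "(('a \<Rightarrow> real) \<Rightarrow> real) \<Rightarrow> 'a set \<Rightarrow> ('a \<Rightarrow> real) \<Rightarrow> (('a \<Rightarrow> real) \<Rightarrow> real) \<Rightarrow> real" where
  "mean w B \<eta> f = (\<Sum>\<sigma>\<in>block B \<eta>. w \<sigma> * f \<sigma>) / sum w (block B \<eta>)"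

text \<open>Ising weights with couplings \<open>J\<close> and an unspecified field \<open>g\<close>.
  Flipping a boundary spin changes the field at its neighbours, so the inductions on influences need
  a class of weights that is closed under changes of the field.\<close>

definition ising_odds ::
  "'a set \<Rightarrow> ('a \<Rightarrow> 'a \<Rightarrow> real) \<Rightarrow> (('a \<Rightarrow> real) \<Rightarrow> real) \<Rightarrow> bool" where
  "ising_odds V J w \<longleftrightarrow> (\<forall>\<sigma>. w \<sigma> > 0) \<and>
    (\<exists>g. \<forall>x\<in>V. \<forall>\<sigma>. w (\<sigma>(x := 1)) = w (\<sigma>(x := -1)) * exp (g x + 2 * (\<Sum>y\<in>V. J x y * \<sigma> y)))"

definition tilt :: "real \<Rightarrow> 'a \<Rightarrow> (('a \<Rightarrow> real) \<Rightarrow> real) \<Rightarrow> ('a \<Rightarrow> real) \<Rightarrow> real" where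
  "tilt s x w \<sigma> = w \<sigma> * exp (s * \<sigma> x)"

lemma ising_odds_tilt:
  assumes "ising_odds V J w" shows "ising_odds V J (tilt s z w)"
proof -
  obtain g where g: "\<forall>x\<in>V. \<forall>\<sigma>. w (\<sigma>(x := 1)) = w (\<sigma>(x := -1)) * exp (g x + 2 * (\<Sum>y\<in>V. J x y * \<sigma> y))"
    using assms by (auto simp: ising_odds_def)
  have "\<forall>x\<in>V. \<forall>\<sigma>. tilt s z w (\<sigma>(x := 1)) = tilt s z w (\<sigma>(x := -1)) *
      exp ((g x + (if x = z then 2 * s else 0)) + 2 * (\<Sum>y\<in>V. J x y * \<sigma> y))"
  proof (intro ballI allI)
    fix x \<sigma> assume x: "x \<in> V"
    have "exp s = exp (-s) * exp (2 * s)" by (simp flip: exp_add)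
    thus "tilt s z w (\<sigma>(x := 1)) = tilt s z w (\<sigma>(x := -1)) *
      exp ((g x + (if x = z then 2 * s else 0)) + 2 * (\<Sum>y\<in>V. J x y * \<sigma> y))"
      using g x by (auto simp: tilt_def exp_add)
  qed
  thus ?thesis using assms unfolding ising_odds_def
    by (intro conjI exI[of _ "\<lambda>x. g x + (if x = z then 2 * s else 0)"]) (auto simp: tilt_def)
qed

text \<open>With \<open>k = exp s\<close>, the worst case is \<open>A * k = D\<close>, where the
  tilt moves the probability from \<open>1 / (1 + k)\<close> to \<open>k / (1 + k)\<close>, a
  difference of \<open>tanh (s / 2)\<close>. That it is the worst case is the inequality
  \<open>0 \<le> (A * k - D)\<^sup>2\<close>.\<close>

lemma tilt_prob_diff:
  fixes A D s :: real
  assumes "A > 0" "D > 0" "0 \<le> s" "s \<le> 2 * \<beta>"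
  shows "\<bar>A * exp s / (A * exp s + D * exp (-s)) - A / (A + D)\<bar> \<le> tanh \<beta>"
proof -
  define k where "k = exp s"
  have k: "k \<ge> 1" using assms by (simp add: k_def)
  have em: "exp (-s) = 1 / k" by (simp add: k_def exp_minus inverse_eq_divide)
  have e1: "A * exp s / (A * exp s + D * exp (-s)) = A * k\<^sup>2 / (A * k\<^sup>2 + D)"
    unfolding em using k by (simp add: k_def[symmetric] power2_eq_square field_simps)
  have den: "A * k\<^sup>2 + D > 0" "A + D > 0" using assms k by (simp_all add: add_pos_pos)
  have e2: "A * k\<^sup>2 / (A * k\<^sup>2 + D) - A / (A + D) = A * D * (k\<^sup>2 - 1) / ((A * k\<^sup>2 + D) * (A + D))"
    using den by (simp add: field_simps)
  have nn: "A * D * (k\<^sup>2 - 1) / ((A * k\<^sup>2 + D) * (A + D)) \<ge> 0"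
    using den assms k by (intro divide_nonneg_pos mult_nonneg_nonneg) auto
  have "A * D * (k + 1)\<^sup>2 \<le> (A * k\<^sup>2 + D) * (A + D)"
    using zero_le_power2[of "A * k - D"] by (simp add: power2_eq_square algebra_simps)
  hence "A * D * (k\<^sup>2 - 1) / ((A * k\<^sup>2 + D) * (A + D)) \<le> A * D * (k\<^sup>2 - 1) / (A * D * (k + 1)\<^sup>2)"
    using assms k den by (intro divide_left_mono mult_nonneg_nonneg) auto
  also have "\<dots> = (k - 1) / (k + 1)"
  proof -
    have "k\<^sup>2 - 1 = (k - 1) * (k + 1)" by (simp add: power2_eq_square algebra_simps)
    thus ?thesis using assms k by (simp add: power2_eq_square)
  qed
  also have "\<dots> = tanh (s / 2)"
  proof -
    define l where "l = exp (s/2)"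
    have k2: "k = l * l" by (simp add: k_def l_def flip: exp_add)
    have l: "l > 0" by (simp add: l_def)
    have t: "tanh (s / 2) = (l - 1 / l) / (l + 1 / l)"
      by (simp add: tanh_altdef l_def exp_minus inverse_eq_divide)
    have e: "l - 1 / l = (l * l - 1) / l" "l + 1 / l = (l * l + 1) / l"
      using l by (simp_all add: field_simps)
    have "(l * l - 1) / l / ((l * l + 1) / l) = (l * l - 1) / (l * l + 1)"
      using l by simp
    thus ?thesis unfolding t e k2 by (rule sym)
  qed
  also have "\<dots> \<le> tanh \<beta>" using assms by simp
  finally show ?thesis unfolding e1 e2 using nn by (simp only: abs_of_nonneg)
qed

text \<open>The mean is a mixture of the two conditional means given the spin at \<open>x\<close>.
  Given that spin the tilt is a constant factor, so it changes only the mixing probability, to which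
  \<open>tilt_prob_diff\<close> applies.\<close>

lemma mean_insert:
  assumes pos: "\<And>\<sigma>. w \<sigma> > 0" and B: "finite B" "x \<notin> B" and s: "0 \<le> s" "s \<le> 2 * \<beta>"
  shows "\<bar>mean (tilt s x w) (insert x B) \<eta> f - mean w (insert x B) \<eta> f\<bar>
    \<le> tanh \<beta> * \<bar>mean w B (\<eta>(x := 1)) f - mean w B (\<eta>(x := -1)) f\<bar>"
proof -
  define A where "A = sum w (block B (\<eta>(x := 1)))"
  define D where "D = sum w (block B (\<eta>(x := -1)))"
  define P where "P = mean w B (\<eta>(x := 1)) f"
  define M where "M = mean w B (\<eta>(x := -1)) f"
  have nb: "block B \<eta>' \<noteq> {}" if "finite B" for \<eta>' :: "_ \<Rightarrow> real"
    using that by (induction rule: finite_induct) (auto simp: block_insert)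
  have A: "A > 0" and D: "D > 0" unfolding A_def D_def using pos B nb by (auto intro!: sum_pos)
  have AP: "(\<Sum>\<sigma>\<in>block B (\<eta>(x := 1)). w \<sigma> * f \<sigma>) = A * P"
    and DM: "(\<Sum>\<sigma>\<in>block B (\<eta>(x := -1)). w \<sigma> * f \<sigma>) = D * M"
    using A D by (simp_all add: P_def M_def A_def D_def mean_def)
  have sx: "\<sigma> x = c" if "\<sigma> \<in> block B (\<eta>(x := c))" for \<sigma> c using that B by (auto simp: block_def)
  have tA: "(\<Sum>\<sigma>\<in>block B (\<eta>(x := c)). tilt s x w \<sigma> * F \<sigma>) = exp (s * c) * (\<Sum>\<sigma>\<in>block B (\<eta>(x := c)). w \<sigma> * F \<sigma>)" for c F
    unfolding sum_distrib_left by (intro sum.cong refl) (simp add: tilt_def sx)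
  have tA1: "(\<Sum>\<sigma>\<in>block B (\<eta>(x := c)). tilt s x w \<sigma>) = exp (s * c) * (\<Sum>\<sigma>\<in>block B (\<eta>(x := c)). w \<sigma>)" for c
    using tA[where c = c and F = "\<lambda>_. 1"] by simp
  have m1: "mean w (insert x B) \<eta> f = (A * P + D * M) / (A + D)"
    unfolding mean_def sum_block_insert'[OF B] AP DM A_def D_def by simp
  have m2: "mean (tilt s x w) (insert x B) \<eta> f = (A * exp s * P + D * exp (-s) * M) / (A * exp s + D * exp (-s))"
    unfolding mean_def sum_block_insert'[OF B] tA tA1 AP DM by (simp add: A_def D_def mult_ac)
  have conv: "(a * P + d * M) / (a + d) = M + a / (a + d) * (P - M)" if "a > 0" "d > 0" for a d
  proof -
    have "a + d \<noteq> 0" using that by simp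
    thus ?thesis by (simp add: field_simps)
  qed
  have "mean (tilt s x w) (insert x B) \<eta> f - mean w (insert x B) \<eta> f =
     (A * exp s / (A * exp s + D * exp (-s)) - A / (A + D)) * (P - M)"
  proof -
    have "(A * exp s * P + D * exp (-s) * M) / (A * exp s + D * exp (-s))
      = M + A * exp s / (A * exp s + D * exp (-s)) * (P - M)"
      using A D by (intro conv) auto
    thus ?thesis unfolding m1 m2 conv[OF A D] left_diff_distrib by simp
  qed
  thus ?thesis unfolding P_def[symmetric] M_def[symmetric]
    using tilt_prob_diff[OF A D s] by (simp add: abs_mult mult_right_mono)
qed

text \<open>Telescoping over \<open>N\<close>. The single-site bound is demanded for every weight of
  the class because the earlier tilts have already altered \<open>w\<close>.\<close>

lemma mean_multi_tilt:
  assumes single: "\<And>w y s. ising_odds V J w \<Longrightarrow> y \<in> B \<Longrightarrow> 0 \<le> s \<Longrightarrow> s \<le> 2 * \<beta> \<Longrightarrow>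
      \<bar>mean (tilt s y w) B \<eta> f - mean w B \<eta> f\<bar> \<le> bnd y"
    and "finite N" "N \<subseteq> B" and s: "\<And>y. y \<in> N \<Longrightarrow> 0 \<le> s y \<and> s y \<le> 2 * \<beta>" and w: "ising_odds V J w"
  shows "\<bar>mean (\<lambda>\<sigma>. w \<sigma> * exp (\<Sum>y\<in>N. s y * \<sigma> y)) B \<eta> f - mean w B \<eta> f\<bar> \<le> (\<Sum>y\<in>N. bnd y)"
  using assms(2,3) s w
proof (induction N arbitrary: w rule: finite_induct)
  case (insert y N)
  have e: "(\<lambda>\<sigma>. w \<sigma> * exp (\<Sum>y\<in>insert y N. s y * \<sigma> y)) = (\<lambda>\<sigma>. tilt (s y) y w \<sigma> * exp (\<Sum>y\<in>N. s y * \<sigma> y))"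
    using insert.hyps by (simp add: tilt_def exp_add fun_eq_iff)
  have "\<bar>mean (\<lambda>\<sigma>. tilt (s y) y w \<sigma> * exp (\<Sum>y\<in>N. s y * \<sigma> y)) B \<eta> f - mean (tilt (s y) y w) B \<eta> f\<bar> \<le> (\<Sum>y\<in>N. bnd y)"
    using insert.prems by (intro insert.IH ising_odds_tilt) auto
  moreover have "\<bar>mean (tilt (s y) y w) B \<eta> f - mean w B \<eta> f\<bar> \<le> bnd y"
    using insert.prems by (intro single) auto
  ultimately show ?case unfolding e using insert.hyps by simp
qed simp

text \<open>Turning the boundary spin at \<open>x\<close> from minus to plus multiplies all weights
  of the block by a common constant and adds \<open>2 * J x y\<close> to the field at each neighbour
  \<open>y\<close>. This is where the range \<open>0 \<le> s \<le> 2 * \<beta>\<close> of the tilts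
  comes from.\<close>

lemma mean_flip:
  assumes single: "\<And>w y s. ising_odds V J w \<Longrightarrow> y \<in> B \<Longrightarrow> 0 \<le> s \<Longrightarrow> s \<le> 2 * \<beta> \<Longrightarrow>
      \<bar>mean (tilt s y w) B (\<eta>(x := -1)) f - mean w B (\<eta>(x := -1)) f\<bar> \<le> bnd y"
    and J: "\<And>x y. 0 \<le> J x y" "\<And>x y. J x y \<le> \<beta>" "\<And>x. J x x = 0"
    and fin: "finite V" and BV: "B \<subseteq> V" and x: "x \<in> V" "x \<notin> B" and w: "ising_odds V J w"
    and f: "\<And>\<sigma>. f (\<sigma>(x := 1)) = f \<sigma>"
  shows "\<bar>mean w B (\<eta>(x := 1)) f - mean w B (\<eta>(x := -1)) f\<bar> \<le> (\<Sum>y | y \<in> B \<and> J x y \<noteq> 0. bnd y)"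
proof -
  define N where "N = {y. y \<in> B \<and> J x y \<noteq> 0}"
  have finB: "finite B" using fin BV by (rule rev_finite_subset)
  obtain g where g: "\<And>\<sigma>. w (\<sigma>(x := 1)) = w (\<sigma>(x := -1)) * exp (g x + 2 * (\<Sum>y\<in>V. J x y * \<sigma> y))"
    using w x by (auto simp: ising_odds_def)
  define C where "C = exp (g x + 2 * (\<Sum>y\<in>V-B. J x y * \<eta> y))"
  have im: "block B (\<eta>(x := 1)) = (\<lambda>\<sigma>. \<sigma>(x := 1)) ` block B (\<eta>(x := -1))"
  proof (rule set_eqI, rule iffI)
    fix \<sigma> assume s: "\<sigma> \<in> block B (\<eta>(x := 1))"
    have "\<sigma>(x := -1) \<in> block B (\<eta>(x := -1))" "\<sigma> = (\<sigma>(x := -1))(x := 1)"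
      using s x(2) by (auto simp: block_def)
    thus "\<sigma> \<in> (\<lambda>\<sigma>. \<sigma>(x := 1)) ` block B (\<eta>(x := -1))" by blast
  next
    fix \<sigma> assume "\<sigma> \<in> (\<lambda>\<sigma>. \<sigma>(x := 1)) ` block B (\<eta>(x := -1))"
    then obtain \<tau> where t: "\<tau> \<in> block B (\<eta>(x := -1))" "\<sigma> = \<tau>(x := 1)" by blast
    have "\<forall>y\<in>B. y \<noteq> x" using x(2) by blast
    thus "\<sigma> \<in> block B (\<eta>(x := 1))" unfolding t(2) using t(1) by (simp add: block_def)
  qed
  have re: "sum F (block B (\<eta>(x := 1))) = (\<Sum>\<sigma>\<in>block B (\<eta>(x := -1)). F (\<sigma>(x := 1)))" for F :: "_ \<Rightarrow> real"
    unfolding im by (subst sum.reindex) (auto intro!: inj_on_upd_block[OF x(2)])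
  have ww: "w (\<sigma>(x := 1)) = C * (w \<sigma> * exp (\<Sum>y\<in>N. (2 * J x y) * \<sigma> y))" if s: "\<sigma> \<in> block B (\<eta>(x := -1))" for \<sigma>
  proof -
    have "\<sigma> x = -1" using s x(2) by (auto simp: block_def)
    hence sx: "\<sigma>(x := -1) = \<sigma>" by (simp add: fun_upd_idem)
    have off: "\<sigma> y = \<eta> y" if "y \<notin> B" "y \<noteq> x" for y using s that by (auto simp: block_def)
    have "(\<Sum>y\<in>V. J x y * \<sigma> y) = (\<Sum>y\<in>V-B. J x y * \<sigma> y) + (\<Sum>y\<in>B. J x y * \<sigma> y)"
      using BV fin by (subst sum.subset_diff[of B V]) auto
    also have "(\<Sum>y\<in>V-B. J x y * \<sigma> y) = (\<Sum>y\<in>V-B. J x y * \<eta> y)"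
    proof (intro sum.cong refl)
      show "J x y * \<sigma> y = J x y * \<eta> y" if "y \<in> V - B" for y
        using that off[of y] J(3) by (cases "y = x") auto
    qed
    also have "(\<Sum>y\<in>B. J x y * \<sigma> y) = (\<Sum>y\<in>N. J x y * \<sigma> y)"
      unfolding N_def using finB by (intro sum.mono_neutral_right) auto
    finally show ?thesis using g[of \<sigma>] unfolding sx
      by (simp add: C_def exp_add sum_distrib_left mult_ac ring_distribs)
  qed
  have "mean w B (\<eta>(x := 1)) f = mean (\<lambda>\<sigma>. w \<sigma> * exp (\<Sum>y\<in>N. (2 * J x y) * \<sigma> y)) B (\<eta>(x := -1)) f"
  proof -
    have "C \<noteq> 0" by (simp add: C_def)
    moreover have "(\<Sum>\<sigma>\<in>block B (\<eta>(x := 1)). w \<sigma> * f \<sigma>)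
      = C * (\<Sum>\<sigma>\<in>block B (\<eta>(x := -1)). w \<sigma> * exp (\<Sum>y\<in>N. (2 * J x y) * \<sigma> y) * f \<sigma>)"
      unfolding re sum_distrib_left using f by (intro sum.cong refl) (simp add: ww mult_ac)
    moreover have "sum w (block B (\<eta>(x := 1))) = C * (\<Sum>\<sigma>\<in>block B (\<eta>(x := -1)). w \<sigma> * exp (\<Sum>y\<in>N. (2 * J x y) * \<sigma> y))"
      unfolding re sum_distrib_left by (intro sum.cong refl) (simp add: ww mult_ac)
    ultimately show ?thesis by (simp add: mean_def)
  qed
  moreover have "\<bar>mean (\<lambda>\<sigma>. w \<sigma> * exp (\<Sum>y\<in>N. (2 * J x y) * \<sigma> y)) B (\<eta>(x := -1)) f - mean w B (\<eta>(x := -1)) f\<bar> \<le> (\<Sum>y\<in>N. bnd y)"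
    by (rule mean_multi_tilt[where V = V and J = J and \<beta> = \<beta>]) (use single finB J w in \<open>auto simp: N_def\<close>)
  ultimately show ?thesis unfolding N_def by simp
qed

text \<open>Conditioning on the spin at \<open>x\<close> splits the forest, and of the neighbours of \<open>x\<close> only the parent
  remains connected to \<open>v\<close>. So the influence of \<open>x\<close> loses a factor \<open>tanh \<beta>\<close> per level.\<close>

lemma mean_tilt_forest:
  assumes fin: "finite V" and J: "\<And>x y. 0 \<le> J x y" "\<And>x y. J x y \<le> \<beta>" "\<And>x. J x x = 0"
    and BV: "B \<subseteq> V" and w: "ising_odds V J w"
    and lev0: "lev v = 0" "\<And>x. x \<in> B \<Longrightarrow> lev x = 0 \<Longrightarrow> x = v"
    and lev: "\<And>x. x \<in> B \<Longrightarrow> lev x \<ge> 1 \<Longrightarrow> lev x = Suc (lev (par x))"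
    and adj: "\<And>x y. x \<in> B \<Longrightarrow> y \<in> B \<Longrightarrow> J x y \<noteq> 0 \<Longrightarrow> (lev x \<ge> 1 \<and> y = par x) \<or> (lev y \<ge> 1 \<and> x = par y)"
    and x: "x \<in> B" and s: "0 \<le> s" "s \<le> 2 * \<beta>"
  shows "\<bar>mean (tilt s x w) B \<eta> (\<lambda>\<sigma>. \<sigma> v) - mean w B \<eta> (\<lambda>\<sigma>. \<sigma> v)\<bar>
    \<le> (if lev x \<ge> 1 \<and> par x \<notin> B then 0 else 2 * tanh \<beta> ^ Suc (lev x))"
  using BV lev0(2) lev adj x w s
proof (induction "card B" arbitrary: B w x s \<eta> rule: less_induct)
  case less
  define B0 where "B0 = B - {x}"
  have B: "B = insert x B0" "x \<notin> B0" using less.prems by (auto simp: B0_def)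
  have finB: "finite B" using less.prems(1) fin by (rule finite_subset)
  have finB0: "finite B0" using finB by (simp add: B0_def)
  have \<beta>0: "\<beta> \<ge> 0" using J(1,2) by (rule order_trans)
  hence t0: "tanh \<beta> \<ge> 0" by simp
  have pos: "w \<sigma> > 0" for \<sigma> using less.prems by (simp add: ising_odds_def)
  have main: "\<bar>mean (tilt s x w) B \<eta> (\<lambda>\<sigma>. \<sigma> v) - mean w B \<eta> (\<lambda>\<sigma>. \<sigma> v)\<bar>
    \<le> tanh \<beta> * \<bar>mean w B0 (\<eta>(x := 1)) (\<lambda>\<sigma>. \<sigma> v) - mean w B0 (\<eta>(x := -1)) (\<lambda>\<sigma>. \<sigma> v)\<bar>"
    unfolding B(1) using mean_insert[OF pos finB0 B(2) less.prems(7,8)] .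
  show ?case
  proof (cases "x = v")
    case True
    have nb: "block B0 \<eta>' \<noteq> {}" for \<eta>' :: "_ \<Rightarrow> real"
      using finB0 by (induction rule: finite_induct) (auto simp: block_insert)
    \<comment> \<open>At the root the two conditional means are the spins 1 and -1 themselves; their
      difference is the factor 2 in the bound.\<close>
    have "mean w B0 (\<eta>(x := c)) (\<lambda>\<sigma>. \<sigma> v) = c" for c
    proof -
      have "(\<Sum>\<sigma>\<in>block B0 (\<eta>(x := c)). w \<sigma> * \<sigma> v) = (\<Sum>\<sigma>\<in>block B0 (\<eta>(x := c)). w \<sigma> * c)"
        using True B(2) by (intro sum.cong refl) (auto simp: block_def)
      moreover have "sum w (block B0 (\<eta>(x := c))) > 0" using pos finB0 nb by (intro sum_pos) auto
      ultimately show ?thesis by (simp add: mean_def flip: sum_distrib_right)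
    qed
    thus ?thesis using main lev0 True by simp
  next
    case False
    hence levx: "lev x \<ge> 1" using less.prems(2)[OF less.prems(5)] by (cases "lev x") auto
    have "\<bar>mean w B0 (\<eta>(x := 1)) (\<lambda>\<sigma>. \<sigma> v) - mean w B0 (\<eta>(x := -1)) (\<lambda>\<sigma>. \<sigma> v)\<bar>
      \<le> (\<Sum>y | y \<in> B0 \<and> J x y \<noteq> 0. if lev y \<ge> 1 \<and> par y \<notin> B0 then 0 else 2 * tanh \<beta> ^ Suc (lev y))"
    proof (rule mean_flip[where V = V and J = J and \<beta> = \<beta>])
      fix w' y s' assume "ising_odds V J w'" "y \<in> B0" "0 \<le> s'" "s' \<le> 2 * \<beta>"
      thus "\<bar>mean (tilt s' y w') B0 (\<eta>(x := -1)) (\<lambda>\<sigma>. \<sigma> v) - mean w' B0 (\<eta>(x := -1)) (\<lambda>\<sigma>. \<sigma> v)\<bar>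
        \<le> (if lev y \<ge> 1 \<and> par y \<notin> B0 then 0 else 2 * tanh \<beta> ^ Suc (lev y))"
        by (intro less.hyps) (use less.prems B finB in \<open>auto simp: card_insert_if\<close>)
    qed (use less.prems J fin False B in auto)
    also have "\<dots> \<le> (\<Sum>y | y \<in> B0 \<and> J x y \<noteq> 0. if y = par x \<and> par x \<in> B then 2 * tanh \<beta> ^ lev x else 0)"
    proof (rule sum_mono)
      fix y assume y: "y \<in> {y. y \<in> B0 \<and> J x y \<noteq> 0}"
      hence "(y = par x) \<or> (lev y \<ge> 1 \<and> x = par y)" using less.prems(4)[of x y] B less.prems(5) by auto
      thus "(if lev y \<ge> 1 \<and> par y \<notin> B0 then 0 else 2 * tanh \<beta> ^ Suc (lev y))
         \<le> (if y = par x \<and> par x \<in> B then 2 * tanh \<beta> ^ lev x else 0)"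
      proof
        assume yp: "y = par x"
        have "lev x = Suc (lev y)" using less.prems(3)[OF less.prems(5) levx] yp by simp
        thus ?thesis using yp y B t0 by auto
      next
        \<comment> \<open>A child \<open>y\<close> of \<open>x\<close> has lost its parent in
          \<open>B0\<close>, so the induction hypothesis gives it influence 0.\<close>
        assume "lev y \<ge> 1 \<and> x = par y"
        thus ?thesis using B t0 by auto
      qed
    qed
    also have "\<dots> \<le> (if par x \<in> B then 2 * tanh \<beta> ^ lev x else 0)"
    proof (cases "par x \<in> B")
      case True
      have "(\<Sum>y | y \<in> B0 \<and> J x y \<noteq> 0. if y = par x \<and> par x \<in> B then 2 * tanh \<beta> ^ lev x else 0)
        = (\<Sum>y | y \<in> B0 \<and> J x y \<noteq> 0. if y = par x then 2 * tanh \<beta> ^ lev x else 0)" using True by simp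
      also have "\<dots> \<le> 2 * tanh \<beta> ^ lev x" using finB0 t0 by (subst sum.delta) auto
      finally show ?thesis using True by simp
    qed simp
    finally have "tanh \<beta> * \<bar>mean w B0 (\<eta>(x := 1)) (\<lambda>\<sigma>. \<sigma> v) - mean w B0 (\<eta>(x := -1)) (\<lambda>\<sigma>. \<sigma> v)\<bar>
       \<le> tanh \<beta> * (if par x \<in> B then 2 * tanh \<beta> ^ lev x else 0)"
      using t0 by (rule mult_left_mono)
    with main show ?thesis using levx by (auto split: if_splits)
  qed
qed

section \<open>Monotonicity and censoring\<close>

lemma configs_iff: "\<sigma> \<in> configs V \<longleftrightarrow> (\<forall>x\<in>V. \<sigma> x = 1 \<or> \<sigma> x = -1) \<and> (\<forall>x. x \<notin> V \<longrightarrow> \<sigma> x = undefined)"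
  unfolding configs_def PiE_iff extensional_def by blast

lemma configs_eq_block: "configs V = block V (\<lambda>_. undefined)"
  unfolding set_eq_iff configs_iff block_def by simp

lemma configs_upd: "\<sigma> \<in> configs V \<Longrightarrow> x \<in> V \<Longrightarrow> c = 1 \<or> c = -1 \<Longrightarrow> \<sigma>(x := c) \<in> configs V"
  unfolding configs_iff fun_upd_apply by metis

lemma configs_val: "\<sigma> \<in> configs V \<Longrightarrow> x \<in> V \<Longrightarrow> \<sigma> x = 1 \<or> \<sigma> x = -1"
  unfolding configs_iff by simp

lemma self_in_block: "\<eta> \<in> configs V \<Longrightarrow> B \<subseteq> V \<Longrightarrow> \<eta> \<in> block B \<eta>"
  unfolding block_def by (simp add: configs_val subset_iff)

lemma block_subset_configs:
  assumes "\<eta> \<in> configs V" "B \<subseteq> V" shows "block B \<eta> \<subseteq> configs V"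
proof
  fix \<sigma> assume s: "\<sigma> \<in> block B \<eta>"
  have in': "\<sigma> x = 1 \<or> \<sigma> x = -1" if "x \<in> V" for x
    using s configs_val[OF assms(1) that] by (cases "x \<in> B") (simp_all add: block_def)
  have "\<sigma> x = undefined" if "x \<notin> V" for x
  proof -
    have "x \<notin> B" using assms(2) that by blast
    hence "\<sigma> x = \<eta> x" using s by (simp add: block_def)
    thus ?thesis using assms(1) that by (simp add: configs_iff)
  qed
  thus "\<sigma> \<in> configs V" using in' unfolding configs_iff by simp
qed

definition plus_config :: "'a set \<Rightarrow> 'a \<Rightarrow> real" where
  "plus_config V = (\<lambda>x. if x \<in> V then 1 else undefined)"

definition minus_config :: "'a set \<Rightarrow> 'a \<Rightarrow> real" where
  "minus_config V = (\<lambda>x. if x \<in> V then -1 else undefined)"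

lemma plus_config_in [simp]: "plus_config V \<in> configs V"
  and minus_config_in [simp]: "minus_config V \<in> configs V"
  by (simp_all add: plus_config_def minus_config_def configs_iff)

lemma configs_between:
  assumes "\<sigma> \<in> configs V"
  shows "\<sigma> \<le> plus_config V" "minus_config V \<le> \<sigma>"
proof -
  have "\<sigma> x \<le> plus_config V x \<and> minus_config V x \<le> \<sigma> x" for x
  proof (cases "x \<in> V")
    case True
    hence "\<sigma> x = 1 \<or> \<sigma> x = -1" using configs_val[OF assms] by simp
    thus ?thesis using True unfolding plus_config_def minus_config_def by fastforce
  next
    case False
    thus ?thesis using assms unfolding configs_iff by (simp add: plus_config_def minus_config_def)
  qed
  thus "\<sigma> \<le> plus_config V" "minus_config V \<le> \<sigma>" by (simp_all add: le_fun_def)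
qed

lemma mono_on_configs_flipI:
  assumes fin: "finite V"
    and flip: "\<And>\<sigma> x. \<sigma> \<in> configs V \<Longrightarrow> x \<in> V \<Longrightarrow> f (\<sigma>(x := -1)) \<le> (f (\<sigma>(x := 1)) :: real)"
  shows "mono_on (configs V) f"
proof (rule mono_onI)
  fix \<sigma> \<tau> assume "\<sigma> \<in> configs V" "\<tau> \<in> configs V" "\<sigma> \<le> \<tau>"
  thus "f \<sigma> \<le> f \<tau>"
  proof (induction "card {x\<in>V. \<sigma> x \<noteq> \<tau> x}" arbitrary: \<sigma>)
    case 0
    hence "\<forall>x\<in>V. \<sigma> x = \<tau> x" using fin by auto
    hence "\<sigma> = \<tau>" using 0(2,3) unfolding configs_def by (metis PiE_ext)
    thus ?case by simp
  next
    case (Suc k)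
    then obtain x where x: "x \<in> V" "\<sigma> x \<noteq> \<tau> x"
      by (metis (mono_tags, lifting) Collect_empty_eq card.empty nat.distinct(1))
    have vals: "\<sigma> x = 1 \<or> \<sigma> x = -1" "\<tau> x = 1 \<or> \<tau> x = -1" "\<sigma> x \<le> \<tau> x"
      using Suc.prems x by (simp_all add: configs_val le_fun_def)
    hence sx: "\<sigma> x = -1" "\<tau> x = 1" using x by auto
    have "{y\<in>V. \<sigma> y \<noteq> \<tau> y} = insert x {y\<in>V. (\<sigma>(x := 1)) y \<noteq> \<tau> y}" using x sx by auto
    moreover have "x \<notin> {y\<in>V. (\<sigma>(x := 1)) y \<noteq> \<tau> y}" using sx by simp
    ultimately have "k = card {y\<in>V. (\<sigma>(x := 1)) y \<noteq> \<tau> y}" using Suc.hyps(2) fin by simp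
    moreover have "\<sigma>(x := 1) \<le> \<tau>" using Suc.prems(3) sx by (auto simp: le_fun_def)
    ultimately have "f (\<sigma>(x := 1)) \<le> f \<tau>" using Suc.prems x by (intro Suc.hyps(1) configs_upd) auto
    moreover have "f \<sigma> \<le> f (\<sigma>(x := 1))"
      using flip[OF Suc.prems(1) x(1)] sx(1) by (metis fun_upd_triv)
    ultimately show ?case by simp
  qed
qed

lemma block_kernel_sum:
  assumes "finite I"
  shows "block_kernel w n B (\<lambda>\<sigma>. \<Sum>i\<in>I. c i * F i \<sigma>) = (\<lambda>\<sigma>. \<Sum>i\<in>I. c i * block_kernel w n B (F i) \<sigma>)"
  using assms
proof (induction rule: finite_induct)
  case empty
  show ?case by (simp add: block_kernel_def heat_def fun_eq_iff)
next
  case (insert i I)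
  have add: "block_kernel w n B (\<lambda>\<sigma>. a * f \<sigma> + g \<sigma>) \<sigma> = a * block_kernel w n B f \<sigma> + block_kernel w n B g \<sigma>" for a f g \<sigma>
  proof -
    have "heat w x (\<lambda>\<sigma>. a * f \<sigma> + g \<sigma>) \<sigma> = a * heat w x f \<sigma> + heat w x g \<sigma>" for x
      by (simp add: heat_def add_divide_distrib algebra_simps)
    thus ?thesis
      by (simp add: block_kernel_def sum.distrib sum_distrib_left add_divide_distrib diff_divide_distrib ring_distribs mult_ac)
  qed
  show ?case using insert by (simp add: add)
qed

lemma block_kernel_funpow_sum:
  assumes "finite I"
  shows "(block_kernel w n B ^^ t) (\<lambda>\<sigma>. \<Sum>i\<in>I. c i * F i \<sigma>) = (\<lambda>\<sigma>. \<Sum>i\<in>I. c i * (block_kernel w n B ^^ t) (F i) \<sigma>)"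
  by (induction t) (simp_all add: block_kernel_sum[OF assms])

lemma block_kernel_funpow_diff:
  "(block_kernel w n B ^^ t) (\<lambda>\<sigma>. f \<sigma> - g \<sigma>) \<sigma> = (block_kernel w n B ^^ t) f \<sigma> - (block_kernel w n B ^^ t) g \<sigma>"
  using block_kernel_funpow_sum[of "{True, False}" t w n B "\<lambda>b. if b then 1 else -1" "\<lambda>b. if b then f else g"]
  by (simp add: fun_eq_iff)

locale ferromagnet =
  fixes V :: "'a set" and J :: "'a \<Rightarrow> 'a \<Rightarrow> real" and w :: "('a \<Rightarrow> real) \<Rightarrow> real" and \<beta> :: real
  assumes finite_V: "finite V" and V_nonempty: "V \<noteq> {}"
    and J_nonneg: "0 \<le> J x y" and J_le: "J x y \<le> \<beta>" and J_diag: "J x x = 0"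
    and odds: "ising_odds V J w"
begin

abbreviation kernel :: "'a set \<Rightarrow> (('a \<Rightarrow> real) \<Rightarrow> real) \<Rightarrow> ('a \<Rightarrow> real) \<Rightarrow> real" where
  "kernel \<equiv> block_kernel w (card V)"

lemma w_pos: "w \<sigma> > 0"
  using odds by (simp add: ising_odds_def)

lemma w2_pos: "w (\<sigma>(x := 1)) + w (\<sigma>(x := -1)) > 0"
  using w_pos by (simp add: add_pos_pos)

lemma card_V_pos: "card V > 0"
  using finite_V V_nonempty by (simp add: card_gt_0_iff)

text \<open>Attractiveness of the dynamics: as \<open>J\<close> is nonnegative, the probability
  \<open>p\<close> of choosing plus increases with the other spins, and plus gives the larger value
  of an increasing \<open>f\<close>.\<close>

lemma heat_mono:
  assumes x: "x \<in> V" and f: "mono_on (configs V) f"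
  shows "mono_on (configs V) (heat w x f)"
proof (rule mono_onI)
  fix \<sigma> \<tau> assume s: "\<sigma> \<in> configs V" "\<tau> \<in> configs V" "\<sigma> \<le> \<tau>"
  obtain g where g: "\<And>\<sigma>. w (\<sigma>(x := 1)) = w (\<sigma>(x := -1)) * exp (g x + 2 * (\<Sum>y\<in>V. J x y * \<sigma> y))"
    using odds x by (auto simp: ising_odds_def)
  define p where "p \<sigma> = 1 - 1 / (1 + exp (g x + 2 * (\<Sum>y\<in>V. J x y * \<sigma> y)))" for \<sigma>
  have hp: "heat w x f \<sigma> = f (\<sigma>(x := -1)) + p \<sigma> * (f (\<sigma>(x := 1)) - f (\<sigma>(x := -1)))" for \<sigma>
  proof -
    define e where "e = exp (g x + 2 * (\<Sum>y\<in>V. J x y * \<sigma> y))"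
    have e: "e > 0" by (simp add: e_def)
    have "heat w x f \<sigma> = (w (\<sigma>(x := -1)) * (e * f (\<sigma>(x := 1)) + f (\<sigma>(x := -1)))) / (w (\<sigma>(x := -1)) * (e + 1))"
      unfolding heat_def g e_def[symmetric] by (simp add: algebra_simps)
    also have "\<dots> = (e * f (\<sigma>(x := 1)) + f (\<sigma>(x := -1))) / (e + 1)" using w_pos[of "\<sigma>(x := -1)"] by simp
    also have "\<dots> = f (\<sigma>(x := -1)) + p \<sigma> * (f (\<sigma>(x := 1)) - f (\<sigma>(x := -1)))"
    proof -
      have "p \<sigma> = e / (e + 1)" unfolding p_def e_def[symmetric] using e by (simp add: field_simps)
      moreover have "(e * F + G) / (e + 1) = G + e / (e + 1) * (F - G)" for F G
      proof -
        have "e + 1 \<noteq> 0" using e by simp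
        thus ?thesis by (simp add: field_simps)
      qed
      ultimately show ?thesis by simp
    qed
    finally show ?thesis .
  qed
  have "(\<Sum>y\<in>V. J x y * \<sigma> y) \<le> (\<Sum>y\<in>V. J x y * \<tau> y)"
    using s J_nonneg by (intro sum_mono mult_left_mono) (auto simp: le_fun_def)
  hence "1 + exp (g x + 2 * (\<Sum>y\<in>V. J x y * \<sigma> y)) \<le> 1 + exp (g x + 2 * (\<Sum>y\<in>V. J x y * \<tau> y))"
    by simp
  hence "p \<sigma> \<le> p \<tau>" unfolding p_def by (intro diff_left_mono divide_left_mono) (auto simp: add_pos_pos)
  moreover have "0 \<le> p \<sigma>" "p \<sigma> \<le> 1" unfolding p_def by (simp_all add: field_simps add_pos_pos)
  moreover have "f (\<sigma>(x := c)) \<le> f (\<tau>(x := c))" if "c = 1 \<or> c = -1" for c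
    using s that x by (intro mono_onD[OF f] configs_upd) (auto simp: le_fun_def)
  moreover have "f (\<tau>(x := -1)) \<le> f (\<tau>(x := 1))"
    using s x by (intro mono_onD[OF f] configs_upd) (auto simp: le_fun_def)
  moreover have "F + p * (G - F) \<le> F' + p' * (G' - F')"
    if "p \<le> p'" "0 \<le> p" "p \<le> 1" "F \<le> F'" "G \<le> G'" "F' \<le> G'" for F G F' G' p p' :: real
  proof -
    have "(1 - p) * F + p * G \<le> (1 - p) * F' + p * G'" using that by (intro add_mono mult_left_mono) auto
    moreover have "p * (G' - F') \<le> p' * (G' - F')" using that by (intro mult_right_mono) auto
    ultimately show ?thesis by (simp add: algebra_simps)
  qed
  ultimately show "heat w x f \<sigma> \<le> heat w x f \<tau>" unfolding hp by simp
qed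

lemma kernel_mono:
  assumes "B \<subseteq> V" "mono_on (configs V) f" shows "mono_on (configs V) (kernel B f)"
proof (rule mono_onI)
  fix \<sigma> \<tau> assume s: "\<sigma> \<in> configs V" "\<tau> \<in> configs V" "\<sigma> \<le> \<tau>"
  have cB: "card B \<le> card V" using assms finite_V by (intro card_mono)
  have "(\<Sum>x\<in>B. heat w x f \<sigma>) \<le> (\<Sum>x\<in>B. heat w x f \<tau>)"
    using assms s by (intro sum_mono mono_onD[OF heat_mono]) auto
  moreover have "(real (card V) - real (card B)) * f \<sigma> \<le> (real (card V) - real (card B)) * f \<tau>"
    using cB mono_onD[OF assms(2) s] by (intro mult_left_mono) auto
  ultimately show "kernel B f \<sigma> \<le> kernel B f \<tau>"
    unfolding block_kernel_def using card_V_pos by (intro divide_right_mono) auto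
qed

lemma kernel_funpow_mono:
  assumes "B \<subseteq> V" "mono_on (configs V) f" shows "mono_on (configs V) ((kernel B ^^ t) f)"
  by (induction t) (use assms kernel_mono in auto)

lemma kernel_le:
  assumes "B \<subseteq> V" "\<And>\<sigma>. \<sigma> \<in> configs V \<Longrightarrow> f \<sigma> \<le> g \<sigma>" and s: "\<sigma> \<in> configs V"
  shows "kernel B f \<sigma> \<le> kernel B g \<sigma>"
proof -
  have cB: "card B \<le> card V" using assms finite_V by (intro card_mono)
  have "heat w x f \<sigma> \<le> heat w x g \<sigma>" if "x \<in> B" for x
    unfolding heat_def using that assms w_pos w2_pos
    by (intro divide_right_mono add_mono mult_left_mono assms(2) configs_upd) (auto simp: less_imp_le)
  thus ?thesis unfolding block_kernel_def
    using assms cB by (intro divide_right_mono add_mono sum_mono mult_left_mono) auto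
qed

lemma kernel_funpow_le:
  assumes "B \<subseteq> V" "\<And>\<sigma>. \<sigma> \<in> configs V \<Longrightarrow> f \<sigma> \<le> g \<sigma>" and "\<sigma> \<in> configs V"
  shows "(kernel B ^^ t) f \<sigma> \<le> (kernel B ^^ t) g \<sigma>"
  using assms(3) by (induction t arbitrary: \<sigma>) (simp_all add: assms kernel_le)

lemma kernel_funpow_const:
  assumes "B \<subseteq> V" shows "(kernel B ^^ t) (\<lambda>_. c) = (\<lambda>_. c)"
proof -
  have h: "heat w x (\<lambda>_. c) \<sigma> = c" for x \<sigma>
    using w2_pos[of \<sigma> x] unfolding heat_def by (simp flip: distrib_right)
  have "kernel B (\<lambda>_. c) = (\<lambda>_. c)" using card_V_pos
    by (simp add: block_kernel_def h fun_eq_iff field_simps)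
  thus ?thesis by (induction t) auto
qed

section \<open>Reversibility and censoring\<close>

definition pairing :: "(('a \<Rightarrow> real) \<Rightarrow> real) \<Rightarrow> (('a \<Rightarrow> real) \<Rightarrow> real) \<Rightarrow> real" where
  "pairing \<phi> g = (\<Sum>\<sigma>\<in>configs V. w \<sigma> * (\<phi> \<sigma> * g \<sigma>))"

lemma sum_configs_split:
  assumes "x \<in> V"
  shows "sum F (configs V) = (\<Sum>\<sigma>\<in>block (V - {x}) (\<lambda>_. undefined). F (\<sigma>(x := 1)) + F (\<sigma>(x := -1) :: 'a \<Rightarrow> real) :: real)"
proof -
  have "V = insert x (V - {x})" using assms by auto
  thus ?thesis unfolding configs_eq_block using sum_block_insert[of "V - {x}" x F] finite_V by simp
qed

lemma pairing_heat:
  assumes x: "x \<in> V" shows "pairing (heat w x \<phi>) g = pairing \<phi> (heat w x g)"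
proof -
  have *: "a * ((a * p + b * q) / s * G) + b * ((a * p + b * q) / s * H)
     = a * (p * ((a * G + b * H) / s)) + b * (q * ((a * G + b * H) / s))" for a b p q s G H :: real
    by (simp add: add_divide_distrib ring_distribs mult_ac)
  show ?thesis
    unfolding pairing_def sum_configs_split[OF x] heat_upd
    unfolding heat_def by (intro sum.cong refl *)
qed

text \<open>The difference of the two sides sums, over the other spins, the weighted conditional
  covariance of \<open>\<phi>\<close> and \<open>g\<close> at \<open>x\<close>. For increasing
  functions it is nonnegative, by the two-point Chebyshev inequality
  \<open>0 \<le> a * b * ((p - q) * (G - H))\<close>. This is the inequality on which censoring
  rests.\<close>

lemma pairing_heat_le:
  assumes x: "x \<in> V" and mono: "mono_on (configs V) \<phi>" "mono_on (configs V) g"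
  shows "pairing \<phi> (heat w x g) \<le> pairing \<phi> g"
  unfolding pairing_def sum_configs_split[OF x] heat_upd
proof (rule sum_mono)
  fix \<sigma> :: "'a \<Rightarrow> real" assume s: "\<sigma> \<in> block (V - {x}) (\<lambda>_. undefined)"
  define a where "a = w (\<sigma>(x := 1))"
  define b where "b = w (\<sigma>(x := -1))"
  have ab: "a > 0" "b > 0" by (simp_all add: a_def b_def w_pos)
  have c: "\<sigma>(x := c) \<in> configs V" if "c = 1 \<or> c = -1" for c
    using s that x unfolding configs_iff block_def by (simp add: fun_upd_apply)
  have m: "h (\<sigma>(x := -1)) \<le> h (\<sigma>(x := 1))" if "mono_on (configs V) h" for h :: "_ \<Rightarrow> real"
    using that by (rule mono_onD) (auto intro!: c simp: le_fun_def)
  have "a * (p * ((a * G + b * H) / (a + b))) + b * (q * ((a * G + b * H) / (a + b))) \<le> a * (p * G) + b * (q * H)"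
    if "q \<le> p" "H \<le> G" for p q G H
  proof -
    have n: "a + b > 0" using ab by simp
    have "a * (p * ((a * G + b * H) / (a + b))) + b * (q * ((a * G + b * H) / (a + b)))
      = (a * p + b * q) * (a * G + b * H) / (a + b)"
    proof -
      have "a * (p * (X / Y)) + b * (q * (X / Y)) = (a * p + b * q) * X / Y" for X Y
        by (simp add: add_divide_distrib distrib_right)
      thus ?thesis .
    qed
    moreover have "(a * p + b * q) * (a * G + b * H) \<le> (a * (p * G) + b * (q * H)) * (a + b)"
    proof -
      have "(a * (p * G) + b * (q * H)) * (a + b) - (a * p + b * q) * (a * G + b * H) = a * b * ((p - q) * (G - H))"
        by (simp add: algebra_simps)
      moreover have "\<dots> \<ge> 0" using that ab by (intro mult_nonneg_nonneg) auto
      ultimately show ?thesis by simp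
    qed
    ultimately show ?thesis using n by (simp add: pos_divide_le_eq)
  qed
  from this[OF m[OF mono(1)] m[OF mono(2)]]
  show "w (\<sigma>(x := 1)) * (\<phi> (\<sigma>(x := 1)) * heat w x g \<sigma>) + w (\<sigma>(x := -1)) * (\<phi> (\<sigma>(x := -1)) * heat w x g \<sigma>)
    \<le> w (\<sigma>(x := 1)) * (\<phi> (\<sigma>(x := 1)) * g (\<sigma>(x := 1))) + w (\<sigma>(x := -1)) * (\<phi> (\<sigma>(x := -1)) * g (\<sigma>(x := -1)))"
    by (simp add: heat_def a_def b_def)
qed

lemma pairing_kernel_right:
  "pairing \<phi> (kernel B g) = ((\<Sum>x\<in>B. pairing \<phi> (heat w x g)) + (real (card V) - real (card B)) * pairing \<phi> g) / real (card V)"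
proof -
  have "pairing \<phi> (kernel B g) = (\<Sum>\<sigma>\<in>configs V. ((\<Sum>x\<in>B. w \<sigma> * (\<phi> \<sigma> * heat w x g \<sigma>))
      + (real (card V) - real (card B)) * (w \<sigma> * (\<phi> \<sigma> * g \<sigma>))) / real (card V))"
    unfolding pairing_def block_kernel_def by (simp add: sum_distrib_left algebra_simps)
  also have "\<dots> = ((\<Sum>x\<in>B. pairing \<phi> (heat w x g)) + (real (card V) - real (card B)) * pairing \<phi> g) / real (card V)"
    unfolding pairing_def by (subst sum.swap) (simp add: sum_divide_distrib[symmetric] sum.distrib sum_distrib_left)
  finally show ?thesis .
qed

lemma pairing_commute: "pairing \<phi> g = pairing g \<phi>"
  by (simp add: pairing_def mult_ac)

lemma pairing_kernel: "B \<subseteq> V \<Longrightarrow> pairing (kernel B \<phi>) g = pairing \<phi> (kernel B g)"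
proof -
  assume B: "B \<subseteq> V"
  have "(\<Sum>x\<in>B. pairing g (heat w x \<phi>)) = (\<Sum>x\<in>B. pairing \<phi> (heat w x g))"
    using B by (intro sum.cong refl) (metis pairing_commute pairing_heat subsetD)
  thus ?thesis by (subst pairing_commute) (simp add: pairing_kernel_right pairing_commute[of g \<phi>])
qed

lemma pairing_kernel_le:
  assumes B: "B \<subseteq> V" and mono: "mono_on (configs V) \<phi>" "mono_on (configs V) g"
  shows "pairing \<phi> (kernel V g) \<le> pairing \<phi> (kernel B g)"
proof -
  have fB: "finite B" using B finite_V by (rule finite_subset)
  have "(\<Sum>x\<in>V. pairing \<phi> (heat w x g)) = (\<Sum>x\<in>V-B. pairing \<phi> (heat w x g)) + (\<Sum>x\<in>B. pairing \<phi> (heat w x g))"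
    using B finite_V by (rule sum.subset_diff)
  also have "(\<Sum>x\<in>V-B. pairing \<phi> (heat w x g)) \<le> (\<Sum>x\<in>V-B. pairing \<phi> g)"
    using mono by (intro sum_mono pairing_heat_le) auto
  also have "\<dots> = (real (card V) - real (card B)) * pairing \<phi> g"
    using B fB finite_V by (simp add: card_Diff_subset of_nat_diff card_mono)
  finally show ?thesis unfolding pairing_kernel_right by (intro divide_right_mono) auto
qed

text \<open>Self-adjointness moves the outer full step over to \<open>\<phi>\<close>, which stays
  increasing, so the induction hypothesis censors the other steps. The step is then moved back and
  censored as well, which is allowed because the block dynamics keep \<open>g\<close>
  increasing.\<close>

lemma censoring:
  assumes B: "B \<subseteq> V" and mono: "mono_on (configs V) \<phi>" "mono_on (configs V) g"
  shows "pairing \<phi> ((kernel V ^^ \<tau>) g) \<le> pairing \<phi> ((kernel B ^^ \<tau>) g)"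
  using mono(1)
proof (induction \<tau> arbitrary: \<phi>)
  case (Suc \<tau>)
  have "pairing \<phi> ((kernel V ^^ Suc \<tau>) g) = pairing (kernel V \<phi>) ((kernel V ^^ \<tau>) g)"
    by (simp add: pairing_kernel)
  also have "\<dots> \<le> pairing (kernel V \<phi>) ((kernel B ^^ \<tau>) g)"
    using Suc.prems by (intro Suc.IH kernel_mono) auto
  also have "\<dots> = pairing \<phi> (kernel V ((kernel B ^^ \<tau>) g))"
    by (simp add: pairing_kernel)
  also have "\<dots> \<le> pairing \<phi> (kernel B ((kernel B ^^ \<tau>) g))"
    using B Suc.prems mono(2) by (intro pairing_kernel_le kernel_funpow_mono)
  finally show ?case by simp
qed simp

lemma pairing_point:
  assumes "\<eta> \<in> configs V"
  shows "pairing (\<lambda>\<sigma>. if \<sigma> = \<eta> then c / w \<eta> else 0) F = c * F \<eta>"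
proof -
  have "pairing (\<lambda>\<sigma>. if \<sigma> = \<eta> then c / w \<eta> else 0) F = (\<Sum>\<sigma>\<in>configs V. if \<sigma> = \<eta> then c * F \<eta> else 0)"
    unfolding pairing_def using w_pos[of \<eta>] by (intro sum.cong refl) auto
  also have "\<dots> = c * F \<eta>" using assms finite_configs[OF finite_V] by simp
  finally show ?thesis .
qed

lemma pairing_kernel_funpow: "pairing ((kernel V ^^ t) \<phi>) g = pairing \<phi> ((kernel V ^^ t) g)"
proof (induction t arbitrary: g)
  case (Suc t)
  have "pairing ((kernel V ^^ Suc t) \<phi>) g = pairing ((kernel V ^^ t) \<phi>) (kernel V g)"
    by (simp add: pairing_kernel)
  also have "\<dots> = pairing \<phi> ((kernel V ^^ Suc t) g)" unfolding Suc funpow_Suc_right by simp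
  finally show ?case .
qed simp

text \<open>The density of the point mass at the all-plus state is increasing, and so is minus the
  density at the all-minus state; these are taken as \<open>\<phi>\<close>. On observables the outer
  kernel acts at the earlier times, so the \<open>t\<close> full steps come first and the
  \<open>\<tau>\<close> censored steps last.\<close>

lemma censoring_extremal:
  assumes B: "B \<subseteq> V" and g: "mono_on (configs V) g"
  shows "(kernel V ^^ (t + \<tau>)) g (plus_config V) \<le> (kernel V ^^ t) ((kernel B ^^ \<tau>) g) (plus_config V)"
    and "(kernel V ^^ t) ((kernel B ^^ \<tau>) g) (minus_config V) \<le> (kernel V ^^ (t + \<tau>)) g (minus_config V)"
proof -
  have *: "c * (kernel V ^^ (t + \<tau>)) g \<eta> \<le> c * (kernel V ^^ t) ((kernel B ^^ \<tau>) g) \<eta>"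
    if \<eta>: "\<eta> \<in> configs V" and m: "mono_on (configs V) (\<lambda>\<sigma>. if \<sigma> = \<eta> then c / w \<eta> else 0)" for c \<eta>
  proof -
    define \<phi> where "\<phi> = (\<lambda>\<sigma>. if \<sigma> = \<eta> then c / w \<eta> else 0)"
    have m': "mono_on (configs V) \<phi>" using m by (simp add: \<phi>_def)
    have "c * (kernel V ^^ (t + \<tau>)) g \<eta> = pairing \<phi> ((kernel V ^^ t) ((kernel V ^^ \<tau>) g))"
      unfolding \<phi>_def pairing_point[OF \<eta>] by (simp add: funpow_add)
    also have "\<dots> \<le> pairing \<phi> ((kernel V ^^ t) ((kernel B ^^ \<tau>) g))"
      unfolding pairing_kernel_funpow[of t, symmetric]
      by (rule censoring[OF B kernel_funpow_mono[OF subset_refl m'] g])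
    finally show ?thesis unfolding \<phi>_def pairing_point[OF \<eta>] .
  qed
  have "mono_on (configs V) (\<lambda>\<sigma>. if \<sigma> = plus_config V then 1 / w (plus_config V) else 0)"
  proof (rule mono_onI)
    fix \<sigma> \<tau> assume "\<sigma> \<in> configs V" "\<tau> \<in> configs V" "\<sigma> \<le> \<tau>"
    thus "(if \<sigma> = plus_config V then 1 / w (plus_config V) else 0) \<le> (if \<tau> = plus_config V then 1 / w (plus_config V) else 0)"
      using configs_between(1)[of \<tau> V] w_pos[of "plus_config V"] by (auto simp: less_imp_le)
  qed
  from *[OF plus_config_in this] show "(kernel V ^^ (t + \<tau>)) g (plus_config V) \<le> (kernel V ^^ t) ((kernel B ^^ \<tau>) g) (plus_config V)" by simp
  have "mono_on (configs V) (\<lambda>\<sigma>. if \<sigma> = minus_config V then -1 / w (minus_config V) else 0)"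
  proof (rule mono_onI)
    fix \<sigma> \<tau> assume "\<sigma> \<in> configs V" "\<tau> \<in> configs V" "\<sigma> \<le> \<tau>"
    thus "(if \<sigma> = minus_config V then -1 / w (minus_config V) else 0) \<le> (if \<tau> = minus_config V then -1 / w (minus_config V) else 0)"
      using configs_between(2)[of \<sigma> V] w_pos[of "minus_config V"] by (auto simp: less_imp_le)
  qed
  from *[OF minus_config_in this] show "(kernel V ^^ t) ((kernel B ^^ \<tau>) g) (minus_config V) \<le> (kernel V ^^ (t + \<tau>)) g (minus_config V)" by simp
qed

section \<open>Recursion for the gaps and distance to equilibrium\<close>

definition spin_gap :: "nat \<Rightarrow> 'a \<Rightarrow> real" where
  "spin_gap t v = (kernel V ^^ t) (\<lambda>\<sigma>. \<sigma> v) (plus_config V) - (kernel V ^^ t) (\<lambda>\<sigma>. \<sigma> v) (minus_config V)"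

lemma mono_on_spin: "mono_on (configs V) (\<lambda>\<sigma>. \<sigma> v)"
  by (rule mono_onI) (simp add: le_fun_def)

text \<open>Once the block has relaxed, the expected spin at \<open>v\<close> is close to
  \<open>m\<close>, a nonlinear function of the boundary. By \<open>lip\<close> and
  \<open>loc\<close> the difference \<open>G\<close> of a linear function and \<open>m\<close> is
  increasing. So the gap of \<open>m\<close> between the extreme states is at most that of the
  linear function, which is a combination of the gaps \<open>spin_gap t u\<close>. The error
  \<open>\<delta>\<close> arises at both extreme states.\<close>

lemma spin_gap_step:
  assumes B: "B \<subseteq> V"
    and relax: "\<And>\<eta>. \<eta> \<in> configs V \<Longrightarrow> \<bar>(kernel B ^^ \<tau>) (\<lambda>\<sigma>. \<sigma> v) \<eta> - m \<eta>\<bar> \<le> \<delta>"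
    and loc: "\<And>\<eta> x c. x \<in> B \<Longrightarrow> m (\<eta>(x := c)) = m \<eta>"
    and lip: "\<And>\<eta> u. u \<in> V - B \<Longrightarrow> \<bar>m (\<eta>(u := 1)) - m (\<eta>(u := -1))\<bar> \<le> 2 * c u"
  shows "spin_gap (t + \<tau>) v \<le> (\<Sum>u\<in>V-B. c u * spin_gap t u) + 2 * \<delta>"
proof -
  define G where "G \<eta> = (\<Sum>u\<in>V-B. c u * \<eta> u) - m \<eta>" for \<eta>
  have fVB: "finite (V - B)" using finite_V by simp
  have "mono_on (configs V) G"
  proof (rule mono_on_configs_flipI[OF finite_V])
    fix \<sigma> x assume x: "\<sigma> \<in> configs V" "x \<in> V"
    have s: "(\<Sum>u\<in>V-B. c u * (\<sigma>(x := b)) u) = (\<Sum>u\<in>V-B-{x}. c u * \<sigma> u) + (if x \<in> B then 0 else c x * b)" for b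
    proof (cases "x \<in> B")
      case True
      hence "V - B - {x} = V - B" by auto
      moreover have "(\<Sum>u\<in>V-B. c u * (\<sigma>(x := b)) u) = (\<Sum>u\<in>V-B. c u * \<sigma> u)"
        using True by (intro sum.cong refl) auto
      ultimately show ?thesis using True by simp
    next
      case False
      have "(\<Sum>u\<in>V-B-{x}. c u * (\<sigma>(x := b)) u) = (\<Sum>u\<in>V-B-{x}. c u * \<sigma> u)"
        by (intro sum.cong refl) auto
      thus ?thesis using False x sum.remove[of "V - B" x "\<lambda>u. c u * (\<sigma>(x := b)) u"] fVB by simp
    qed
    show "G (\<sigma>(x := -1)) \<le> G (\<sigma>(x := 1))"
    proof (cases "x \<in> B")
      case True thus ?thesis unfolding G_def s by (simp add: loc)
    next
      case False
      thus ?thesis unfolding G_def s using lip[of x \<sigma>] x by auto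
    qed
  qed
  hence "(kernel V ^^ t) G (minus_config V) \<le> (kernel V ^^ t) G (plus_config V)"
    by (intro mono_onD[OF kernel_funpow_mono]) (auto intro: configs_between)
  hence m: "(kernel V ^^ t) m (plus_config V) - (kernel V ^^ t) m (minus_config V) \<le> (\<Sum>u\<in>V-B. c u * spin_gap t u)"
    unfolding G_def block_kernel_funpow_diff block_kernel_funpow_sum[OF fVB, of _ _ _ _ c "\<lambda>u \<eta>. \<eta> u"]
    by (simp add: spin_gap_def right_diff_distrib sum_subtractf)
  have shift: "(kernel V ^^ t) (\<lambda>\<sigma>. m \<sigma> - d) \<eta> = (kernel V ^^ t) m \<eta> - d" for d \<eta>
    unfolding block_kernel_funpow_diff by (simp add: kernel_funpow_const)
  have up: "(kernel V ^^ t) ((kernel B ^^ \<tau>) (\<lambda>\<sigma>. \<sigma> v)) (plus_config V) \<le> (kernel V ^^ t) m (plus_config V) + \<delta>"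
    using kernel_funpow_le[of V "(kernel B ^^ \<tau>) (\<lambda>\<sigma>. \<sigma> v)" "\<lambda>\<sigma>. m \<sigma> - (-\<delta>)" "plus_config V" t] relax
    unfolding shift by (force simp: abs_le_iff)
  have lo: "(kernel V ^^ t) m (minus_config V) - \<delta> \<le> (kernel V ^^ t) ((kernel B ^^ \<tau>) (\<lambda>\<sigma>. \<sigma> v)) (minus_config V)"
    using kernel_funpow_le[of V "\<lambda>\<sigma>. m \<sigma> - \<delta>" "(kernel B ^^ \<tau>) (\<lambda>\<sigma>. \<sigma> v)" "minus_config V" t] relax
    unfolding shift by (force simp: abs_le_iff)
  show ?thesis
    using censoring_extremal[OF B mono_on_spin, of t \<tau> v] up lo m unfolding spin_gap_def by linarith
qed

text \<open>For \<open>f\<close> with values in \<open>[0, 1]\<close>, both \<open>S + f\<close> and \<open>S - f\<close> are increasing, where \<open>S\<close> is half the sum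
  of the spins. This replaces a monotone coupling.\<close>

lemma kernel_funpow_dist_le:
  assumes f: "\<And>\<sigma>. \<sigma> \<in> configs V \<Longrightarrow> 0 \<le> f \<sigma> \<and> f \<sigma> \<le> 1" and xy: "x \<in> configs V" "y \<in> configs V"
  shows "\<bar>(kernel V ^^ T) f x - (kernel V ^^ T) f y\<bar> \<le> (\<Sum>v\<in>V. spin_gap T v)"
proof -
  define S where "S = (\<lambda>\<sigma>. \<Sum>v\<in>V. (1/2) * (\<sigma> v :: real))"
  define ST where "ST = (kernel V ^^ T) S"
  have ST: "ST = (\<lambda>\<sigma>. \<Sum>v\<in>V. (1/2) * (kernel V ^^ T) (\<lambda>\<sigma>. \<sigma> v) \<sigma>)"
    unfolding ST_def S_def by (rule block_kernel_funpow_sum[OF finite_V])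
  have flipS: "S (\<sigma>(u := 1)) = S (\<sigma>(u := -1)) + 1" if "u \<in> V" for \<sigma> u
  proof -
    have "S (\<sigma>(u := b)) = (\<Sum>v\<in>V-{u}. (1/2) * \<sigma> v) + b / 2" for b
      unfolding S_def using sum.remove[OF finite_V that, of "\<lambda>v. (1/2) * (\<sigma>(u := b)) v"] by simp
    thus ?thesis by simp
  qed
  have mono: "mono_on (configs V) (\<lambda>\<sigma>. S \<sigma> - h \<sigma>)" if h: "\<And>\<sigma> \<tau>. \<sigma> \<in> configs V \<Longrightarrow> \<tau> \<in> configs V \<Longrightarrow> h \<sigma> - h \<tau> \<le> 1" for h
  proof (rule mono_on_configs_flipI[OF finite_V])
    fix \<sigma> u assume "\<sigma> \<in> configs V" "u \<in> V"
    thus "S (\<sigma>(u := -1)) - h (\<sigma>(u := -1)) \<le> S (\<sigma>(u := 1)) - h (\<sigma>(u := 1))"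
      using h[of "\<sigma>(u := 1)" "\<sigma>(u := -1)"] by (simp add: flipS configs_upd)
  qed
  have ord: "ST a - (kernel V ^^ T) h a \<le> ST b - (kernel V ^^ T) h b"
    if h: "\<And>\<sigma> \<tau>. \<sigma> \<in> configs V \<Longrightarrow> \<tau> \<in> configs V \<Longrightarrow> h \<sigma> - h \<tau> \<le> 1"
      and ab: "a \<in> configs V" "b \<in> configs V" "a \<le> b" for h a b
    unfolding ST_def block_kernel_funpow_diff[symmetric]
    using ab by (intro mono_onD[OF kernel_funpow_mono[OF subset_refl mono]] h)
  have neg: "(kernel V ^^ T) (\<lambda>\<sigma>. 0 - f \<sigma>) \<sigma> = - (kernel V ^^ T) f \<sigma>" for \<sigma>
    unfolding block_kernel_funpow_diff by (simp add: kernel_funpow_const)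
  have f1: "f \<sigma> - f \<tau> \<le> 1" if "\<sigma> \<in> configs V" "\<tau> \<in> configs V" for \<sigma> \<tau>
    using f[OF that(1)] f[OF that(2)] by linarith
  have f2: "(0 - f \<sigma>) - (0 - f \<tau>) \<le> 1" if "\<sigma> \<in> configs V" "\<tau> \<in> configs V" for \<sigma> \<tau>
    using f1[OF that(2,1)] by linarith
  define P where "P = plus_config V"
  define M where "M = minus_config V"
  have near: "\<bar>(kernel V ^^ T) f a - (kernel V ^^ T) f P\<bar> \<le> ST P - ST M" if a: "a \<in> configs V" for a
  proof -
    have aP: "a \<le> P" "M \<le> a" "P \<in> configs V" "M \<in> configs V"
      using configs_between[OF a] by (simp_all add: P_def M_def)
    have "ST a - (kernel V ^^ T) f a \<le> ST P - (kernel V ^^ T) f P" by (rule ord[OF f1 a aP(3,1)])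
    moreover have "ST a - (kernel V ^^ T) (\<lambda>\<sigma>. 0 - f \<sigma>) a \<le> ST P - (kernel V ^^ T) (\<lambda>\<sigma>. 0 - f \<sigma>) P"
      by (rule ord[OF f2 a aP(3,1)])
    moreover have "ST M - (kernel V ^^ T) (\<lambda>_. 0) M \<le> ST a - (kernel V ^^ T) (\<lambda>_. 0) a"
      by (rule ord[OF _ aP(4) a aP(2)]) simp
    ultimately show ?thesis unfolding neg kernel_funpow_const[OF subset_refl] by linarith
  qed
  \<comment> \<open>Both \<open>x\<close> and \<open>y\<close> are compared with the all-plus state,
    and each comparison costs half the sum of the gaps.\<close>
  have "ST P - ST M = (1/2) * (\<Sum>v\<in>V. spin_gap T v)"
    unfolding ST spin_gap_def P_def M_def by (simp add: sum_subtractf sum_divide_distrib diff_divide_distrib)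
  thus ?thesis using near[OF xy(1)] near[OF xy(2)] by linarith
qed

text \<open>By stationarity the equilibrium mean is the average of \<open>(kernel V ^^ T) f\<close>
  over all starting states, so it suffices to compare two starting states.\<close>

lemma kernel_funpow_equilibrium:
  assumes f: "\<And>\<sigma>. \<sigma> \<in> configs V \<Longrightarrow> 0 \<le> f \<sigma> \<and> f \<sigma> \<le> 1" and x: "x \<in> configs V"
  shows "\<bar>(kernel V ^^ T) f x - (\<Sum>\<sigma>\<in>configs V. w \<sigma> * f \<sigma>) / sum w (configs V)\<bar> \<le> (\<Sum>v\<in>V. spin_gap T v)"
proof -
  define s where "s = (\<Sum>v\<in>V. spin_gap T v)"
  define Z where "Z = sum w (configs V)"
  have Z: "Z > 0" unfolding Z_def using w_pos finite_configs[OF finite_V] configs_nonempty by (intro sum_pos) auto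
  have stat: "(\<Sum>\<sigma>\<in>configs V. w \<sigma> * (kernel V ^^ T) f \<sigma>) = (\<Sum>\<sigma>\<in>configs V. w \<sigma> * f \<sigma>)"
    using pairing_kernel_funpow[of T "\<lambda>_. 1" f] by (simp add: kernel_funpow_const pairing_def)
  have "Z * (kernel V ^^ T) f x - (\<Sum>\<sigma>\<in>configs V. w \<sigma> * f \<sigma>) = (\<Sum>\<sigma>\<in>configs V. w \<sigma> * ((kernel V ^^ T) f x - (kernel V ^^ T) f \<sigma>))"
    unfolding stat[symmetric] Z_def by (simp add: right_diff_distrib sum_subtractf sum_distrib_right)
  moreover have "\<bar>\<dots>\<bar> \<le> (\<Sum>\<sigma>\<in>configs V. \<bar>w \<sigma> * ((kernel V ^^ T) f x - (kernel V ^^ T) f \<sigma>)\<bar>)" by (rule sum_abs)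
  moreover have "\<dots> \<le> (\<Sum>\<sigma>\<in>configs V. w \<sigma> * s)"
  proof (rule sum_mono)
    fix \<sigma> assume "\<sigma> \<in> configs V"
    hence "w \<sigma> * \<bar>(kernel V ^^ T) f x - (kernel V ^^ T) f \<sigma>\<bar> \<le> w \<sigma> * s"
      unfolding s_def using w_pos[of \<sigma>] by (intro mult_left_mono kernel_funpow_dist_le f x) auto
    thus "\<bar>w \<sigma> * ((kernel V ^^ T) f x - (kernel V ^^ T) f \<sigma>)\<bar> \<le> w \<sigma> * s"
      using w_pos[of \<sigma>] by (simp add: abs_mult)
  qed
  moreover have "\<dots> = Z * s" by (simp add: Z_def sum_distrib_right)
  ultimately have b: "\<bar>Z * (kernel V ^^ T) f x - (\<Sum>\<sigma>\<in>configs V. w \<sigma> * f \<sigma>)\<bar> \<le> Z * s" by linarith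
  have "(kernel V ^^ T) f x - (\<Sum>\<sigma>\<in>configs V. w \<sigma> * f \<sigma>) / Z = (Z * (kernel V ^^ T) f x - (\<Sum>\<sigma>\<in>configs V. w \<sigma> * f \<sigma>)) / Z"
    using Z by (simp add: field_simps)
  also have "\<bar>\<dots>\<bar> \<le> s" using b Z by (simp add: pos_divide_le_eq mult.commute)
  finally show ?thesis unfolding s_def Z_def .
qed

end

section \<open>From block estimates to the mixing time\<close>

definition interaction :: "'a set set \<Rightarrow> ('a set \<Rightarrow> real) \<Rightarrow> 'a \<Rightarrow> 'a \<Rightarrow> real" where
  "interaction E J x y = (if {x, y} \<in> E then J {x, y} else 0)"

definition energy ::
  "'a set \<Rightarrow> 'a set set \<Rightarrow> ('a set \<Rightarrow> real) \<Rightarrow> ('a \<Rightarrow> real) \<Rightarrow> ('a \<Rightarrow> real) \<Rightarrow> real" where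
  "energy V E J h \<sigma> = (\<Sum>e\<in>E. J e * (\<Prod>v\<in>e. \<sigma> v)) + (\<Sum>v\<in>V. h v * \<sigma> v)"

lemma finite_potential_edges: "finite V \<Longrightarrow> finite (potential_edges V)"
  by (simp add: potential_edges_def)

lemma edge_cases:
  assumes "e \<in> potential_edges V" "x \<in> e"
  obtains y where "e = {x, y}" "y \<noteq> x" "x \<in> V" "y \<in> V"
proof -
  have "card e = 2" "e \<subseteq> V" using assms by (auto simp: potential_edges_def)
  then obtain a b where "e = {a, b}" "a \<noteq> b" by (meson card_2_iff)
  with assms \<open>e \<subseteq> V\<close> show ?thesis by (auto intro: that)
qed

text \<open>The energy is affine in the spin at \<open>x\<close>, with the local field as slope. The
  value 0 is no spin and serves only as base point.\<close>

lemma energy_upd: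
  assumes V: "finite V" "E \<subseteq> potential_edges V" and x: "x \<in> V"
  shows "energy V E J h (\<sigma>(x := b)) = energy V E J h (\<sigma>(x := 0)) + b * local_field V E J h \<sigma> x"
proof -
  have fE: "finite E" using V finite_potential_edges finite_subset by blast
  define Ex where "Ex = {e\<in>E. x \<in> e}"
  define N where "N = {u. u \<in> V \<and> {u, x} \<in> E}"
  have im: "Ex = (\<lambda>u. {u, x}) ` N"
  proof (rule set_eqI, rule iffI)
    fix e assume e: "e \<in> Ex"
    then obtain y where "e = {x, y}" "y \<in> V" using edge_cases[of e V x] V by (auto simp: Ex_def)
    thus "e \<in> (\<lambda>u. {u, x}) ` N" using e by (auto simp: Ex_def N_def insert_commute)
  qed (auto simp: Ex_def N_def)
  have inj: "inj_on (\<lambda>u. {u, x}) N"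
    by (rule inj_onI) (auto simp: doubleton_eq_iff)
  have ne: "u \<noteq> x" if "u \<in> N" for u using that V(2) by (auto simp: N_def potential_edges_def)
  have Ex_sum: "(\<Sum>e\<in>Ex. J e * (\<Prod>v\<in>e. (\<sigma>(x := c)) v)) = c * (\<Sum>u\<in>N. J {u, x} * \<sigma> u)" for c
    unfolding im sum.reindex[OF inj] sum_distrib_left
    by (intro sum.cong refl) (simp add: ne)
  have rest: "(\<Sum>e\<in>E-Ex. J e * (\<Prod>v\<in>e. (\<sigma>(x := c)) v)) = (\<Sum>e\<in>E-Ex. J e * (\<Prod>v\<in>e. \<sigma> v))" for c
    by (intro sum.cong refl arg_cong2[where f = "(*)"] prod.cong) (auto simp: Ex_def)
  have field: "(\<Sum>v\<in>V. h v * (\<sigma>(x := c)) v) = (\<Sum>v\<in>V-{x}. h v * \<sigma> v) + c * h x" for c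
    using sum.remove[OF V(1) x, of "\<lambda>v. h v * (\<sigma>(x := c)) v"] by simp
  have split: "(\<Sum>e\<in>E. J e * (\<Prod>v\<in>e. (\<sigma>(x := c)) v)) = (\<Sum>e\<in>E-Ex. J e * (\<Prod>v\<in>e. (\<sigma>(x := c)) v))
     + (\<Sum>e\<in>Ex. J e * (\<Prod>v\<in>e. (\<sigma>(x := c)) v))" for c
    using fE by (intro sum.subset_diff) (auto simp: Ex_def)
  have "energy V E J h (\<sigma>(x := c)) = (\<Sum>e\<in>E-Ex. J e * (\<Prod>v\<in>e. \<sigma> v)) + c * (\<Sum>u\<in>N. J {u, x} * \<sigma> u)
     + (\<Sum>v\<in>V-{x}. h v * \<sigma> v) + c * h x" for c
    unfolding energy_def field split rest Ex_sum by simp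
  thus ?thesis by (simp add: local_field_def N_def distrib_left)
qed

lemma ising_weight_energy: "ising_weight V E J h \<sigma> = exp (energy V E J h \<sigma>)"
  by (simp add: ising_weight_def energy_def)

lemma ising_weight_flip:
  assumes V: "finite V" "E \<subseteq> potential_edges V" and x: "x \<in> V"
  shows "ising_weight V E J h (\<sigma>(x := 1)) = ising_weight V E J h (\<sigma>(x := -1)) * exp (2 * local_field V E J h \<sigma> x)"
proof -
  have "energy V E J h (\<sigma>(x := 1)) = energy V E J h (\<sigma>(x := -1)) + 2 * local_field V E J h \<sigma> x"
    using energy_upd[OF V x, of J h \<sigma> 1] energy_upd[OF V x, of J h \<sigma> "-1"] by linarith
  thus ?thesis by (simp add: ising_weight_energy exp_add)
qed

lemma ising_odds_ising_weight:
  assumes V: "finite V" "E \<subseteq> potential_edges V"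
  shows "ising_odds V (interaction E J) (ising_weight V E J h)"
  unfolding ising_odds_def
proof (intro conjI allI exI[of _ "\<lambda>x. 2 * h x"] ballI)
  show "ising_weight V E J h \<sigma> > 0" for \<sigma> by (simp add: ising_weight_def)
  fix x \<sigma> assume x: "x \<in> V"
  have "(\<Sum>u | u \<in> V \<and> {u, x} \<in> E. J {u, x} * \<sigma> u) = (\<Sum>u\<in>V. interaction E J x u * \<sigma> u)"
    using V by (intro sum.mono_neutral_cong_left) (auto simp: interaction_def insert_commute)
  thus "ising_weight V E J h (\<sigma>(x := 1)) = ising_weight V E J h (\<sigma>(x := -1)) *
       exp (2 * h x + 2 * (\<Sum>y\<in>V. interaction E J x y * \<sigma> y))"
    unfolding ising_weight_flip[OF V x] local_field_def by (simp add: distrib_left)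
qed

text \<open>The field at \<open>x\<close> and the contributions of the other spins are collected in
  \<open>r\<close>, which cancels. So neither enters the Poincare constant.\<close>

lemma cross_ratio_ising_odds:
  assumes w: "ising_odds V J w" and V: "finite V" and x: "x \<in> V" "z \<in> V" "x \<noteq> z" and J: "J x x = 0"
  shows "cross_ratio w x z \<sigma> = exp (4 * J x z)"
proof -
  obtain g where g: "\<And>\<sigma>. w (\<sigma>(x := 1)) = w (\<sigma>(x := -1)) * exp (g x + 2 * (\<Sum>y\<in>V. J x y * \<sigma> y))"
    using w x by (auto simp: ising_odds_def)
  have pos: "w \<sigma> > 0" for \<sigma> using w by (simp add: ising_odds_def)
  define r where "r = g x + 2 * (\<Sum>y\<in>V-{z}. J x y * \<sigma> y)"
  have "w (\<sigma>(z := c, x := 1)) = w (\<sigma>(z := c, x := -1)) * exp (r + 2 * J x z * c)" for c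
  proof -
    have "(\<Sum>y\<in>V. J x y * (\<sigma>(z := c)) y) = J x z * c + (\<Sum>y\<in>V-{z}. J x y * \<sigma> y)"
      using sum.remove[OF V x(2), of "\<lambda>y. J x y * (\<sigma>(z := c)) y"] by simp
    thus ?thesis using g[of "\<sigma>(z := c)"] by (simp add: r_def algebra_simps)
  qed
  hence e: "w (\<sigma>(x := 1, z := c)) = w (\<sigma>(x := -1, z := c)) * exp (r + 2 * J x z * c)" for c
    using x(3) by (metis fun_upd_twist)
  have "exp (r + 2 * J x z * 1) = exp (4 * J x z) * exp (r + 2 * J x z * (-1))"
    by (simp flip: exp_add)
  thus ?thesis unfolding cross_ratio_def e using pos[of "\<sigma>(x := -1, z := 1)"] pos[of "\<sigma>(x := -1, z := -1)"]
    by simp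
qed

text \<open>The log odds of plus at \<open>v\<close> under the Ising weight are twice the local
  field, so the probability used by the sampler is the conditional probability that defines
  \<open>heat\<close>.\<close>

lemma expectation_glauber_step:
  assumes V: "finite V" "V \<noteq> {}" "E \<subseteq> potential_edges V"
  shows "measure_pmf.expectation (glauber_step V E J h \<sigma>) f = block_kernel (ising_weight V E J h) (card V) V f \<sigma>"
proof -
  define w where "w = ising_weight V E J h"
  have h: "measure_pmf.expectation (bernoulli_pmf (let x = local_field V E J h \<sigma> v in exp x / (exp x + exp (- x)))
         \<bind> (\<lambda>plus. return_pmf (\<sigma>(v := if plus then 1 else -1)))) f = heat w v f \<sigma>" if v: "v \<in> V" for v
  proof -
    define y where "y = local_field V E J h \<sigma> v"
    define p where "p = exp y / (exp y + exp (- y))"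
    have s0: "exp y + exp (-y) > 0" by (simp add: add_pos_pos)
    have p: "0 \<le> p" "p \<le> 1" using s0 by (simp_all add: p_def)
    have q: "1 - p = exp (-y) / (exp y + exp (-y))" using s0 by (simp add: p_def field_simps)
    have "measure_pmf.expectation (bernoulli_pmf p \<bind> (\<lambda>plus. return_pmf (\<sigma>(v := if plus then 1 else -1)))) f
       = measure_pmf.expectation (bernoulli_pmf p) (\<lambda>plus. f (\<sigma>(v := if plus then 1 else -1)))"
      unfolding map_pmf_def[symmetric] by simp
    also have "\<dots> = p * f (\<sigma>(v := 1)) + (1 - p) * f (\<sigma>(v := -1))" using p by simp
    also have "\<dots> = heat w v f \<sigma>"
    proof -
      define b where "b = w (\<sigma>(v := -1))"
      have b: "b > 0" by (simp add: b_def w_def ising_weight_def)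
      have "w (\<sigma>(v := 1)) = b * exp (2 * y)"
        using ising_weight_flip[OF V(1,3) v, of J h \<sigma>] by (simp add: w_def b_def y_def)
      moreover have "exp (2 * y) = exp y * exp y" "exp y * exp (-y) = 1" by (simp_all flip: exp_add)
      ultimately have e: "w (\<sigma>(v := 1)) = (b * exp y) * exp y" "b = (b * exp y) * exp (-y)" by simp_all
      have "heat w v f \<sigma> = ((b * exp y) * (exp y * f (\<sigma>(v := 1)) + exp (-y) * f (\<sigma>(v := -1)))) / ((b * exp y) * (exp y + exp (-y)))"
        unfolding heat_def b_def[symmetric] e(1) by (subst (2 4) e(2)) (simp add: algebra_simps)
      also have "\<dots> = (exp y * f (\<sigma>(v := 1)) + exp (-y) * f (\<sigma>(v := -1))) / (exp y + exp (-y))"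
        using b by simp
      finally show ?thesis unfolding q unfolding p_def by (simp add: add_divide_distrib)
    qed
    finally show ?thesis unfolding p_def y_def Let_def .
  qed
  have "measure_pmf.expectation (glauber_step V E J h \<sigma>) f = (\<Sum>v\<in>V. heat w v f \<sigma> /\<^sub>R real (card V))"
    unfolding glauber_step_def using V h
    by (subst pmf_expectation_bind_pmf_of_set) (auto intro!: finite_UN_I)
  also have "\<dots> = block_kernel w (card V) V f \<sigma>"
    by (simp add: block_kernel_def sum_distrib_left divide_inverse mult.commute)
  finally show ?thesis unfolding w_def .
qed

lemma set_glauber_step:
  assumes "finite V" "V \<noteq> {}" "\<sigma> \<in> configs V"
  shows "set_pmf (glauber_step V E J h \<sigma>) \<subseteq> configs V"
  unfolding glauber_step_def using assms by (auto simp: configs_upd)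

lemma set_chain_glauber:
  assumes "finite V" "V \<noteq> {}" "x \<in> configs V"
  shows "set_pmf (chain_pmf (glauber_step V E J h) t x) \<subseteq> configs V"
proof (induction t)
  case (Suc t)
  have "set_pmf (chain_pmf (glauber_step V E J h) (Suc t) x)
     = (\<Union>\<sigma>\<in>set_pmf (chain_pmf (glauber_step V E J h) t x). set_pmf (glauber_step V E J h \<sigma>))"
    by (simp add: chain_pmf_def)
  thus ?case using Suc set_glauber_step[OF assms(1,2)] by blast
qed (use assms in \<open>simp add: chain_pmf_def\<close>)

lemma expectation_chain_glauber:
  assumes V: "finite V" "V \<noteq> {}" "E \<subseteq> potential_edges V" and x: "x \<in> configs V"
  shows "measure_pmf.expectation (chain_pmf (glauber_step V E J h) t x) f
     = (block_kernel (ising_weight V E J h) (card V) V ^^ t) f x"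
proof (induction t arbitrary: f)
  case (Suc t)
  define C where "C = chain_pmf (glauber_step V E J h) t x"
  have C: "set_pmf C \<subseteq> configs V" unfolding C_def by (rule set_chain_glauber[OF V(1,2) x])
  have "measure_pmf.expectation (chain_pmf (glauber_step V E J h) (Suc t) x) f
     = measure_pmf.expectation (bind_pmf C (glauber_step V E J h)) f"
    by (simp add: chain_pmf_def C_def)
  also have "\<dots> = (\<Sum>\<sigma>\<in>configs V. pmf C \<sigma> *\<^sub>R measure_pmf.expectation (glauber_step V E J h \<sigma>) f)"
    using C finite_configs[OF V(1)] finite_subset[OF set_glauber_step[OF V(1,2)] finite_configs[OF V(1)]]
    by (intro pmf_expectation_bind) auto
  also have "\<dots> = measure_pmf.expectation C (block_kernel (ising_weight V E J h) (card V) V f)"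
    unfolding expectation_glauber_step[OF V] using C finite_configs[OF V(1)]
    by (subst integral_measure_pmf_real[of "configs V"]) (auto simp: mult.commute)
  also have "\<dots> = (block_kernel (ising_weight V E J h) (card V) V ^^ Suc t) f x"
    unfolding C_def Suc funpow_Suc_right by simp
  finally show ?case .
qed (simp add: chain_pmf_def)

text \<open>The inner sum in the last condition bounds half the change of the mean spin at
  \<open>v\<close> when the boundary spin at \<open>u\<close> is flipped; in use, \<open>t\<close>
  is \<open>tanh \<beta>\<close>. A neighbour whose parent is missing from \<open>B\<close> is cut
  off from \<open>v\<close> and counts 0. The total \<open>1/2\<close> is the contraction factor of
  one round.\<close>

definition good_block ::
  "'a set \<Rightarrow> 'a set set \<Rightarrow> real \<Rightarrow> nat \<Rightarrow> 'a \<Rightarrow> 'a set \<Rightarrow> ('a \<Rightarrow> 'a) \<Rightarrow> ('a \<Rightarrow> nat) \<Rightarrow> bool" where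
  "good_block V E t M v B par lev \<longleftrightarrow> B \<subseteq> V \<and> v \<in> B \<and> lev v = 0 \<and> (\<forall>x\<in>B. lev x = 0 \<longrightarrow> x = v) \<and>
    (\<forall>x\<in>B. lev x \<ge> 1 \<longrightarrow> lev x = Suc (lev (par x))) \<and>
    (\<forall>x\<in>B. \<forall>y\<in>B. {x, y} \<in> E \<longrightarrow> (lev x \<ge> 1 \<and> y = par x) \<or> (lev y \<ge> 1 \<and> x = par y)) \<and>
    (\<forall>x\<in>B. chain_kids par lev B x \<le> M) \<and>
    (\<Sum>u\<in>V-B. \<Sum>x | x \<in> B \<and> {u, x} \<in> E. if lev x \<ge> 1 \<and> par x \<notin> B then 0 else t ^ Suc (lev x)) \<le> 1 / 2"

lemma card_block_le: "finite B \<Longrightarrow> card (block B \<eta>) \<le> 2 ^ card B"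
proof (induction rule: finite_induct)
  case (insert z B)
  have "card (block (insert z B) \<eta>) \<le> card (block B \<eta>) + card (block B \<eta>)"
    unfolding block_insert[OF insert.hyps(2)]
    by (rule order_trans[OF card_Un_le]) (intro add_mono card_image_le finite_block insert)
  thus ?case using insert by simp
qed simp

text \<open>The number 4 bounds the odds ratios, and \<open>42 = 10 + 8 * 4\<close> is then the base
  in \<open>poincare_forest\<close>. The factor \<open>2 ^ card V * exp (2 * H)\<close> bounds the
  weight of a block relative to a single configuration. Each round of \<open>\<tau>\<close> steps
  halves the largest gap up to \<open>2 * \<delta>\<close>.\<close>

lemma glauber_mixing_time_le:
  fixes V :: "'a set"
  assumes V: "finite V" "V \<noteq> {}" and EV: "E \<subseteq> potential_edges V"
    and J: "\<And>e. e \<in> E \<Longrightarrow> 0 \<le> J e \<and> J e \<le> \<beta>" and \<beta>: "0 \<le> \<beta>" "exp (4 * \<beta>) \<le> 4"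
    and good: "\<And>v. v \<in> V \<Longrightarrow> \<exists>B par lev. good_block V E (tanh \<beta>) M v B par lev"
    and H: "\<And>\<sigma>. \<sigma> \<in> configs V \<Longrightarrow> \<bar>energy V E J h \<sigma>\<bar> \<le> H"
    and \<delta>: "0 \<le> \<delta>" "(1 - 1 / (real (card V) * 42 ^ M)) ^ \<tau> * (2 ^ card V * exp (2 * H)) \<le> \<delta>\<^sup>2"
    and j: "real (card V) * (2 * (1/2) ^ j + 4 * \<delta>) \<le> 1 / (2 * exp 1)"
  shows "glauber_mixing_time V E J h \<le> enat (j * \<tau>)"
proof -
  define w where "w = ising_weight V E J h"
  define Jm where "Jm = interaction E J"
  define n where "n = card V"
  have n: "n > 0" using V by (simp add: n_def card_gt_0_iff)
  have Jm: "0 \<le> Jm x y" "Jm x y \<le> \<beta>" "Jm x x = 0" for x y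
    using J \<beta> EV by (auto simp: Jm_def interaction_def potential_edges_def)
  have odds: "ising_odds V Jm w" unfolding Jm_def w_def by (rule ising_odds_ising_weight[OF V(1) EV])
  interpret ferromagnet V Jm w \<beta>
    by unfold_locales (use V Jm odds in auto)
  have step: "spin_gap (t + \<tau>) v \<le> (1/2) * a + 2 * \<delta>"
    if v: "v \<in> V" and a: "\<And>u. u \<in> V \<Longrightarrow> spin_gap t u \<le> a" "a \<ge> 0" for t v a
  proof -
    obtain B par lev where gb: "good_block V E (tanh \<beta>) M v B par lev" using good[OF v] by blast
    have BV: "B \<subseteq> V" and vB: "v \<in> B" and lev0: "lev v = 0" "\<And>x. x \<in> B \<Longrightarrow> lev x = 0 \<Longrightarrow> x = v"
      and lev: "\<And>x. x \<in> B \<Longrightarrow> lev x \<ge> 1 \<Longrightarrow> lev x = Suc (lev (par x))"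
      and adj: "\<And>x y. x \<in> B \<Longrightarrow> y \<in> B \<Longrightarrow> {x, y} \<in> E \<Longrightarrow> (lev x \<ge> 1 \<and> y = par x) \<or> (lev y \<ge> 1 \<and> x = par y)"
      and ck: "\<And>x. x \<in> B \<Longrightarrow> chain_kids par lev B x \<le> M"
      and bd: "(\<Sum>u\<in>V-B. \<Sum>x | x \<in> B \<and> {u, x} \<in> E. if lev x \<ge> 1 \<and> par x \<notin> B then 0 else tanh \<beta> ^ Suc (lev x)) \<le> 1 / 2"
      using gb unfolding good_block_def by blast+
    have fB: "finite B" using BV V by (blast intro: finite_subset)
    have cB: "card B \<le> n" unfolding n_def using BV V by (intro card_mono) auto
    have fw: "forest_weight par lev 4 B w"
      unfolding forest_weight_def
    proof (intro conjI ballI impI allI)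
      show "w \<sigma> > 0" for \<sigma> by (rule w_pos)
      fix x z \<sigma> assume xz: "x \<in> B" "z \<in> B" "x \<noteq> z"
      have cr: "cross_ratio w x z \<sigma> = exp (4 * Jm x z)"
        using xz BV Jm by (intro cross_ratio_ising_odds[OF odds V(1)]) auto
      have "exp (4 * Jm x z) \<le> exp (4 * \<beta>)" using Jm(2)[of x z] by simp
      thus "cross_ratio w x z \<sigma> \<le> 4" unfolding cr using \<beta> by linarith
      have "exp (4 * Jm x z) \<ge> 1" using Jm(1)[of x z] by simp
      thus "1 \<le> 4 * cross_ratio w x z \<sigma>" unfolding cr by linarith
      assume "\<not> (1 \<le> lev z \<and> par z = x) \<and> \<not> (1 \<le> lev x \<and> par x = z)"
      hence "{x, z} \<notin> E" using adj[of x z] xz by blast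
      thus "cross_ratio w x z \<sigma> = 1" unfolding cr by (simp add: Jm_def interaction_def)
    qed
    define m where "m \<eta> = mean w B \<eta> (\<lambda>\<sigma>. \<sigma> v)" for \<eta>
    define W :: real where "W = 42 ^ M"
    have W: "W \<ge> 1" by (simp add: W_def)
    have relax: "\<bar>(kernel B ^^ \<tau>) (\<lambda>\<sigma>. \<sigma> v) \<eta> - m \<eta>\<bar> \<le> \<delta>" if \<eta>: "\<eta> \<in> configs V" for \<eta>
    proof -
      have P: "block_var w B \<eta> f \<le> sum w (block B \<eta>) * dirichlet w B (\<lambda>_. W) \<eta> f" for f
      proof -
        have "dirichlet w B (\<lambda>x. (10 + 8 * 4) ^ chain_kids par lev B x) \<eta> f \<le> dirichlet w B (\<lambda>_. W) \<eta> f"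
          unfolding dirichlet_def W_def using ck
          by (intro sum_mono mult_right_mono sum_nonneg site_var_nonneg w_pos) (auto intro: power_increasing)
        hence "sum w (block B \<eta>) * dirichlet w B (\<lambda>x. (10 + 8 * 4) ^ chain_kids par lev B x) \<eta> f
          \<le> sum w (block B \<eta>) * dirichlet w B (\<lambda>_. W) \<eta> f"
          using w_pos by (intro mult_left_mono sum_nonneg) (auto simp: less_imp_le)
        thus ?thesis
          using poincare_forest[OF fB _ lev fw, of \<eta> f] by simp
      qed
      define X where "X = (kernel B ^^ \<tau>) (\<lambda>\<sigma>. \<sigma> v) \<eta> - m \<eta>"
      have vals: "\<bar>\<sigma> v\<bar> \<le> 1" if "\<sigma> \<in> block B \<eta>" for \<sigma>
        using that vB by (auto simp: block_def)
      have rel: "w \<eta> * X\<^sup>2 \<le> (1 - 1 / (real n * W)) ^ \<tau> * sum w (block B \<eta>)"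
        unfolding X_def m_def mean_def n_def[symmetric]
        by (rule block_relaxation[OF w_pos fB cB n W P self_in_block[OF \<eta> BV]]) (rule vals)
      have "sum w (block B \<eta>) \<le> (\<Sum>\<sigma>\<in>block B \<eta>. exp (2 * H) * w \<eta>)"
      proof (rule sum_mono)
        fix \<sigma> assume "\<sigma> \<in> block B \<eta>"
        hence "\<sigma> \<in> configs V" using block_subset_configs[OF \<eta> BV] by blast
        hence "energy V E J h \<sigma> \<le> 2 * H + energy V E J h \<eta>" using H[of \<sigma>] H[OF \<eta>] by linarith
        thus "w \<sigma> \<le> exp (2 * H) * w \<eta>" by (simp add: w_def ising_weight_energy flip: exp_add)
      qed
      also have "\<dots> = real (card (block B \<eta>)) * (exp (2 * H) * w \<eta>)" by simp
      also have "\<dots> \<le> 2 ^ n * (exp (2 * H) * w \<eta>)"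
      proof (rule mult_right_mono)
        have "card (block B \<eta>) \<le> 2 ^ card B" by (rule card_block_le[OF fB])
        also have "\<dots> \<le> 2 ^ n" using cB by (intro power_increasing) auto
        finally show "real (card (block B \<eta>)) \<le> 2 ^ n" by (metis of_nat_le_iff of_nat_numeral of_nat_power)
      qed (use w_pos[of \<eta>] in simp)
      finally have Zb: "sum w (block B \<eta>) \<le> w \<eta> * (2 ^ n * exp (2 * H))" by (simp add: mult_ac)
      have nW: "real n * W \<ge> 1" using n W by (metis One_nat_def Suc_leI mult_mono' mult_1 of_nat_1 of_nat_mono zero_le_one)
      have g0: "(1 - 1 / (real n * W)) ^ \<tau> \<ge> 0" using nW by (intro zero_le_power) simp
      have "w \<eta> * X\<^sup>2 \<le> (1 - 1 / (real n * W)) ^ \<tau> * (w \<eta> * (2 ^ n * exp (2 * H)))"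
        using rel mult_left_mono[OF Zb g0] by linarith
      also have "\<dots> = w \<eta> * ((1 - 1 / (real n * W)) ^ \<tau> * (2 ^ n * exp (2 * H)))" by (simp add: mult_ac)
      also have "\<dots> \<le> w \<eta> * \<delta>\<^sup>2" using \<delta>(2) w_pos[of \<eta>] by (intro mult_left_mono) (auto simp: n_def W_def)
      finally have "X\<^sup>2 \<le> \<delta>\<^sup>2" using w_pos[of \<eta>] by simp
      thus ?thesis unfolding X_def[symmetric] using \<delta>(1) by (simp add: abs_le_square_iff[symmetric])
    qed
    define bnd where "bnd x = (if lev x \<ge> 1 \<and> par x \<notin> B then 0 else tanh \<beta> ^ Suc (lev x))" for x
    define c where "c u = (\<Sum>x | x \<in> B \<and> {u, x} \<in> E. bnd x)" for u
    have b0: "bnd x \<ge> 0" for x using \<beta> by (simp add: bnd_def)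
    have lip: "\<bar>m (\<eta>(u := 1)) - m (\<eta>(u := -1))\<bar> \<le> 2 * c u" if u: "u \<in> V - B" for \<eta> u
    proof -
      have "\<bar>m (\<eta>(u := 1)) - m (\<eta>(u := -1))\<bar> \<le> (\<Sum>y | y \<in> B \<and> Jm u y \<noteq> 0. 2 * bnd y)"
        unfolding m_def
      proof (rule mean_flip[where V = V and J = Jm and \<beta> = \<beta>])
        fix w' y s assume w': "ising_odds V Jm w'" and y: "y \<in> B" and s: "0 \<le> s" "s \<le> 2 * \<beta>"
        have "\<bar>mean (tilt s y w') B (\<eta>(u := -1)) (\<lambda>\<sigma>. \<sigma> v) - mean w' B (\<eta>(u := -1)) (\<lambda>\<sigma>. \<sigma> v)\<bar>
          \<le> (if lev y \<ge> 1 \<and> par y \<notin> B then 0 else 2 * tanh \<beta> ^ Suc (lev y))"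
        proof (rule mean_tilt_forest[OF V(1) Jm BV w' lev0(1) lev0(2) lev _ y s])
          fix x y assume "x \<in> B" "y \<in> B" "Jm x y \<noteq> 0"
          thus "(1 \<le> lev x \<and> y = par x) \<or> (1 \<le> lev y \<and> x = par y)"
            by (intro adj) (auto simp: Jm_def interaction_def split: if_splits)
        qed
        thus "\<bar>mean (tilt s y w') B (\<eta>(u := -1)) (\<lambda>\<sigma>. \<sigma> v) - mean w' B (\<eta>(u := -1)) (\<lambda>\<sigma>. \<sigma> v)\<bar> \<le> 2 * bnd y"
          by (cases "lev y \<ge> 1 \<and> par y \<notin> B") (auto simp: bnd_def)
      qed (use Jm V BV u odds vB in auto)
      also have "\<dots> \<le> (\<Sum>y | y \<in> B \<and> {u, y} \<in> E. 2 * bnd y)"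
        using fB b0 by (intro sum_mono2) (auto simp: Jm_def interaction_def split: if_splits)
      finally show ?thesis by (simp add: c_def sum_distrib_left)
    qed
    have loc: "m (\<eta>(x := b)) = m \<eta>" if "x \<in> B" for \<eta> x b
    proof -
      have "block B (\<eta>(x := b)) = block B \<eta>" using that by (auto simp: block_def)
      thus ?thesis by (simp add: m_def mean_def)
    qed
    have "spin_gap (t + \<tau>) v \<le> (\<Sum>u\<in>V-B. c u * spin_gap t u) + 2 * \<delta>"
      by (rule spin_gap_step[OF BV relax loc lip])
    also have "(\<Sum>u\<in>V-B. c u * spin_gap t u) \<le> (\<Sum>u\<in>V-B. c u * a)"
      using a b0 by (intro sum_mono mult_left_mono) (auto simp: c_def intro!: sum_nonneg)
    also have "\<dots> = (\<Sum>u\<in>V-B. c u) * a" by (simp add: sum_distrib_right)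
    also have "\<dots> \<le> (1/2) * a" using bd a(2) unfolding c_def bnd_def by (rule mult_right_mono)
    finally show ?thesis by simp
  qed
  \<comment> \<open>The initial gap is 2, and \<open>4 * \<delta>\<close> is the fixed point of the
    map taking \<open>a\<close> to \<open>a / 2 + 2 * \<delta>\<close>.\<close>
  have iter: "spin_gap (i * \<tau>) v \<le> 2 * (1/2) ^ i + 4 * \<delta>" if "v \<in> V" for i v
    using that
  proof (induction i arbitrary: v)
    case 0
    thus ?case using \<delta> by (simp add: spin_gap_def plus_config_def minus_config_def)
  next
    case (Suc i)
    have "spin_gap (i * \<tau> + \<tau>) v \<le> (1/2) * (2 * (1/2) ^ i + 4 * \<delta>) + 2 * \<delta>"
      using Suc \<delta> by (intro step) auto
    thus ?case by (simp add: add.commute add_divide_distrib)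
  qed
  have total: "(\<Sum>v\<in>V. spin_gap (j * \<tau>) v) \<le> 1 / (2 * exp 1)"
  proof -
    have "(\<Sum>v\<in>V. spin_gap (j * \<tau>) v) \<le> (\<Sum>v\<in>V. 2 * (1/2) ^ j + 4 * \<delta>)" by (intro sum_mono iter)
    also have "\<dots> = real (card V) * (2 * (1/2) ^ j + 4 * \<delta>)" by simp
    finally show ?thesis using j by linarith
  qed
  have "tv_dist (chain_pmf (glauber_step V E J h) (j * \<tau>) x) (ising_pmf V E J h) \<le> 1 / (2 * exp 1)"
    if x: "x \<in> configs V" for x
    unfolding tv_dist_def
  proof (rule cSUP_least)
    fix A :: "('a \<Rightarrow> real) set"
    define C where "C = chain_pmf (glauber_step V E J h) (j * \<tau>) x"
    have c1: "measure_pmf.prob C A = (kernel V ^^ (j * \<tau>)) (indicator A) x"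
      using expectation_chain_glauber[OF V EV x, of J h "j * \<tau>" "indicator A"]
      by (simp add: C_def w_def)
    have fc: "finite (configs V)" using V finite_configs by blast
    have Z: "partition_function V E J h = sum w (configs V)" by (simp add: partition_function_def w_def)
    have "measure_pmf.prob (ising_pmf V E J h) A = measure_pmf.expectation (ising_pmf V E J h) (indicator A)"
      by simp
    also have "\<dots> = (\<Sum>\<sigma>\<in>configs V. indicator A \<sigma> * pmf (ising_pmf V E J h) \<sigma>)"
      using fc V by (intro integral_measure_pmf_real) (auto simp: set_pmf_iff pmf_ising_pmf split: if_splits)
    also have "\<dots> = (\<Sum>\<sigma>\<in>configs V. w \<sigma> * indicator A \<sigma>) / sum w (configs V)"
      using V by (simp add: pmf_ising_pmf Z w_def[symmetric] sum_divide_distrib mult.commute)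
    finally have c2: "measure_pmf.prob (ising_pmf V E J h) A = (\<Sum>\<sigma>\<in>configs V. w \<sigma> * indicator A \<sigma>) / sum w (configs V)" .
    have "\<bar>measure_pmf.prob C A - measure_pmf.prob (ising_pmf V E J h) A\<bar> \<le> (\<Sum>v\<in>V. spin_gap (j * \<tau>) v)"
      unfolding c1 c2 by (rule kernel_funpow_equilibrium) (use x in \<open>auto simp: indicator_def\<close>)
    thus "\<bar>measure_pmf.prob C A - measure_pmf.prob (ising_pmf V E J h) A\<bar> \<le> 1 / (2 * exp 1)" using total by linarith
  qed simp
  thus ?thesis unfolding glauber_mixing_time_def mixing_time_def by (intro Inf_lower) auto
qed

section \<open>Exploration of the random graph\<close>

lemma prob_le_expectation:
  assumes fin: "finite (set_pmf p)" and f: "\<And>x. x \<in> set_pmf p \<Longrightarrow> 0 \<le> f x"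
    and P: "\<And>x. x \<in> set_pmf p \<Longrightarrow> P x \<Longrightarrow> 1 \<le> f x"
  shows "measure_pmf.prob p {x. P x} \<le> measure_pmf.expectation p f"
proof -
  have "measure_pmf.prob p {x. P x} = measure_pmf.expectation p (indicator {x. P x})" by simp
  also have "\<dots> \<le> measure_pmf.expectation p f"
    using f P fin by (intro integral_mono_AE integrable_measure_pmf_finite)
      (auto simp: AE_measure_pmf_iff indicator_def)
  finally show ?thesis .
qed

lemma prob_Ex_le:
  assumes "finite I" "\<And>i. i \<in> I \<Longrightarrow> measure_pmf.prob p {x. P i x} \<le> b i"
  shows "measure_pmf.prob p {x. \<exists>i\<in>I. P i x} \<le> sum b I"
proof -
  have "{x. \<exists>i\<in>I. P i x} = (\<Union>i\<in>I. {x. P i x})" by auto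
  hence "measure_pmf.prob p {x. \<exists>i\<in>I. P i x} \<le> (\<Sum>i\<in>I. measure_pmf.prob p {x. P i x})"
    using measure_pmf.finite_measure_subadditive_finite[OF assms(1), of "\<lambda>i. {x. P i x}" p] by simp
  also have "\<dots> \<le> sum b I" using assms by (intro sum_mono)
  finally show ?thesis .
qed

lemma expectation_pair_pmf_mult:
  fixes f :: "'a \<Rightarrow> real" and g :: "'b \<Rightarrow> real"
  assumes "finite (set_pmf p)" "finite (set_pmf q)"
  shows "measure_pmf.expectation (pair_pmf p q) (\<lambda>(a, b). f a * g b)
     = measure_pmf.expectation p f * measure_pmf.expectation q g"
proof -
  have "measure_pmf.expectation (pair_pmf p q) (\<lambda>(a, b). f a * g b)
     = (\<Sum>(a,b)\<in>set_pmf p \<times> set_pmf q. (f a * pmf p a) * (g b * pmf q b))"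
    using assms by (subst integral_measure_pmf_real[of "set_pmf p \<times> set_pmf q"])
      (auto intro!: sum.cong simp: pmf_pair)
  also have "\<dots> = (\<Sum>a\<in>set_pmf p. f a * pmf p a) * (\<Sum>b\<in>set_pmf q. g b * pmf q b)"
    by (simp add: sum_product sum.cartesian_product)
  also have "\<dots> = measure_pmf.expectation p f * measure_pmf.expectation q g"
    using assms by (subst (1 2) integral_measure_pmf_real[where A = "set_pmf _"]) auto
  finally show ?thesis .
qed

lemma set_gnp: "set_pmf (gnp n p) \<subseteq> Pow (potential_edges {..<n})"
  unfolding gnp_def by auto

lemma finite_set_gnp: "finite (set_pmf (gnp n p))"
  using finite_subset[OF set_gnp] finite_potential_edges[of "{..<n}"] by auto

lemma finite_set_Pi_bernoulli: "finite P \<Longrightarrow> finite (set_pmf (Pi_pmf P False (\<lambda>_. bernoulli_pmf p)))"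
  by (auto simp: set_Pi_pmf intro!: finite_PiE_dflt)

lemma gnp_expectation_prod:
  fixes \<phi> :: "nat set \<Rightarrow> bool \<Rightarrow> real"
  assumes p: "0 \<le> p" "p \<le> 1" and nn: "\<And>e b. 0 \<le> \<phi> e b"
  shows "measure_pmf.expectation (gnp n p) (\<lambda>E. \<Prod>e\<in>potential_edges {..<n}. \<phi> e (e \<in> E))
    = (\<Prod>e\<in>potential_edges {..<n}. p * \<phi> e True + (1 - p) * \<phi> e False)"
proof -
  have "measure_pmf.expectation (gnp n p) (\<lambda>E. \<Prod>e\<in>potential_edges {..<n}. \<phi> e (e \<in> E))
    = measure_pmf.expectation (Pi_pmf (potential_edges {..<n}) False (\<lambda>_. bernoulli_pmf p))
        (\<lambda>y. \<Prod>e\<in>potential_edges {..<n}. \<phi> e (y e))"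
    unfolding gnp_def by (simp cong: prod.cong)
  also have "\<dots> = (\<Prod>e\<in>potential_edges {..<n}. measure_pmf.expectation (bernoulli_pmf p) (\<phi> e))"
    using nn by (intro expectation_prod_Pi_pmf integrable_measure_pmf_finite finite_potential_edges) auto
  also have "\<dots> = (\<Prod>e\<in>potential_edges {..<n}. p * \<phi> e True + (1 - p) * \<phi> e False)"
    using p by (simp add: mult.commute)
  finally show ?thesis .
qed

text \<open>Independence factorises the expectation over the edges. The factor 2 comes from
  \<open>exp \<theta> \<le> 1 + 2 * \<theta>\<close> on the unit interval; it is the reason why
  spheres are later compared with \<open>(2 * d) ^ r\<close> and not with
  \<open>d ^ r\<close>.\<close>

lemma gnp_expectation_subset_exp:
  assumes p: "0 \<le> p" "p \<le> 1" and F: "F \<subseteq> potential_edges {..<n}" and T: "T \<subseteq> potential_edges {..<n}" "F \<inter> T = {}"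
    and \<theta>: "0 \<le> \<theta>" "\<theta> \<le> 1"
  shows "measure_pmf.expectation (gnp n p) (\<lambda>E. if F \<subseteq> E then exp (\<theta> * real (card (E \<inter> T))) else 0)
    \<le> p ^ card F * exp (2 * \<theta> * p * real (card T))"
proof -
  define PE where "PE = potential_edges {..<n}"
  have fin: "finite PE" "finite F" "finite T"
    using F T finite_potential_edges[of "{..<n}"] finite_subset by (auto simp: PE_def)
  define \<phi> where "\<phi> e b = (if e \<in> F then (if b then 1 else 0) else if e \<in> T then (if b then exp \<theta> else 1) else (1::real))" for e b
  have e: "(if F \<subseteq> E then exp (\<theta> * real (card (E \<inter> T))) else 0) = (\<Prod>e\<in>PE. \<phi> e (e \<in> E))" for E
  proof -
    have "(\<Prod>e\<in>PE. \<phi> e (e \<in> E)) = (\<Prod>e\<in>F \<union> T. \<phi> e (e \<in> E))"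
      using fin F T by (intro prod.mono_neutral_right) (auto simp: \<phi>_def PE_def)
    also have "\<dots> = (\<Prod>e\<in>F. \<phi> e (e \<in> E)) * (\<Prod>e\<in>T. \<phi> e (e \<in> E))"
      using fin T by (intro prod.union_disjoint)
    also have "(\<Prod>e\<in>F. \<phi> e (e \<in> E)) = (\<Prod>e\<in>F. if e \<in> E then 1 else 0)"
      by (intro prod.cong) (auto simp: \<phi>_def)
    also have "\<dots> = (if F \<subseteq> E then 1 else 0)"
    proof (cases "F \<subseteq> E")
      case True
      hence "(\<Prod>e\<in>F. if e \<in> E then 1 else 0) = (\<Prod>e\<in>F. 1 :: real)" by (intro prod.cong) auto
      thus ?thesis using True by simp
    next
      case False
      thus ?thesis using fin by (auto intro!: prod_zero)
    qed
    also have "(\<Prod>e\<in>T. \<phi> e (e \<in> E)) = (\<Prod>e\<in>T. if e \<in> E then exp \<theta> else 1)"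
      using T by (intro prod.cong) (auto simp: \<phi>_def)
    also have "\<dots> = (\<Prod>e\<in>T \<inter> E. exp \<theta>)" using fin by (intro prod.inter_restrict[symmetric])
    also have "\<dots> = exp (\<theta> * real (card (E \<inter> T)))" by (simp add: exp_of_nat_mult[symmetric] Int_commute mult.commute)
    finally show ?thesis by simp
  qed
  have "measure_pmf.expectation (gnp n p) (\<lambda>E. if F \<subseteq> E then exp (\<theta> * real (card (E \<inter> T))) else 0)
    = (\<Prod>e\<in>PE. p * \<phi> e True + (1 - p) * \<phi> e False)"
    unfolding e PE_def by (rule gnp_expectation_prod[OF p]) (simp add: \<phi>_def)
  also have "\<dots> = (\<Prod>e\<in>F \<union> T. p * \<phi> e True + (1 - p) * \<phi> e False)"
    using fin F T by (intro prod.mono_neutral_right) (auto simp: \<phi>_def PE_def)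
  also have "\<dots> = (\<Prod>e\<in>F. p * \<phi> e True + (1 - p) * \<phi> e False) * (\<Prod>e\<in>T. p * \<phi> e True + (1 - p) * \<phi> e False)"
    using fin T by (intro prod.union_disjoint)
  also have "(\<Prod>e\<in>F. p * \<phi> e True + (1 - p) * \<phi> e False) = (\<Prod>e\<in>F. p)"
    by (intro prod.cong) (auto simp: \<phi>_def)
  also have "(\<Prod>e\<in>T. p * \<phi> e True + (1 - p) * \<phi> e False) = (\<Prod>e\<in>T. p * exp \<theta> + (1 - p))"
    using T by (intro prod.cong) (auto simp: \<phi>_def)
  also have "\<dots> \<le> (\<Prod>e\<in>T. exp (2 * \<theta> * p))"
  proof (intro prod_mono conjI)
    have "exp \<theta> \<le> 1 + \<theta> + \<theta>\<^sup>2" using \<theta> by (rule exp_bound)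
    moreover have "\<theta>\<^sup>2 \<le> \<theta>" using \<theta> by (simp add: power2_eq_square mult_left_le)
    ultimately have "p * exp \<theta> + (1 - p) \<le> 1 + 2 * \<theta> * p"
      using mult_left_mono[of "exp \<theta>" "1 + 2 * \<theta>" p] p by (simp add: algebra_simps)
    also have "\<dots> \<le> exp (2 * \<theta> * p)" by (rule exp_ge_add_one_self)
    finally show "p * exp \<theta> + (1 - p) \<le> exp (2 * \<theta> * p)" .
    show "0 \<le> p * exp \<theta> + (1 - p)" using p by simp
  qed
  also have "\<dots> = exp (2 * \<theta> * p * real (card T))" by (simp add: exp_of_nat_mult[symmetric] mult.commute)
  finally show ?thesis using p by (simp add: mult_left_mono)
qed

lemma gnp_prob_subset_many:
  assumes p: "0 \<le> p" "p \<le> 1" and F: "F \<subseteq> potential_edges {..<n}" and T: "T \<subseteq> potential_edges {..<n}" "F \<inter> T = {}"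
  shows "measure_pmf.prob (gnp n p) {E. F \<subseteq> E \<and> M \<le> real (card (E \<inter> T))}
    \<le> p ^ card F * exp (2 * p * real (card T)) * exp (- M)"
proof -
  define f where "f E = (if F \<subseteq> E then exp (1 * real (card (E \<inter> T))) else 0)" for E
  have "measure_pmf.prob (gnp n p) {E. F \<subseteq> E \<and> M \<le> real (card (E \<inter> T))}
    \<le> measure_pmf.expectation (gnp n p) (\<lambda>E. f E * exp (- M))"
    by (intro prob_le_expectation finite_set_gnp) (auto simp: f_def simp flip: exp_add)
  also have "\<dots> = measure_pmf.expectation (gnp n p) f * exp (- M)" by simp
  also have "\<dots> \<le> p ^ card F * exp (2 * 1 * p * real (card T)) * exp (- M)"
    unfolding f_def by (intro mult_right_mono gnp_expectation_subset_exp p F T) auto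
  finally show ?thesis by simp
qed

lemma gnp_expectation_indep:
  fixes f g :: "nat set set \<Rightarrow> real"
  assumes P: "P \<subseteq> potential_edges {..<n}" and Q: "Q \<subseteq> potential_edges {..<n}" "P \<inter> Q = {}"
    and f: "\<And>E. f E = f (E \<inter> P)" and g: "\<And>E. g E = g (E \<inter> Q)"
  shows "measure_pmf.expectation (gnp n p) (\<lambda>E. f E * g E)
    = measure_pmf.expectation (gnp n p) f * measure_pmf.expectation (gnp n p) g"
proof -
  define PE where "PE = potential_edges {..<n}"
  define R where "R = PE - P"
  have fPE: "finite PE" by (simp add: PE_def finite_potential_edges)
  hence fin: "finite P" "finite R" using P by (auto simp: R_def PE_def intro: finite_subset)
  have PR: "P \<union> R = PE" "P \<inter> R = {}" "Q \<subseteq> R" using P Q by (auto simp: R_def PE_def)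
  define \<mu> where "\<mu> = Pi_pmf P False (\<lambda>_. bernoulli_pmf p)"
  define \<nu> where "\<nu> = Pi_pmf R False (\<lambda>_. bernoulli_pmf p)"
  define \<pi> where "\<pi> = pair_pmf \<mu> \<nu>"
  have f\<mu>: "finite (set_pmf \<mu>)" "finite (set_pmf \<nu>)" unfolding \<mu>_def \<nu>_def by (intro finite_set_Pi_bernoulli fin)+
  define U where "U = (\<lambda>(a, b). {e \<in> PE. if e \<in> P then a e else b e})"
  have gn: "gnp n p = map_pmf U \<pi>"
    unfolding gnp_def PE_def[symmetric] PR(1)[symmetric] U_def \<pi>_def \<mu>_def \<nu>_def
    by (subst Pi_pmf_union[OF fin PR(2)]) (simp add: map_pmf_comp case_prod_unfold)
  define a where "a = (\<lambda>\<alpha>. f {e \<in> P. \<alpha> e})"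
  define b where "b = (\<lambda>\<alpha>. g {e \<in> Q. \<alpha> e})"
  have fU: "f (U (\<alpha>, \<gamma>)) = a \<alpha>" for \<alpha> \<gamma>
  proof -
    have "U (\<alpha>, \<gamma>) \<inter> P = {e \<in> P. \<alpha> e}" using P by (auto simp: U_def PE_def)
    thus ?thesis unfolding a_def by (subst f) simp
  qed
  hence fU': "f (U x) = a (fst x)" for x by (cases x) simp
  have gU: "g (U (\<alpha>, \<gamma>)) = b \<gamma>" for \<alpha> \<gamma>
  proof -
    have "U (\<alpha>, \<gamma>) \<inter> Q = {e \<in> Q. \<gamma> e}" using P Q by (auto simp: U_def PE_def)
    thus ?thesis unfolding b_def by (subst g) simp
  qed
  hence gU': "g (U x) = b (snd x)" for x by (cases x) simp
  have e1: "measure_pmf.expectation (gnp n p) (\<lambda>E. f E * g E) = measure_pmf.expectation \<mu> a * measure_pmf.expectation \<nu> b"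
    unfolding gn using expectation_pair_pmf_mult[OF f\<mu>, of a b] by (simp add: \<pi>_def case_prod_unfold fU' gU')
  have e2: "measure_pmf.expectation (gnp n p) f = measure_pmf.expectation \<mu> a"
    unfolding gn using expectation_pair_pmf_mult[OF f\<mu>, of a "\<lambda>_. 1"] by (simp add: \<pi>_def case_prod_unfold fU')
  have e3: "measure_pmf.expectation (gnp n p) g = measure_pmf.expectation \<nu> b"
    unfolding gn using expectation_pair_pmf_mult[OF f\<mu>, of "\<lambda>_. 1" b] by (simp add: \<pi>_def case_prod_unfold gU')
  show ?thesis unfolding e1 e2 e3 ..
qed

section \<open>Growth of the explored layers\<close>

definition nbrs :: "'a set set \<Rightarrow> 'a set \<Rightarrow> 'a set \<Rightarrow> 'a set" where
  "nbrs E A U = {x \<in> U. \<exists>y\<in>A. {y, x} \<in> E}"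

text \<open>The recursion removes the first layer, so that the remaining exploration depends only on edges
  inside \<open>U\<close>, which are independent of the edges between \<open>A\<close> and \<open>U\<close> that determine that layer.\<close>

fun layer :: "'a set set \<Rightarrow> 'a set \<Rightarrow> 'a set \<Rightarrow> nat \<Rightarrow> 'a set" where
  "layer E A U 0 = A"
| "layer E A U (Suc r) = layer E (nbrs E A U) (U - nbrs E A U) r"

lemma layer_restrict:
  assumes "A \<subseteq> W" "U \<subseteq> W" shows "layer E A U r = layer (E \<inter> Pow W) A U r"
  using assms
proof (induction r arbitrary: A U)
  case (Suc r)
  have n: "nbrs (E \<inter> Pow W) A U = nbrs E A U" using Suc.prems by (auto simp: nbrs_def)
  have "nbrs E A U \<subseteq> W" using Suc.prems by (auto simp: nbrs_def)
  thus ?case unfolding layer.simps n using Suc.prems by (intro Suc.IH) auto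
qed simp

text \<open>The recursion for exponential moments of a branching process. Given the first layer
  \<open>N\<close>, the induction hypothesis bounds the later growth in terms of
  \<open>card N\<close>, which is at most the number of present edges between \<open>A\<close> and
  \<open>U\<close>. The condition \<open>\<theta> * D ^ r \<le> 1\<close> keeps the parameter at
  most 1 in every generation.\<close>

lemma gnp_layer_exp:
  assumes p: "0 \<le> p" "p \<le> 1" and D: "1 \<le> D" "2 * real n * p \<le> D"
  shows "A \<subseteq> {..<n} \<Longrightarrow> U \<subseteq> {..<n} \<Longrightarrow> A \<inter> U = {} \<Longrightarrow> 0 \<le> \<theta> \<Longrightarrow> \<theta> * D ^ r \<le> 1 \<Longrightarrow>
    measure_pmf.expectation (gnp n p) (\<lambda>E. exp (\<theta> * real (card (layer E A U r)))) \<le> exp (\<theta> * D ^ r * real (card A))"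
proof (induction r arbitrary: A U)
  case (Suc r)
  define PE where "PE = potential_edges {..<n}"
  define P where "P = {e \<in> PE. e \<inter> A \<noteq> {} \<and> e \<inter> U \<noteq> {}}"
  define Q where "Q = {e \<in> PE. e \<subseteq> U}"
  have fU: "finite U" "finite A" using Suc.prems by (auto intro: finite_subset[OF _ finite_lessThan])
  define F where "F N E = exp (\<theta> * real (card (layer E N (U - N) r)))" for N E
  have PQ: "P \<inter> Q = {}" using Suc.prems(3) by (auto simp: P_def Q_def)
  have int: "integrable (measure_pmf (gnp n p)) h" for h :: "_ \<Rightarrow> real"
    by (rule integrable_measure_pmf_finite[OF finite_set_gnp])
  define \<theta>' where "\<theta>' = \<theta> * D ^ r"
  have \<theta>': "0 \<le> \<theta>'" "\<theta>' \<le> 1" "\<theta>' * D \<le> 1"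
  proof -
    show 0: "0 \<le> \<theta>'" using Suc.prems D by (simp add: \<theta>'_def)
    show "\<theta>' * D \<le> 1" using Suc.prems by (simp add: \<theta>'_def mult_ac)
    thus "\<theta>' \<le> 1" using mult_left_mono[OF D(1) 0] by simp
  qed
  \<comment> \<open>Decomposition by the value \<open>N\<close> of the first layer. The indicator
    sees only the edges in \<open>P\<close>, between \<open>A\<close> and \<open>U\<close>, and
    \<open>F N\<close> only those in \<open>Q\<close>, inside \<open>U\<close>, so that every
    summand is a product of independent factors.\<close>
  have "measure_pmf.expectation (gnp n p) (\<lambda>E. exp (\<theta> * real (card (layer E A U (Suc r)))))
    = measure_pmf.expectation (gnp n p) (\<lambda>E. \<Sum>N\<in>Pow U. indicator {E. nbrs (E \<inter> P) A U = N} E * F N (E \<inter> Q))"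
  proof (intro integral_cong_AE)
    show "AE E in measure_pmf (gnp n p). exp (\<theta> * real (card (layer E A U (Suc r)))) =
       (\<Sum>N\<in>Pow U. indicator {E. nbrs (E \<inter> P) A U = N} E * F N (E \<inter> Q))"
      unfolding AE_measure_pmf_iff
    proof
      fix E assume "E \<in> set_pmf (gnp n p)"
      hence E: "E \<subseteq> PE" using set_gnp by (auto simp: PE_def)
      have n1: "nbrs (E \<inter> P) A U = nbrs E A U" using E by (auto simp: nbrs_def P_def)
      have n2: "nbrs E A U \<in> Pow U" by (auto simp: nbrs_def)
      have "(\<Sum>N\<in>Pow U. indicator {E. nbrs (E \<inter> P) A U = N} E * F N (E \<inter> Q))
        = (\<Sum>N\<in>Pow U. if N = nbrs E A U then F N (E \<inter> Q) else 0)"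
        by (intro sum.cong) (auto simp: n1)
      also have "\<dots> = F (nbrs E A U) (E \<inter> Q)" using fU n2 by (simp add: sum.delta)
      also have "F (nbrs E A U) (E \<inter> Q) = F (nbrs E A U) (E \<inter> Pow U)"
        using E by (intro arg_cong[where f = "F _"]) (auto simp: Q_def)
      also have "\<dots> = F (nbrs E A U) E"
        unfolding F_def using n2 by (subst layer_restrict[of _ U _ E]) auto
      finally show "exp (\<theta> * real (card (layer E A U (Suc r)))) =
         (\<Sum>N\<in>Pow U. indicator {E. nbrs (E \<inter> P) A U = N} E * F N (E \<inter> Q))" by (simp add: F_def)
    qed
  qed auto
  also have "\<dots> = (\<Sum>N\<in>Pow U. measure_pmf.expectation (gnp n p) (\<lambda>E. indicator {E. nbrs (E \<inter> P) A U = N} E * F N (E \<inter> Q)))"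
    by (intro Bochner_Integration.integral_sum int)
  also have "\<dots> = (\<Sum>N\<in>Pow U. measure_pmf.expectation (gnp n p) (\<lambda>E. indicator {E. nbrs (E \<inter> P) A U = N} E)
      * measure_pmf.expectation (gnp n p) (\<lambda>E. F N (E \<inter> Q)))"
    by (intro sum.cong refl gnp_expectation_indep[where P = P and Q = Q] PQ) (auto simp: P_def Q_def PE_def indicator_def Int_assoc)
  also have "\<dots> \<le> (\<Sum>N\<in>Pow U. measure_pmf.expectation (gnp n p) (\<lambda>E. indicator {E. nbrs (E \<inter> P) A U = N} E) * exp (\<theta>' * real (card N)))"
  proof (rule sum_mono, rule mult_left_mono)
    fix N assume N: "N \<in> Pow U"
    have "measure_pmf.expectation (gnp n p) (\<lambda>E. F N (E \<inter> Q)) = measure_pmf.expectation (gnp n p) (F N)"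
    proof (intro integral_cong_AE)
      show "AE E in measure_pmf (gnp n p). F N (E \<inter> Q) = F N E"
        unfolding AE_measure_pmf_iff
      proof
        fix E assume "E \<in> set_pmf (gnp n p)"
        hence "E \<inter> Q = E \<inter> Pow U" using set_gnp by (force simp: Q_def PE_def)
        moreover have "layer E N (U - N) r = layer (E \<inter> Pow U) N (U - N) r"
          using N by (intro layer_restrict) auto
        ultimately show "F N (E \<inter> Q) = F N E" by (simp add: F_def)
      qed
    qed auto
    also have "\<dots> \<le> exp (\<theta>' * real (card N))"
      unfolding F_def \<theta>'_def using N Suc.prems(1,2,4) \<theta>' by (intro Suc.IH) (auto simp: \<theta>'_def)
    finally show "measure_pmf.expectation (gnp n p) (\<lambda>E. F N (E \<inter> Q)) \<le> exp (\<theta>' * real (card N))" .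
  qed simp
  also have "\<dots> = measure_pmf.expectation (gnp n p) (\<lambda>E. \<Sum>N\<in>Pow U. indicator {E. nbrs (E \<inter> P) A U = N} E * exp (\<theta>' * real (card N)))"
    by (subst Bochner_Integration.integral_sum) (auto intro: int)
  also have "\<dots> \<le> measure_pmf.expectation (gnp n p) (\<lambda>E. if {} \<subseteq> E then exp (\<theta>' * real (card (E \<inter> P))) else 0)"
  proof (intro integral_mono int)
    fix E
    have n2: "nbrs (E \<inter> P) A U \<in> Pow U" by (auto simp: nbrs_def)
    have "(\<Sum>N\<in>Pow U. indicator {E. nbrs (E \<inter> P) A U = N} E * exp (\<theta>' * real (card N)))
      = (\<Sum>N\<in>Pow U. if N = nbrs (E \<inter> P) A U then exp (\<theta>' * real (card N)) else 0)"
      by (intro sum.cong) auto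
    also have "\<dots> = exp (\<theta>' * real (card (nbrs (E \<inter> P) A U)))" using fU n2 by (simp add: sum.delta)
    also have "\<dots> \<le> exp (\<theta>' * real (card (E \<inter> P)))"
    proof -
      have fP: "finite (E \<inter> P)" unfolding P_def PE_def using finite_potential_edges[of "{..<n}"] by auto
      have "nbrs (E \<inter> P) A U \<subseteq> (\<lambda>e. THE x. x \<in> e \<inter> U) ` (E \<inter> P)"
      proof
        fix x assume "x \<in> nbrs (E \<inter> P) A U"
        then obtain y where y: "y \<in> A" "{y, x} \<in> E \<inter> P" "x \<in> U" by (auto simp: nbrs_def)
        hence "{y, x} \<inter> U = {x}" using Suc.prems(3) by auto
        hence "x = (THE z. z \<in> {y, x} \<inter> U)" by simp
        thus "x \<in> (\<lambda>e. THE x. x \<in> e \<inter> U) ` (E \<inter> P)" using y(2) by (rule image_eqI)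
      qed
      hence "card (nbrs (E \<inter> P) A U) \<le> card (E \<inter> P)" by (rule surj_card_le[OF fP])
      thus ?thesis using \<theta>' by (simp add: mult_left_mono)
    qed
    finally show "(\<Sum>N\<in>Pow U. indicator {E. nbrs (E \<inter> P) A U = N} E * exp (\<theta>' * real (card N)))
      \<le> (if {} \<subseteq> E then exp (\<theta>' * real (card (E \<inter> P))) else 0)" by simp
  qed
  also have "\<dots> \<le> p ^ card ({} :: nat set set) * exp (2 * \<theta>' * p * real (card P))"
    by (intro gnp_expectation_subset_exp p \<theta>') (auto simp: P_def PE_def)
  also have "\<dots> \<le> exp (\<theta> * D ^ Suc r * real (card A))"
  proof -
    have "P \<subseteq> (\<lambda>(x, y). {x, y}) ` (A \<times> U)"
    proof
      fix e assume e: "e \<in> P"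
      then obtain x where x: "x \<in> e" "x \<in> A" by (auto simp: P_def)
      obtain y where y: "e = {x, y}" using edge_cases[of e "{..<n}" x] e x by (auto simp: P_def PE_def)
      hence "y \<in> U" using e x Suc.prems(3) by (auto simp: P_def)
      thus "e \<in> (\<lambda>(x, y). {x, y}) ` (A \<times> U)" using x y by auto
    qed
    hence "card P \<le> card (A \<times> U)" using fU by (intro surj_card_le) auto
    also have "\<dots> \<le> card A * n"
      using card_mono[OF finite_lessThan Suc.prems(2)] by (simp add: card_cartesian_product)
    finally have "real (card P) \<le> real (card A) * real n" by (metis of_nat_le_iff of_nat_mult)
    hence "2 * \<theta>' * p * real (card P) \<le> 2 * \<theta>' * p * (real (card A) * real n)"
      using \<theta>' p by (intro mult_left_mono) auto
    also have "\<dots> = \<theta>' * real (card A) * (2 * real n * p)" by simp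
    also have "\<dots> \<le> \<theta>' * real (card A) * D" using \<theta>' D by (intro mult_left_mono) auto
    finally show ?thesis by (simp add: \<theta>'_def mult_ac)
  qed
  finally show ?case .
qed simp

text \<open>The exponential Markov inequality with \<open>\<theta> = 1 / D ^ r\<close>, the largest
  parameter that \<open>gnp_layer_exp\<close> admits.\<close>

lemma gnp_layer_tail:
  assumes p: "0 \<le> p" "p \<le> 1" and D: "1 \<le> D" "2 * real n * p \<le> D" and v: "v < n"
  shows "measure_pmf.prob (gnp n p) {E. b * D ^ r \<le> real (card (layer E {v} ({..<n} - {v}) r))} \<le> exp (1 - b)"
proof -
  define \<theta> where "\<theta> = 1 / D ^ r"
  have D0: "D ^ r > 0" "D \<noteq> 0" using D by auto
  define X where "X E = real (card (layer E {v} ({..<n} - {v}) r))" for E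
  have "measure_pmf.prob (gnp n p) {E. b * D ^ r \<le> X E} \<le> measure_pmf.expectation (gnp n p) (\<lambda>E. exp (\<theta> * X E) * exp (- b))"
    using D0 by (intro prob_le_expectation finite_set_gnp)
      (auto simp: \<theta>_def le_divide_eq simp flip: exp_add)
  also have "\<dots> = measure_pmf.expectation (gnp n p) (\<lambda>E. exp (\<theta> * X E)) * exp (- b)" by simp
  also have "\<dots> \<le> exp (\<theta> * D ^ r * real (card {v})) * exp (- b)"
    unfolding X_def using v D0 by (intro mult_right_mono gnp_layer_exp[OF p D]) (auto simp: \<theta>_def)
  also have "\<dots> = exp (1 - b)" using D0 by (simp add: \<theta>_def flip: exp_add)
  finally show ?thesis unfolding X_def .
qed

section \<open>Breadth-first search blocks\<close>

fun path_edges :: "'a list \<Rightarrow> 'a set set" where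
  "path_edges (x # y # xs) = insert {x, y} (path_edges (y # xs))"
| "path_edges _ = {}"

lemma path_edges_subset: "e \<in> path_edges xs \<Longrightarrow> e \<subseteq> set xs"
  by (induction xs rule: path_edges.induct) auto

lemma finite_path_edges: "finite (path_edges xs)"
  by (induction xs rule: path_edges.induct) auto

lemma card_path_edges: "distinct xs \<Longrightarrow> card (path_edges xs) = length xs - 1"
proof (induction xs rule: path_edges.induct)
  case (1 x y xs)
  have "{x, y} \<notin> path_edges (y # xs)" using 1(2) path_edges_subset[of "{x, y}" "y # xs"] by auto
  thus ?case using 1 by (simp add: finite_path_edges)
qed auto

lemma path_edges_map: "path_edges (map f [i..<j]) = (\<lambda>k. {f k, f (Suc k)}) ` {k. i \<le> k \<and> Suc k < j}"
proof (induction "j - i" arbitrary: i)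
  case 0
  hence "j \<le> i" by simp
  thus ?case by auto
next
  case (Suc n)
  hence ij: "i < j" by simp
  show ?case
  proof (cases "Suc i < j")
    case False
    hence "[i..<j] = [i]" using ij by (simp add: upt_conv_Cons)
    thus ?thesis using False ij by auto
  next
    case True
    have e: "map f [i..<j] = f i # f (Suc i) # map f [Suc (Suc i)..<j]" "map f [Suc i..<j] = f (Suc i) # map f [Suc (Suc i)..<j]"
      using True by (simp_all add: upt_conv_Cons)
    have "path_edges (map f [i..<j]) = insert {f i, f (Suc i)} (path_edges (map f [Suc i..<j]))"
      unfolding e by simp
    also have "path_edges (map f [Suc i..<j]) = (\<lambda>k. {f k, f (Suc k)}) ` {k. Suc i \<le> k \<and> Suc k < j}"
      using Suc by (intro Suc.hyps) auto
    also have "insert {f i, f (Suc i)} \<dots> = (\<lambda>k. {f k, f (Suc k)}) ` insert i {k. Suc i \<le> k \<and> Suc k < j}" by simp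
    also have "insert i {k. Suc i \<le> k \<and> Suc k < j} = {k. i \<le> k \<and> Suc k < j}" using True by auto
    finally show ?thesis .
  qed
qed

text \<open>Equivalently for the use made of it: a connected subgraph on at most \<open>s\<close>
  vertices has at most one cycle.\<close>

definition locally_sparse :: "nat \<Rightarrow> 'a set \<Rightarrow> 'a set set \<Rightarrow> bool" where
  "locally_sparse s V E \<longleftrightarrow> (\<forall>W\<subseteq>V. card W \<le> s \<longrightarrow> card {e \<in> E. e \<subseteq> W} \<le> card W)"

text \<open>The path's own edges are excluded from the count, so that in the random graph their
  presence is independent of the number of the others. Together both bound the sum of the degrees
  along the path.\<close>

definition thin_paths :: "nat \<Rightarrow> nat \<Rightarrow> 'a set \<Rightarrow> 'a set set \<Rightarrow> bool" where
  "thin_paths r m V E \<longleftrightarrow> (\<forall>xs. distinct xs \<and> xs \<noteq> [] \<and> length xs \<le> r \<and> set xs \<subseteq> V \<and> path_edges xs \<subseteq> E \<longrightarrow>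
     card {e \<in> E. e \<inter> set xs \<noteq> {} \<and> e \<notin> path_edges xs} \<le> m)"

fun rest :: "'a set set \<Rightarrow> 'a set \<Rightarrow> 'a set \<Rightarrow> nat \<Rightarrow> 'a set" where
  "rest E A U 0 = U"
| "rest E A U (Suc r) = rest E (nbrs E A U) (U - nbrs E A U) r"

text \<open>\<open>layer\<close> and \<open>rest\<close> peel off the first layer, as independence
  requires. Breadth-first arguments extend the search at its last layer; these equations give that
  description.\<close>

lemma layer_Suc: "layer E A U (Suc r) = nbrs E (layer E A U r) (rest E A U r)"
  and rest_Suc: "rest E A U (Suc r) = rest E A U r - nbrs E (layer E A U r) (rest E A U r)"
  by (induction r arbitrary: A U) simp_all

section \<open>The tree of the search and the blocks cut from it\<close>

locale bfs =
  fixes V :: "'a set" and E :: "'a set set" and v :: 'a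
  assumes finite_V: "finite V" and E_sub: "E \<subseteq> potential_edges V" and v_in: "v \<in> V"
begin

definition S :: "nat \<Rightarrow> 'a set" where "S i = layer E {v} (V - {v}) i"
definition U :: "nat \<Rightarrow> 'a set" where "U i = rest E {v} (V - {v}) i"

lemma S_0: "S 0 = {v}" and U_0: "U 0 = V - {v}" and S_Suc: "S (Suc i) = nbrs E (S i) (U i)"
  and U_Suc: "U (Suc i) = U i - S (Suc i)"
  by (simp_all add: S_def U_def layer_Suc rest_Suc del: layer.simps(2) rest.simps(2))

lemma U_antimono: "i \<le> j \<Longrightarrow> U j \<subseteq> U i"
  by (rule lift_Suc_antimono_le[of U]) (auto simp: U_Suc)

lemma S_sub_U: "i < j \<Longrightarrow> S j \<subseteq> U i"
proof -
  assume "i < j"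
  then obtain k where k: "j = Suc k" "i \<le> k" by (cases j) auto
  have "S j \<subseteq> U k" by (auto simp: k S_Suc nbrs_def)
  thus ?thesis using U_antimono[OF k(2)] by blast
qed

lemma S_U_disj: "S i \<inter> U i = {}"
  by (cases i) (auto simp: S_0 U_0 U_Suc)

lemma S_disj: "i \<noteq> j \<Longrightarrow> S i \<inter> S j = {}"
  using S_sub_U[of i j] S_sub_U[of j i] S_U_disj[of i] S_U_disj[of j] by (cases i j rule: linorder_cases) auto

lemma U_sub_V: "U i \<subseteq> V" using U_antimono[of 0 i] by (auto simp: U_0)

lemma S_sub_V: "S i \<subseteq> V"
  using v_in U_sub_V[of "i - 1"] by (cases i) (auto simp: S_0 S_Suc nbrs_def)

lemma V_cover: "x \<in> V \<Longrightarrow> x \<in> U i \<or> (\<exists>j\<le>i. x \<in> S j)"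
proof (induction i)
  case (Suc i)
  thus ?case by (auto simp: U_Suc le_Suc_eq)
qed (auto simp: U_0 S_0)

definition lev :: "'a \<Rightarrow> nat" where "lev x = (LEAST i. x \<in> S i)"
definition par :: "'a \<Rightarrow> 'a" where "par x = (SOME y. y \<in> S (lev x - 1) \<and> {y, x} \<in> E)"

lemma lev_eq:
  assumes "x \<in> S i" shows "lev x = i"
  unfolding lev_def
proof (rule Least_equality)
  show "x \<in> S i" by (rule assms)
  fix j assume "x \<in> S j"
  hence "i = j" using S_disj[of i j] assms by (metis disjoint_iff)
  thus "i \<le> j" by simp
qed

lemma par_props:
  assumes "x \<in> S (Suc i)" shows "par x \<in> S i" "{par x, x} \<in> E"
proof -
  have l: "lev x = Suc i" by (rule lev_eq[OF assms])
  have "\<exists>y. y \<in> S (lev x - 1) \<and> {y, x} \<in> E" using assms by (auto simp: S_Suc nbrs_def l)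
  from someI_ex[OF this] show "par x \<in> S i" "{par x, x} \<in> E" unfolding par_def[symmetric] by (simp_all add: l)
qed

lemma adj_level:
  assumes "x \<in> S i" "u \<in> V" "{u, x} \<in> E" obtains j where "j \<le> Suc i" "u \<in> S j"
proof (cases "u \<in> U i")
  case True
  hence "u \<in> S (Suc i)" using assms by (auto simp: S_Suc nbrs_def insert_commute)
  thus ?thesis using that by blast
next
  case False
  thus ?thesis using V_cover[OF assms(2), of i] that by (meson le_SucI)
qed

definition ball :: "nat \<Rightarrow> 'a set" where "ball r = (\<Union>i\<le>r. S i)"

lemma ball_lev: "x \<in> ball r \<Longrightarrow> x \<in> S (lev x) \<and> lev x \<le> r"
  by (auto simp: ball_def lev_eq)

lemma S_par_funpow: "x \<in> S i \<Longrightarrow> j \<le> i \<Longrightarrow> (par ^^ j) x \<in> S (i - j)"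
proof (induction j)
  case (Suc j)
  have "(par ^^ j) x \<in> S (Suc (i - Suc j))" using Suc by (simp add: Suc_diff_Suc)
  thus ?case using par_props(1) by simp
qed simp

definition chain :: "'a \<Rightarrow> 'a set" where "chain x = (\<lambda>j. (par ^^ j) x) ` {..lev x}"

lemma chain_props:
  assumes "x \<in> ball r"
  shows "chain x \<subseteq> ball r" "card (chain x) \<le> Suc r" "finite (chain x)" "x \<in> chain x" "v \<in> chain x"
    "\<And>y. y \<in> chain x \<Longrightarrow> lev y \<ge> 1 \<Longrightarrow> par y \<in> chain x"
proof -
  have x: "x \<in> S (lev x)" "lev x \<le> r" using ball_lev[OF assms] by auto
  have p: "(par ^^ j) x \<in> S (lev x - j)" if "j \<le> lev x" for j using S_par_funpow[OF x(1) that] .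
  show "chain x \<subseteq> ball r"
  proof
    fix y assume "y \<in> chain x"
    then obtain j where "j \<le> lev x" "y = (par ^^ j) x" by (auto simp: chain_def)
    thus "y \<in> ball r" using p[of j] x(2) unfolding ball_def by (intro UN_I[of "lev x - j"]) auto
  qed
  have "card (chain x) \<le> card {..lev x}" unfolding chain_def by (rule card_image_le) simp
  thus "card (chain x) \<le> Suc r" using x(2) by simp
  show "finite (chain x)" by (simp add: chain_def)
  show "x \<in> chain x" unfolding chain_def by (rule image_eqI[of _ _ 0]) auto
  have "(par ^^ lev x) x = v" using p[of "lev x"] by (simp add: S_0)
  thus "v \<in> chain x" unfolding chain_def by (metis atMost_iff image_eqI order_refl)
  fix y assume "y \<in> chain x" "lev y \<ge> 1"
  then obtain j where j: "j \<le> lev x" "y = (par ^^ j) x" by (auto simp: chain_def)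
  have "lev y = lev x - j" using p[OF j(1)] j(2) by (simp add: lev_eq)
  hence "Suc j \<le> lev x" using \<open>lev y \<ge> 1\<close> by simp
  thus "par y \<in> chain x" unfolding chain_def j(2) by (intro image_eqI[of _ _ "Suc j"]) auto
qed

definition tree_edges :: "nat \<Rightarrow> 'a set set" where
  "tree_edges r = {{par x, x} |x. x \<in> ball r \<and> lev x \<ge> 1}"

lemma par_lev:
  assumes "x \<in> ball r" "lev x \<ge> 1"
  shows "lev x = Suc (lev (par x))" "{par x, x} \<in> E" "par x \<in> ball r"
proof -
  obtain i where i: "lev x = Suc i" using assms by (cases "lev x") auto
  hence x: "x \<in> S (Suc i)" "Suc i \<le> r" using ball_lev[OF assms(1)] by auto
  show "lev x = Suc (lev (par x))" using par_props(1)[OF x(1)] by (simp add: i lev_eq)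
  show "{par x, x} \<in> E" by (rule par_props(2)[OF x(1)])
  show "par x \<in> ball r" using par_props(1)[OF x(1)] x(2) by (auto simp: ball_def intro!: bexI[of _ i])
qed

text \<open>The paths from the four endpoints to the root together have a set \<open>H\<close> of at
  most \<open>4 * Suc r\<close> vertices, and they contribute \<open>card H - 1\<close> tree edges
  inside \<open>H\<close>. Two further edges would make \<open>card H + 1\<close>. Sparsity is thus
  needed only for sets of order \<open>r\<close>, far smaller than the ball may be.\<close>

lemma one_extra_edge:
  assumes sparse: "locally_sparse (4 * Suc r) V E"
    and e1: "e1 \<in> E" "e1 \<subseteq> ball r" "e1 \<notin> tree_edges r"
    and e2: "e2 \<in> E" "e2 \<subseteq> ball r" "e2 \<notin> tree_edges r"
  shows "e1 = e2"
proof (rule ccontr)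
  assume ne: "e1 \<noteq> e2"
  have two: "\<exists>a b. e = {a, b}" if "e \<in> E" for e
  proof -
    have "card e = 2" using that E_sub by (auto simp: potential_edges_def)
    thus ?thesis by (meson card_2_iff)
  qed
  obtain a b where ab: "e1 = {a, b}" using two[OF e1(1)] by blast
  obtain c d where cd: "e2 = {c, d}" using two[OF e2(1)] by blast
  have in_ball: "a \<in> ball r" "b \<in> ball r" "c \<in> ball r" "d \<in> ball r" using e1(2) e2(2) ab cd by auto
  define H where "H = chain a \<union> chain b \<union> chain c \<union> chain d"
  have H: "H \<subseteq> ball r" "finite H" "v \<in> H" "a \<in> H" "b \<in> H" "c \<in> H" "d \<in> H"
    using chain_props[OF in_ball(1)] chain_props[OF in_ball(2)] chain_props[OF in_ball(3)] chain_props[OF in_ball(4)]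
    by (auto simp: H_def)
  have closed: "par y \<in> H" if "y \<in> H" "lev y \<ge> 1" for y
    using that chain_props(6)[OF in_ball(1)] chain_props(6)[OF in_ball(2)] chain_props(6)[OF in_ball(3)] chain_props(6)[OF in_ball(4)]
    by (auto simp: H_def)
  have cH: "card H \<le> 4 * Suc r"
    using chain_props(2)[OF in_ball(1)] chain_props(2)[OF in_ball(2)] chain_props(2)[OF in_ball(3)] chain_props(2)[OF in_ball(4)]
      card_Un_le[of "chain a" "chain b"] card_Un_le[of "chain a \<union> chain b" "chain c"] card_Un_le[of "chain a \<union> chain b \<union> chain c" "chain d"]
    by (simp add: H_def)
  have ball_V: "ball r \<subseteq> V" using S_sub_V by (auto simp: ball_def)
  have lev1: "lev y \<ge> 1" if "y \<in> H - {v}" for y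
  proof (rule ccontr)
    assume "\<not> lev y \<ge> 1"
    hence "lev y = 0" by simp
    hence "y \<in> S 0" using ball_lev[of y r] that H(1) by auto
    thus False using that by (simp add: S_0)
  qed
  define T where "T = (\<lambda>y. {par y, y}) ` (H - {v})"
  have inj: "inj_on (\<lambda>y. {par y, y}) (H - {v})"
  proof (rule inj_onI, rule ccontr)
    fix x y assume x: "x \<in> H - {v}" and y: "y \<in> H - {v}" and e: "{par x, x} = {par y, y}" and n: "x \<noteq> y"
    have "par x = y" "par y = x" using e n by (auto simp: doubleton_eq_iff)
    moreover have "lev x = Suc (lev (par x))" "lev y = Suc (lev (par y))"
      using par_lev(1) lev1[OF x] lev1[OF y] x y H(1) by blast+
    ultimately show False by simp
  qed
  have cT: "card T = card H - 1" unfolding T_def card_image[OF inj] using H by simp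
  have Tt: "T \<subseteq> tree_edges r" using lev1 H(1) by (auto simp: T_def tree_edges_def)
  have TE: "T \<subseteq> E" using lev1 H(1) par_lev(2) by (auto simp: T_def)
  have fT: "finite T" using H by (simp add: T_def)
  have "insert e1 (insert e2 T) \<subseteq> {e \<in> E. e \<subseteq> H}"
    using TE e1 e2 ab cd H closed lev1 by (auto simp: T_def)
  moreover have "finite {e \<in> E. e \<subseteq> H}"
    by (rule finite_subset[of _ "Pow H"]) (use H in auto)
  ultimately have "card (insert e1 (insert e2 T)) \<le> card {e \<in> E. e \<subseteq> H}" by (rule card_mono[rotated])
  moreover have "card (insert e1 (insert e2 T)) = Suc (Suc (card T))"
    using fT ne e1(3) e2(3) Tt by (subst card_insert_disjoint, simp, blast)+ simp
  moreover have "card {e \<in> E. e \<subseteq> H} \<le> card H" using sparse H ball_V cH unfolding locally_sparse_def by blast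
  moreover have "card H \<ge> 1" using H by (metis One_nat_def Suc_leI card_gt_0_iff empty_iff)
  ultimately show False using cT by simp
qed

lemma sum_degree_le:
  assumes "finite W"
  shows "(\<Sum>y\<in>W. card {e \<in> E. y \<in> e}) \<le> 2 * card {e \<in> E. e \<inter> W \<noteq> {}}"
proof -
  have fE: "finite E" using E_sub finite_potential_edges[OF finite_V] by (rule finite_subset)
  have count: "card {x \<in> A. P x} = (\<Sum>x\<in>A. if P x then 1 else 0)" if "finite A" for A :: "'a set set" and P
    using sum.inter_filter[OF that, of "\<lambda>_. 1::nat" P] by simp
  have count': "card {x \<in> A. P x} = (\<Sum>x\<in>A. if P x then 1 else 0)" if "finite A" for A :: "'a set" and P
    using sum.inter_filter[OF that, of "\<lambda>_. 1::nat" P] by simp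
  have "(\<Sum>y\<in>W. card {e \<in> E. y \<in> e}) = (\<Sum>y\<in>W. \<Sum>e\<in>E. if y \<in> e then 1 else 0)"
    by (intro sum.cong refl count fE)
  also have "\<dots> = (\<Sum>e\<in>E. \<Sum>y\<in>W. if y \<in> e then 1 else 0)" by (rule sum.swap)
  also have "\<dots> = (\<Sum>e\<in>E. card (e \<inter> W))"
  proof (intro sum.cong refl)
    fix e
    have "e \<inter> W = {y \<in> W. y \<in> e}" by blast
    thus "(\<Sum>y\<in>W. if y \<in> e then 1 else 0) = card (e \<inter> W)" using count'[OF assms, of "\<lambda>y. y \<in> e"] by simp
  qed
  also have "\<dots> \<le> (\<Sum>e\<in>E. if e \<inter> W \<noteq> {} then 2 else 0)"
  proof (rule sum_mono)
    fix e assume "e \<in> E"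
    hence c: "card e = 2" using E_sub by (auto simp: potential_edges_def)
    hence "finite e" by (metis card.infinite zero_neq_numeral)
    thus "card (e \<inter> W) \<le> (if e \<inter> W \<noteq> {} then 2 else 0)" using card_mono[of e "e \<inter> W"] c by auto
  qed
  also have "\<dots> = 2 * (\<Sum>e\<in>E. if e \<inter> W \<noteq> {} then 1 else 0)"
    unfolding sum_distrib_left by (intro sum.cong) auto
  also have "\<dots> = 2 * card {e \<in> E. e \<inter> W \<noteq> {}}" unfolding count[OF fE] ..
  finally show ?thesis .
qed

text \<open>The path from \<open>x\<close> to the root has \<open>lev x\<close> edges and meets at
  most \<open>m\<close> others, so its degrees sum to at most \<open>2 * (m + lev x)\<close>. Adding
  one for each of its \<open>Suc (lev x)\<close> vertices gives the bound, as
  \<open>lev x < r\<close>.\<close>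

lemma chain_kids_le:
  assumes thin: "thin_paths r m V E"
    and x: "x \<in> ball r" "lev x < r" and B: "B \<subseteq> ball r"
  shows "chain_kids par lev B x \<le> 3 * r + 2 * m"
proof -
  define xs where "xs = map (\<lambda>j. (par ^^ j) x) [0..<Suc (lev x)]"
  have xS: "x \<in> S (lev x)" using ball_lev[OF x(1)] by simp
  have pS: "(par ^^ j) x \<in> S (lev x - j)" if "j \<le> lev x" for j using S_par_funpow[OF xS that] .
  have inj: "inj_on (\<lambda>j. (par ^^ j) x) {..lev x}"
  proof (rule inj_onI)
    fix i j assume ij: "i \<in> {..lev x}" "j \<in> {..lev x}" "(par ^^ i) x = (par ^^ j) x"
    hence "lev x - i = lev x - j" using lev_eq[OF pS[of i]] lev_eq[OF pS[of j]] by simp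
    thus "i = j" using ij by simp
  qed
  have sxs: "set xs = chain x" by (simp add: xs_def chain_def lessThan_Suc_atMost[symmetric] atLeast0LessThan del: upt_Suc)
  have dist: "distinct xs" unfolding xs_def distinct_map
    using inj by (auto simp: lessThan_Suc_atMost[symmetric] atLeast0LessThan simp del: upt_Suc)
  have len: "length xs = Suc (lev x)" by (simp add: xs_def)
  have ball_V: "ball r \<subseteq> V" using S_sub_V by (auto simp: ball_def)
  have pe: "path_edges xs \<subseteq> E"
  proof
    fix e assume "e \<in> path_edges xs"
    then obtain k where k: "Suc k < Suc (lev x)" "e = {(par ^^ k) x, (par ^^ Suc k) x}"
      unfolding xs_def path_edges_map by auto
    have "(par ^^ k) x \<in> S (Suc (lev x - Suc k))" using pS[of k] k(1) by (simp add: Suc_diff_Suc)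
    from par_props(2)[OF this] show "e \<in> E" unfolding k(2) by (simp add: insert_commute)
  qed
  have fE: "finite E" using E_sub finite_potential_edges[OF finite_V] by (rule finite_subset)
  have t: "card {e \<in> E. e \<inter> set xs \<noteq> {} \<and> e \<notin> path_edges xs} \<le> m"
  proof (rule thin[unfolded thin_paths_def, rule_format], intro conjI)
    show "set xs \<subseteq> V" using chain_props(1)[OF x(1)] ball_V sxs by blast
  qed (use dist len x(2) pe in auto)
  have "{e \<in> E. e \<inter> set xs \<noteq> {}} \<subseteq> {e \<in> E. e \<inter> set xs \<noteq> {} \<and> e \<notin> path_edges xs} \<union> path_edges xs" by auto
  hence "card {e \<in> E. e \<inter> set xs \<noteq> {}} \<le> card ({e \<in> E. e \<inter> set xs \<noteq> {} \<and> e \<notin> path_edges xs} \<union> path_edges xs)"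
    using fE by (intro card_mono) (auto simp: finite_path_edges)
  also have "\<dots> \<le> m + lev x"
    using card_Un_le[of "{e \<in> E. e \<inter> set xs \<noteq> {} \<and> e \<notin> path_edges xs}" "path_edges xs"] t card_path_edges[OF dist] len by simp
  finally have touch: "card {e \<in> E. e \<inter> set xs \<noteq> {}} \<le> m + lev x" .
  have kd: "kids par lev B y \<le> card {e \<in> E. y \<in> e}" for y
    unfolding kids_def
  proof (rule card_inj_on_le[where f = "\<lambda>z. {y, z}"])
    show "inj_on (\<lambda>z. {y, z}) {z \<in> B. 1 \<le> lev z \<and> par z = y}"
      by (rule inj_onI) (auto simp: doubleton_eq_iff)
    show "(\<lambda>z. {y, z}) ` {z \<in> B. 1 \<le> lev z \<and> par z = y} \<subseteq> {e \<in> E. y \<in> e}"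
      using par_lev(2) B by blast
  qed (use fE in simp)
  have "chain_kids par lev B x = Suc (lev x) + (\<Sum>j\<le>lev x. kids par lev B ((par ^^ j) x))"
    unfolding chain_kids_def sum.distrib by simp
  also have "(\<Sum>j\<le>lev x. kids par lev B ((par ^^ j) x)) = (\<Sum>y\<in>chain x. kids par lev B y)"
    unfolding chain_def by (simp add: sum.reindex[OF inj])
  also have "\<dots> \<le> (\<Sum>y\<in>chain x. card {e \<in> E. y \<in> e})" by (intro sum_mono kd)
  also have "\<dots> \<le> 2 * (m + lev x)"
    using sum_degree_le[OF chain_props(3)[OF x(1)]] touch by (simp add: sxs)
  finally show ?thesis using x(2) by simp
qed

text \<open>A vertex \<open>u\<close> of the sphere acts on the block through its parent, at a cost
  of at most \<open>t ^ r\<close>. The removed vertex acts through its parent and through the other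
  end of the extra edge, at a cost of at most \<open>t\<close> each. Its children inside the block
  count 0, because their parent is missing.\<close>

lemma good_block_exists:
  assumes sparse: "locally_sparse (4 * Suc r) V E"
    and thin: "thin_paths r m V E"
    and r: "1 \<le> r" and t: "0 \<le> t" "t \<le> 1"
    and growth: "2 * t + real (card (S r)) * t ^ r \<le> 1 / 2"
  shows "\<exists>B. good_block V E t (3 * r + 2 * m) v B par lev"
proof -
  have ball_V: "ball r \<subseteq> V" using S_sub_V by (auto simp: ball_def)
  have noloop: "{x, x} \<notin> E" for x using E_sub by (auto simp: potential_edges_def)
  obtain X a where X: "X \<subseteq> ball r - {v}" "card X \<le> 1" "finite X"
    and extra: "\<And>e. e \<in> E \<Longrightarrow> e \<subseteq> ball r \<Longrightarrow> e \<notin> tree_edges r \<Longrightarrow> \<exists>b\<in>X. e = {a, b}"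
  proof (cases "\<exists>e\<in>E. e \<subseteq> ball r \<and> e \<notin> tree_edges r")
    case False
    thus ?thesis using that[of "{}"] by auto
  next
    case True
    then obtain e where e: "e \<in> E" "e \<subseteq> ball r" "e \<notin> tree_edges r" by blast
    have "card e = 2" using e(1) E_sub by (auto simp: potential_edges_def)
    then obtain c d where cd: "e = {c, d}" "c \<noteq> d" by (meson card_2_iff)
    \<comment> \<open>The endpoint to be removed must not be the root.\<close>
    have "\<exists>a b. e = {a, b} \<and> a \<noteq> b \<and> b \<noteq> v"
    proof (cases "d = v")
      case True
      thus ?thesis using cd by (intro exI[of _ d] exI[of _ c]) auto
    qed (use cd in auto)
    then obtain a b where ab: "e = {a, b}" "b \<noteq> v" by blast
    show ?thesis
    proof (rule that[of "{b}" a])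
      show "{b} \<subseteq> ball r - {v}" using ab e by auto
      show "\<exists>b'\<in>{b}. e' = {a, b'}" if "e' \<in> E" "e' \<subseteq> ball r" "e' \<notin> tree_edges r" for e'
        using one_extra_edge[OF sparse that e] ab by auto
    qed auto
  qed
  \<comment> \<open>The sphere at distance \<open>r\<close> is left out of the block: it forms the
    boundary, together with the vertex in \<open>X\<close>.\<close>
  define B where "B = {x \<in> ball r. lev x < r} - X"
  have Bb: "B \<subseteq> ball r" by (auto simp: B_def)
  have Bl: "lev x < r" "x \<in> S (lev x)" if "x \<in> B" for x using that ball_lev[of x r] by (auto simp: B_def)
  have vS: "v \<in> S 0" by (simp add: S_0)
  have levv: "lev v = 0" by (rule lev_eq[OF vS])
  have vb: "v \<in> ball r" using vS by (auto simp: ball_def)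
  have fB: "finite B" using Bb ball_V finite_V by (meson finite_subset)
  have tree: "(lev x \<ge> 1 \<and> y = par x) \<or> (lev y \<ge> 1 \<and> x = par y)" if "{x, y} \<in> tree_edges r" for x y
    using that by (auto simp: tree_edges_def doubleton_eq_iff)
  define bnd where "bnd x = (if lev x \<ge> 1 \<and> par x \<notin> B then 0 else t ^ Suc (lev x))" for x
  have bnd: "0 \<le> bnd x" "bnd x \<le> t ^ Suc (lev x)" for x using t by (auto simp: bnd_def)
  have pw: "t ^ Suc k \<le> t" for k using t power_le_one[of t k] by (simp add: mult_left_le)
  have inner: "(\<Sum>x | x \<in> B \<and> {u, x} \<in> E. bnd x) \<le> (if u \<in> S r then t ^ r else 0) + (if u \<in> X then 2 * t else 0)"
    if u: "u \<in> V - B" for u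
  proof -
    have "(\<Sum>x | x \<in> B \<and> {u, x} \<in> E. bnd x) \<le> (\<Sum>x | x \<in> B \<and> {u, x} \<in> E.
       (if x = par u then (if u \<in> S r then t ^ r else 0) + (if u \<in> X then t else 0) else 0) + (if x = a then (if u \<in> X then t else 0) else 0))"
    proof (rule sum_mono)
      fix x assume "x \<in> {x. x \<in> B \<and> {u, x} \<in> E}"
      hence x: "x \<in> B" "{u, x} \<in> E" by auto
      obtain j where j: "j \<le> Suc (lev x)" "u \<in> S j"
        using adj_level[OF Bl(2)[OF x(1)] _ x(2)] u by blast
      hence ub: "u \<in> ball r" using Bl(1)[OF x(1)] by (auto simp: ball_def intro!: bexI[of _ j])
      have levu: "lev u = j" using lev_eq[OF j(2)] .
      have uSX: "u \<in> S r \<or> u \<in> X"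
      proof (rule ccontr)
        assume n: "\<not> (u \<in> S r \<or> u \<in> X)"
        hence "lev u \<noteq> r" using j(2) levu by auto
        hence "lev u < r" using ball_lev[OF ub] by simp
        thus False using u ub n by (auto simp: B_def)
      qed
      show "bnd x \<le> (if x = par u then (if u \<in> S r then t ^ r else 0) + (if u \<in> X then t else 0) else 0) + (if x = a then (if u \<in> X then t else 0) else 0)"
      proof (cases "{u, x} \<in> tree_edges r")
        case False
        then obtain b where b: "b \<in> X" "{u, x} = {a, b}"
          using extra[OF x(2)] ub x(1) Bb by auto
        have "x \<noteq> b" using b(1) x(1) by (auto simp: B_def)
        hence "u = b" "x = a" using b(2) by (auto simp: doubleton_eq_iff)
        hence "t \<le> (if x = par u then (if u \<in> S r then t ^ r else 0) + (if u \<in> X then t else 0) else 0) + (if x = a then (if u \<in> X then t else 0) else 0)"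
          using b(1) t zero_le_power[OF t(1), of r] by auto
        thus ?thesis using order_trans[OF bnd(2) pw, of x] by (rule order_trans[rotated])
      next
        case True
        show ?thesis
        proof (cases "lev u \<ge> 1 \<and> x = par u")
          case True
          have l: "lev u = Suc (lev x)" using par_lev(1)[OF ub] True by simp
          show ?thesis
          proof (cases "u \<in> S r")
            case uS: True
            hence "bnd x \<le> t ^ r" using bnd(2)[of x] l lev_eq[OF uS] by simp
            thus ?thesis using True uS t by auto
          next
            case False
            hence "u \<in> X" using uSX by simp
            hence "t \<le> (if x = par u then (if u \<in> S r then t ^ r else 0) + (if u \<in> X then t else 0) else 0) + (if x = a then (if u \<in> X then t else 0) else 0)"
              using True False t by auto
            thus ?thesis using order_trans[OF bnd(2) pw, of x] by (rule order_trans[rotated])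
          qed
        next
          case False
          \<comment> \<open>Here \<open>u\<close> lies outside \<open>B\<close> and is the parent of
            \<open>x\<close>, so \<open>x\<close> is a root of a component of the block that does
            not contain \<open>v\<close>.\<close>
          hence "lev x \<ge> 1 \<and> u = par x" using tree[OF True] by auto
          hence "bnd x = 0" using u by (auto simp: bnd_def)
          thus ?thesis using t by auto
        qed
      qed
    qed
    also have "\<dots> \<le> ((if u \<in> S r then t ^ r else 0) + (if u \<in> X then t else 0)) + (if u \<in> X then t else 0)"
      unfolding sum.distrib using fB t by (intro add_mono) (simp_all add: sum.delta)
    finally show ?thesis by (auto split: if_splits)
  qed
  have "(\<Sum>u\<in>V-B. \<Sum>x | x \<in> B \<and> {u, x} \<in> E. bnd x) \<le> (\<Sum>u\<in>V-B. (if u \<in> S r then t ^ r else 0) + (if u \<in> X then 2 * t else 0))"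
    by (intro sum_mono inner)
  also have "\<dots> \<le> (\<Sum>u\<in>V. (if u \<in> S r then t ^ r else 0) + (if u \<in> X then 2 * t else 0))"
    using finite_V t by (intro sum_mono2) auto
  also have "\<dots> = real (card (S r)) * t ^ r + real (card X) * (2 * t)"
  proof -
    have "(\<Sum>u\<in>V. if u \<in> W then c else 0) = real (card W) * c" if "W \<subseteq> V" for W and c :: real
      by (subst sum.inter_restrict[OF finite_V, symmetric]) (simp add: Int_absorb1[OF that])
    moreover have "X \<subseteq> V" using X(1) ball_V by blast
    ultimately show ?thesis using S_sub_V[of r] by (simp add: sum.distrib)
  qed
  also have "\<dots> \<le> real (card (S r)) * t ^ r + 1 * (2 * t)"
    using X(2) t by (intro add_left_mono mult_right_mono) auto
  also have "\<dots> \<le> 1 / 2" using growth by simp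
  finally have total: "(\<Sum>u\<in>V-B. \<Sum>x | x \<in> B \<and> {u, x} \<in> E. bnd x) \<le> 1 / 2" .
  have "good_block V E t (3 * r + 2 * m) v B par lev"
    unfolding good_block_def
  proof (intro conjI ballI impI)
    show "B \<subseteq> V" using Bb ball_V by blast
    show "v \<in> B" using vb levv r X(1) by (auto simp: B_def)
    show "lev v = 0" by (rule levv)
    show "x = v" if "x \<in> B" "lev x = 0" for x using Bl(2)[OF that(1)] that(2) by (simp add: S_0)
    show "lev x = Suc (lev (par x))" if "x \<in> B" "1 \<le> lev x" for x using par_lev(1)[of x r] that Bb by blast
    show "(1 \<le> lev x \<and> y = par x) \<or> (1 \<le> lev y \<and> x = par y)" if xy: "x \<in> B" "y \<in> B" "{x, y} \<in> E" for x y
    proof (rule tree, rule ccontr)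
      assume "{x, y} \<notin> tree_edges r"
      then obtain b where "b \<in> X" "{x, y} = {a, b}" using extra[OF xy(3)] xy Bb by auto
      thus False using xy by (auto simp: B_def doubleton_eq_iff)
    qed
    show "chain_kids par lev B x \<le> 3 * r + 2 * m" if "x \<in> B" for x
      using that Bb Bl(1) by (intro chain_kids_le thin) auto
    show "(\<Sum>u\<in>V - B. \<Sum>x | x \<in> B \<and> {u, x} \<in> E. if 1 \<le> lev x \<and> par x \<notin> B then 0 else t ^ Suc (lev x)) \<le> 1 / 2"
      using total unfolding bnd_def .
  qed
  thus ?thesis by blast
qed

end

section \<open>Rare events in the random graph\<close>

lemma card_potential_edges_le:
  assumes "finite W" shows "card (potential_edges W) \<le> card W ^ 2"
proof -
  have "potential_edges W \<subseteq> (\<lambda>(x, y). {x, y}) ` (W \<times> W)"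
  proof
    fix e assume e: "e \<in> potential_edges W"
    hence "card e = 2" by (simp add: potential_edges_def)
    then obtain x y where "e = {x, y}" by (meson card_2_iff)
    thus "e \<in> (\<lambda>(x, y). {x, y}) ` (W \<times> W)" using e by (auto simp: potential_edges_def)
  qed
  hence "card (potential_edges W) \<le> card (W \<times> W)" using assms by (intro surj_card_le) auto
  thus ?thesis by (simp add: card_cartesian_product power2_eq_square)
qed

lemma gnp_prob_subset:
  assumes "0 \<le> p" "p \<le> 1" "F \<subseteq> potential_edges {..<n}"
  shows "measure_pmf.prob (gnp n p) {E. F \<subseteq> E} \<le> p ^ card F"
  using gnp_prob_subset_many[OF assms, of "{}" 0] by simp

text \<open>A union bound over vertex sets of size \<open>k\<close> and sets of \<open>k + 1\<close>
  edges inside them: \<open>n ^ k\<close> choices against probability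
  \<open>(d / n) ^ (k + 1)\<close> leave a factor \<open>1 / n\<close>. The number of edge sets is
  bounded crudely by \<open>2 ^ s\<^sup>2\<close>, which is affordable for \<open>s\<close> of order
  \<open>ln (ln n)\<close>.\<close>

lemma gnp_sparse:
  fixes d :: real
  assumes d: "1 \<le> d" "d \<le> real n"
  shows "measure_pmf.prob (gnp n (d / real n))
    {E. E \<subseteq> potential_edges {..<n} \<and> \<not> locally_sparse s {..<n} E}
    \<le> real (Suc s) * 2 ^ s\<^sup>2 * d ^ Suc s / real n"
proof -
  define p where "p = d / real n"
  have n: "real n > 0" using d by linarith
  have p: "0 \<le> p" "p \<le> 1" using d n by (simp_all add: p_def)
  define Ws where "Ws k = {W. W \<subseteq> {..<n} \<and> card W = k}" for k
  define Fs where "Fs W = {F. F \<subseteq> potential_edges W \<and> card F = Suc (card W)}" for W :: "nat set"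
  have fWs: "finite (Ws k)" for k unfolding Ws_def by simp
  have finW: "finite W" if "W \<subseteq> {..<n}" for W using that by (rule finite_subset) simp
  have fFs: "finite (Fs W)" if "W \<subseteq> {..<n}" for W
    unfolding Fs_def using finite_potential_edges[OF finW[OF that]] by simp
  have b1: "measure_pmf.prob (gnp n p) {E. \<exists>F\<in>Fs W. F \<subseteq> E} \<le> 2 ^ s\<^sup>2 * p ^ Suc k"
    if W: "W \<in> Ws k" "k \<le> s" for W k
  proof -
    have W': "W \<subseteq> {..<n}" "card W = k" using W by (auto simp: Ws_def)
    have sub: "potential_edges W \<subseteq> potential_edges {..<n}" using W' by (auto simp: potential_edges_def)
    have "measure_pmf.prob (gnp n p) {E. \<exists>F\<in>Fs W. F \<subseteq> E} \<le> (\<Sum>F\<in>Fs W. p ^ Suc k)"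
    proof (rule prob_Ex_le[OF fFs[OF W'(1)]])
      fix F assume F: "F \<in> Fs W"
      hence "F \<subseteq> potential_edges {..<n}" "card F = Suc k" using sub W' by (auto simp: Fs_def)
      thus "measure_pmf.prob (gnp n p) {E. F \<subseteq> E} \<le> p ^ Suc k" using gnp_prob_subset[OF p] by metis
    qed
    also have "\<dots> = real (card (Fs W)) * p ^ Suc k" by simp
    also have "\<dots> \<le> 2 ^ s\<^sup>2 * p ^ Suc k"
    proof (rule mult_right_mono)
      have "card (Fs W) \<le> card (Pow (potential_edges W))"
        using finite_potential_edges[OF finW[OF W'(1)]] by (intro card_mono) (auto simp: Fs_def)
      also have "\<dots> = 2 ^ card (potential_edges W)" using finite_potential_edges[OF finW[OF W'(1)]] by (rule card_Pow)
      also have "\<dots> \<le> 2 ^ s\<^sup>2"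
        using card_potential_edges_le[OF finW[OF W'(1)]] W'(2) W(2)
        by (intro power_increasing) (auto intro: order_trans power_mono)
      finally show "real (card (Fs W)) \<le> 2 ^ s\<^sup>2" by (metis of_nat_le_iff of_nat_numeral of_nat_power)
    qed (use p in simp)
    finally show ?thesis .
  qed
  have b2: "measure_pmf.prob (gnp n p) {E. \<exists>W\<in>Ws k. \<exists>F\<in>Fs W. F \<subseteq> E} \<le> 2 ^ s\<^sup>2 * d ^ Suc s / real n"
    if k: "k \<in> {..s}" for k
  proof -
    have "measure_pmf.prob (gnp n p) {E. \<exists>W\<in>Ws k. \<exists>F\<in>Fs W. F \<subseteq> E} \<le> (\<Sum>W\<in>Ws k. 2 ^ s\<^sup>2 * p ^ Suc k)"
      using k by (intro prob_Ex_le fWs b1) auto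
    also have "\<dots> = real (card (Ws k)) * (2 ^ s\<^sup>2 * p ^ Suc k)" by simp
    also have "card (Ws k) = n choose k" unfolding Ws_def by (subst n_subsets) auto
    also have "real (n choose k) * (2 ^ s\<^sup>2 * p ^ Suc k) \<le> real n ^ k * (2 ^ s\<^sup>2 * p ^ Suc k)"
    proof (rule mult_right_mono)
      have "n choose k \<le> n ^ k"
        by (cases "k \<le> n") (auto intro: binomial_le_pow simp: binomial_eq_0)
      thus "real (n choose k) \<le> real n ^ k" by (metis of_nat_le_iff of_nat_power)
    qed (use p in simp)
    also have "\<dots> = 2 ^ s\<^sup>2 * d ^ Suc k / real n"
      using n by (simp add: p_def power_divide)
    also have "\<dots> \<le> 2 ^ s\<^sup>2 * d ^ Suc s / real n"
      using d k n by (intro divide_right_mono mult_left_mono power_increasing) auto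
    finally show ?thesis .
  qed
  have "measure_pmf.prob (gnp n p)
    {E. E \<subseteq> potential_edges {..<n} \<and> \<not> locally_sparse s {..<n} E}
    \<le> measure_pmf.prob (gnp n p) {E. \<exists>k\<in>{..s}. \<exists>W\<in>Ws k. \<exists>F\<in>Fs W. F \<subseteq> E}"
  proof (rule measure_pmf.finite_measure_mono, rule subsetI)
    fix E assume "E \<in> {E. E \<subseteq> potential_edges {..<n} \<and> \<not> locally_sparse s {..<n} E}"
    then obtain W where W: "W \<subseteq> {..<n}" "card W \<le> s" "E \<subseteq> potential_edges {..<n}" "card W < card {e \<in> E. e \<subseteq> W}"
      by (auto simp: locally_sparse_def not_le)
    obtain F where F: "F \<subseteq> {e \<in> E. e \<subseteq> W}" "card F = Suc (card W)"
      using obtain_subset_with_card_n[of "Suc (card W)" "{e \<in> E. e \<subseteq> W}"] W(4) by (metis Suc_leI)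
    have "F \<in> Fs W" using F W(3) by (auto simp: Fs_def potential_edges_def)
    moreover have "W \<in> Ws (card W)" using W by (simp add: Ws_def)
    ultimately show "E \<in> {E. \<exists>k\<in>{..s}. \<exists>W\<in>Ws k. \<exists>F\<in>Fs W. F \<subseteq> E}" using F(1) W(2) by blast
  qed simp
  also have "\<dots> \<le> (\<Sum>k\<in>{..s}. 2 ^ s\<^sup>2 * d ^ Suc s / real n)" by (rule prob_Ex_le[OF _ b2]) auto
  also have "\<dots> = real (Suc s) * 2 ^ s\<^sup>2 * d ^ Suc s / real n" by simp
  finally show ?thesis unfolding p_def .
qed

lemma path_edges_potential: "distinct xs \<Longrightarrow> path_edges xs \<subseteq> potential_edges (set xs)"
  by (induction xs rule: path_edges.induct) (auto simp: potential_edges_def card_2_iff)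

text \<open>A union bound over paths with \<open>k\<close> edges: \<open>n ^ (k + 1)\<close> choices
  against probability \<open>(d / n) ^ k\<close> leave \<open>n * d ^ k\<close>. The further edges
  at the path are independent of it, and \<open>m + 1\<close> of them cost
  \<open>exp (2 * d * r - (m + 1))\<close>.\<close>

lemma gnp_thin:
  fixes d :: real
  assumes d: "1 \<le> d" "d \<le> real n"
  shows "measure_pmf.prob (gnp n (d / real n))
    {E. E \<subseteq> potential_edges {..<n} \<and> \<not> thin_paths r m {..<n} E}
    \<le> real r * real n * (d ^ r * exp (2 * d * real r)) * exp (- real (Suc m))"
proof -
  define p where "p = d / real n"
  have n: "real n > 0" using d by linarith
  have p: "0 \<le> p" "p \<le> 1" using d n by (simp_all add: p_def)
  define L where "L k = {xs. set xs \<subseteq> {..<n} \<and> length xs = Suc k \<and> distinct xs}" for k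
  define T where "T xs = {e \<in> potential_edges {..<n}. e \<inter> set xs \<noteq> {} \<and> e \<notin> path_edges xs}" for xs
  have LL: "L k \<subseteq> {xs. set xs \<subseteq> {..<n} \<and> length xs = Suc k}" for k by (auto simp: L_def)
  have fL: "finite (L k)" for k by (rule finite_subset[OF LL]) (simp add: finite_lists_length_eq)
  have cL: "real (card (L k)) \<le> real n ^ Suc k" for k
  proof -
    have "card (L k) \<le> n ^ Suc k"
      using card_mono[OF _ LL[of k]] card_lists_length_eq[of "{..<n}" "Suc k"] by (simp add: finite_lists_length_eq)
    thus ?thesis by (metis of_nat_le_iff of_nat_power)
  qed
  have b1: "measure_pmf.prob (gnp n p) {E. path_edges xs \<subseteq> E \<and> real (Suc m) \<le> real (card (E \<inter> T xs))}
    \<le> p ^ k * exp (2 * d * real r) * exp (- real (Suc m))" if xs: "xs \<in> L k" "k < r" for xs k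
  proof -
    have x: "set xs \<subseteq> {..<n}" "length xs = Suc k" "distinct xs" using xs by (auto simp: L_def)
    have pe: "path_edges xs \<subseteq> potential_edges {..<n}"
      using path_edges_potential[OF x(3)] x(1) by (auto simp: potential_edges_def)
    have "T xs \<subseteq> (\<lambda>(x, y). {x, y}) ` (set xs \<times> {..<n})"
    proof
      fix e assume e: "e \<in> T xs"
      then obtain a where a: "a \<in> e" "a \<in> set xs" by (auto simp: T_def)
      obtain y where "e = {a, y}" "y < n" using edge_cases[of e "{..<n}" a] e a by (auto simp: T_def)
      thus "e \<in> (\<lambda>(x, y). {x, y}) ` (set xs \<times> {..<n})" using a by auto
    qed
    hence "card (T xs) \<le> card (set xs \<times> {..<n})" by (intro surj_card_le) auto
    also have "\<dots> = Suc k * n" using distinct_card[OF x(3)] x(2) by (simp add: card_cartesian_product)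
    also have "\<dots> \<le> r * n" using xs(2) by (intro mult_right_mono) auto
    finally have "real (card (T xs)) \<le> real r * real n" by (metis of_nat_le_iff of_nat_mult)
    hence "2 * p * real (card (T xs)) \<le> 2 * p * (real r * real n)" using p by (intro mult_left_mono) auto
    also have "\<dots> = 2 * d * real r" using n by (simp add: p_def)
    finally have e: "exp (2 * p * real (card (T xs))) \<le> exp (2 * d * real r)" by simp
    have "measure_pmf.prob (gnp n p) {E. path_edges xs \<subseteq> E \<and> real (Suc m) \<le> real (card (E \<inter> T xs))}
      \<le> p ^ card (path_edges xs) * exp (2 * p * real (card (T xs))) * exp (- real (Suc m))"
      by (rule gnp_prob_subset_many[OF p pe]) (auto simp: T_def)
    also have "card (path_edges xs) = k" using card_path_edges[OF x(3)] x(2) by simp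
    also have "p ^ k * exp (2 * p * real (card (T xs))) * exp (- real (Suc m)) \<le> p ^ k * exp (2 * d * real r) * exp (- real (Suc m))"
      using e p by (intro mult_right_mono mult_left_mono) auto
    finally show ?thesis .
  qed
  have b2: "measure_pmf.prob (gnp n p) {E. \<exists>xs\<in>L k. path_edges xs \<subseteq> E \<and> real (Suc m) \<le> real (card (E \<inter> T xs))}
    \<le> real n * (d ^ r * exp (2 * d * real r)) * exp (- real (Suc m))" if k: "k \<in> {..<r}" for k
  proof -
    have "measure_pmf.prob (gnp n p) {E. \<exists>xs\<in>L k. path_edges xs \<subseteq> E \<and> real (Suc m) \<le> real (card (E \<inter> T xs))}
      \<le> (\<Sum>xs\<in>L k. p ^ k * exp (2 * d * real r) * exp (- real (Suc m)))"
      using k by (intro prob_Ex_le fL b1) auto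
    also have "\<dots> = real (card (L k)) * (p ^ k * exp (2 * d * real r) * exp (- real (Suc m)))" by simp
    also have "\<dots> \<le> real n ^ Suc k * (p ^ k * exp (2 * d * real r) * exp (- real (Suc m)))"
      using p by (intro mult_right_mono cL) simp
    also have "\<dots> = real n * (d ^ k * exp (2 * d * real r)) * exp (- real (Suc m))"
      using n by (simp add: p_def power_divide)
    also have "\<dots> \<le> real n * (d ^ r * exp (2 * d * real r)) * exp (- real (Suc m))"
      using d k by (intro mult_right_mono mult_left_mono power_increasing) auto
    finally show ?thesis .
  qed
  have "measure_pmf.prob (gnp n p)
    {E. E \<subseteq> potential_edges {..<n} \<and> \<not> thin_paths r m {..<n} E}
    \<le> measure_pmf.prob (gnp n p) {E. \<exists>k\<in>{..<r}. \<exists>xs\<in>L k. path_edges xs \<subseteq> E \<and> real (Suc m) \<le> real (card (E \<inter> T xs))}"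
  proof (rule measure_pmf.finite_measure_mono, rule subsetI)
    fix E assume "E \<in> {E. E \<subseteq> potential_edges {..<n} \<and> \<not> thin_paths r m {..<n} E}"
    then obtain xs where xs: "distinct xs" "xs \<noteq> []" "length xs \<le> r" "set xs \<subseteq> {..<n}" "E \<subseteq> potential_edges {..<n}" "path_edges xs \<subseteq> E"
      "m < card {e \<in> E. e \<inter> set xs \<noteq> {} \<and> e \<notin> path_edges xs}"
      by (auto simp: thin_paths_def not_le)
    have "{e \<in> E. e \<inter> set xs \<noteq> {} \<and> e \<notin> path_edges xs} = E \<inter> T xs" using xs(5) by (auto simp: T_def)
    moreover obtain k where k: "length xs = Suc k" using xs(2) by (cases xs) auto
    moreover have "xs \<in> L k" using xs k by (simp add: L_def)
    ultimately show "E \<in> {E. \<exists>k\<in>{..<r}. \<exists>xs\<in>L k. path_edges xs \<subseteq> E \<and> real (Suc m) \<le> real (card (E \<inter> T xs))}"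
      using xs by (auto intro!: bexI[of _ k] bexI[of _ xs])
  qed simp
  also have "\<dots> \<le> (\<Sum>k\<in>{..<r}. real n * (d ^ r * exp (2 * d * real r)) * exp (- real (Suc m)))" by (rule prob_Ex_le[OF _ b2]) auto
  also have "\<dots> = real r * real n * (d ^ r * exp (2 * d * real r)) * exp (- real (Suc m))" by simp
  finally show ?thesis unfolding p_def .
qed

lemma gnp_growth:
  fixes d :: real
  assumes d: "1 \<le> d" "d \<le> real n"
  shows "measure_pmf.prob (gnp n (d / real n))
    {E. \<exists>v\<in>{..<n}. b * (2 * d) ^ r \<le> real (card (layer E {v} ({..<n} - {v}) r))} \<le> real n * exp (1 - b)"
proof -
  have "measure_pmf.prob (gnp n (d / real n))
    {E. \<exists>v\<in>{..<n}. b * (2 * d) ^ r \<le> real (card (layer E {v} ({..<n} - {v}) r))} \<le> (\<Sum>v\<in>{..<n}. exp (1 - b))"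
    using d by (intro prob_Ex_le gnp_layer_tail) auto
  thus ?thesis by simp
qed

section \<open>The mixing time on typical graphs\<close>

lemma abs_energy_le:
  assumes V: "finite V" "E \<subseteq> potential_edges V"
    and J: "\<And>e. e \<in> E \<Longrightarrow> \<bar>J e\<bar> \<le> 1" and h: "\<And>v. v \<in> V \<Longrightarrow> \<bar>h v\<bar> \<le> a" and s: "\<sigma> \<in> configs V"
  shows "\<bar>energy V E J h \<sigma>\<bar> \<le> real (card V) ^ 2 + real (card V) * a"
proof -
  have s1: "\<bar>\<sigma> x\<bar> = 1" if "x \<in> V" for x using configs_val[OF s that] by auto
  have "\<bar>\<Sum>e\<in>E. J e * (\<Prod>v\<in>e. \<sigma> v)\<bar> \<le> (\<Sum>e\<in>E. 1)"
  proof (rule order_trans[OF sum_abs], rule sum_mono)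
    fix e assume e: "e \<in> E"
    have "\<bar>\<Prod>v\<in>e. \<sigma> v\<bar> = (\<Prod>v\<in>e. 1)"
      unfolding abs_prod using e V by (intro prod.cong s1) (auto simp: potential_edges_def)
    thus "\<bar>J e * (\<Prod>v\<in>e. \<sigma> v)\<bar> \<le> 1" using J[OF e] by (simp add: abs_mult)
  qed
  also have "\<dots> \<le> real (card V) ^ 2"
  proof -
    have "card E \<le> card V ^ 2"
      using card_mono[OF finite_potential_edges[OF V(1)] V(2)] card_potential_edges_le[OF V(1)] by (rule order_trans)
    hence "real (card E) \<le> real (card V) ^ 2" by (metis of_nat_le_iff of_nat_power)
    thus ?thesis by simp
  qed
  finally have 1: "\<bar>\<Sum>e\<in>E. J e * (\<Prod>v\<in>e. \<sigma> v)\<bar> \<le> real (card V) ^ 2" .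
  have "\<bar>\<Sum>v\<in>V. h v * \<sigma> v\<bar> \<le> (\<Sum>v\<in>V. a)"
    by (rule order_trans[OF sum_abs], rule sum_mono) (simp add: abs_mult s1 h)
  thus ?thesis using 1 unfolding energy_def by simp
qed

lemma exp_1_square_ge: "(exp 1)\<^sup>2 \<ge> (5::real)"
proof -
  have "1 + 1/2 \<le> exp (1/2 :: real)" by (rule exp_ge_add_one_self)
  hence "(3/2)^4 \<le> exp (1/2 :: real) ^ 4" by (intro power_mono) auto
  also have "\<dots> = (exp 1)\<^sup>2" by (simp flip: exp_of_nat_mult)
  finally show ?thesis by (simp add: power_numeral_even)
qed

lemma tanh_small_bounds:
  assumes "0 \<le> \<beta>" "tanh \<beta> \<le> (1/5 :: real)"
  shows "exp (4 * \<beta>) \<le> 4" "\<beta> \<le> 1"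
proof -
  define k where "k = exp (2 * \<beta>)"
  have k: "k > 0" by (simp add: k_def)
  have "tanh \<beta> = (k - 1) / (k + 1)"
  proof -
    have "exp (- (2 * \<beta>)) = 1 / k" by (simp add: k_def exp_minus inverse_eq_divide)
    hence "tanh \<beta> = (1 - 1 / k) / (1 + 1 / k)" by (simp add: tanh_real_altdef)
    also have "1 - 1 / k = (k - 1) / k" using k by (simp add: field_simps)
    also have "1 + 1 / k = (k + 1) / k" using k by (simp add: field_simps)
    also have "(k - 1) / k / ((k + 1) / k) = (k - 1) / (k + 1)" using k by simp
    finally show ?thesis .
  qed
  hence "(k - 1) / (k + 1) \<le> 1 / 5" using assms by simp
  hence "k - 1 \<le> 1 / 5 * (k + 1)" using k by (simp add: pos_divide_le_eq)
  hence k2: "k \<le> 2" by simp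
  have "exp (4 * \<beta>) = k ^ 2" by (simp add: k_def power2_eq_square flip: exp_add)
  also have "\<dots> \<le> 2 ^ 2" using k k2 by (intro power_mono) auto
  finally show "exp (4 * \<beta>) \<le> 4" by simp
  have "1 + 2 * \<beta> \<le> k" unfolding k_def by (rule exp_ge_add_one_self)
  thus "\<beta> \<le> 1" using k2 by simp
qed

text \<open>With \<open>\<delta> = exp (- n^2)\<close>, the relaxation must beat
  \<open>2 ^ n * exp (202 * n^2)\<close> and still leave \<open>exp (- 2 * n^2)\<close>; as
  \<open>2 ^ n \<le> exp (n^2)\<close>, an exponent \<open>205 * n^2\<close> at rate
  \<open>1 / (n * W)\<close> suffices. The chain is run for \<open>n\<close> such rounds.\<close>

lemma glauber_mixing_time_good_graph:
  fixes E :: "nat set set"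
  assumes n: "n \<ge> 1" and r: "1 \<le> r" and EV: "E \<subseteq> potential_edges {..<n}"
    and \<beta>: "0 \<le> \<beta>" "tanh \<beta> \<le> 1 / 5"
    and sparse: "locally_sparse (4 * Suc r) {..<n} E"
    and thin: "thin_paths r m {..<n} E"
    and growth: "\<And>v. v < n \<Longrightarrow> real (card (layer E {v} ({..<n} - {v}) r)) * tanh \<beta> ^ r \<le> 1 / 10"
    and J: "\<And>e. e \<in> E \<Longrightarrow> 0 \<le> J e \<and> J e \<le> \<beta>" and h: "\<And>v. v < n \<Longrightarrow> \<bar>h v\<bar> \<le> 100 * \<beta> * real n"
    and num: "real n * (2 * (1/2) ^ n + 4 * exp (- (real n ^ 2))) \<le> 1 / (2 * exp 1)"
  shows "glauber_mixing_time {..<n} E J h \<le> enat (n * nat \<lceil>205 * real n ^ 3 * 42 ^ (3 * r + 2 * m)\<rceil>)"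
proof -
  define W :: real where "W = 42 ^ (3 * r + 2 * m)"
  define \<tau> where "\<tau> = nat \<lceil>205 * real n ^ 3 * W\<rceil>"
  have W: "W \<ge> 1" by (simp add: W_def)
  have b: "exp (4 * \<beta>) \<le> 4" "\<beta> \<le> 1" using tanh_small_bounds[OF \<beta>] by auto
  have n1: "real n \<ge> 1" using n by simp
  have "glauber_mixing_time {..<n} E J h \<le> enat (n * \<tau>)"
  proof (rule glauber_mixing_time_le[where \<beta> = \<beta> and M = "3 * r + 2 * m" and H = "101 * real n ^ 2" and \<delta> = "exp (- (real n ^ 2))"])
    show "\<exists>B par lev. good_block {..<n} E (tanh \<beta>) (3 * r + 2 * m) v B par lev" if v: "v \<in> {..<n}" for v
    proof -
      interpret bfs "{..<n}" E v by unfold_locales (use EV v in auto)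
      have "real (card (S r)) * tanh \<beta> ^ r \<le> 1 / 10" using growth[of v] v by (simp add: S_def)
      \<comment> \<open>The removed vertex uses at most \<open>2/5\<close> and the sphere at most
        \<open>1/10\<close>.\<close>
      hence "2 * tanh \<beta> + real (card (S r)) * tanh \<beta> ^ r \<le> 1 / 2" using \<beta> by simp
      thus ?thesis using good_block_exists[OF sparse thin r, of "tanh \<beta>"] \<beta> by auto
    qed
    \<comment> \<open>At most \<open>n^2\<close> from the edges and \<open>100 * n^2\<close> from
      the fields, as \<open>\<beta> \<le> 1\<close>.\<close>
    show "\<bar>energy {..<n} E J h \<sigma>\<bar> \<le> 101 * real n ^ 2" if \<sigma>: "\<sigma> \<in> configs {..<n}" for \<sigma>
    proof -
      have "\<bar>energy {..<n} E J h \<sigma>\<bar> \<le> real (card {..<n}) ^ 2 + real (card {..<n}) * (100 * real n)"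
      proof (rule abs_energy_le[OF _ EV _ _ \<sigma>])
        show "\<bar>J e\<bar> \<le> 1" if "e \<in> E" for e using J[OF that] b by simp
        show "\<bar>h v\<bar> \<le> 100 * real n" if "v \<in> {..<n}" for v
        proof -
          have "100 * \<beta> * real n \<le> 100 * real n"
            using mult_right_mono[OF b(2), of "100 * real n"] by (simp add: mult_ac)
          thus ?thesis using h[of v] that by (meson lessThan_iff order_trans)
        qed
      qed simp
      thus ?thesis by (simp add: power2_eq_square)
    qed
    show "(1 - 1 / (real (card {..<n}) * 42 ^ (3 * r + 2 * m))) ^ \<tau> * (2 ^ card {..<n} * exp (2 * (101 * real n ^ 2))) \<le> (exp (- (real n ^ 2)))\<^sup>2"
    proof -
      define x where "x = 1 / (real n * W)"
      have nW: "real n * W \<ge> 1" using mult_mono[OF n1 W] W by simp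
      hence x: "0 < x" "x \<le> 1" by (auto simp: x_def intro: divide_pos_pos)
      have "205 * real n ^ 3 * W \<le> real \<tau>" unfolding \<tau>_def by linarith
      hence "205 * real n ^ 3 * W * x \<le> real \<tau> * x" using x by (intro mult_right_mono) auto
      moreover have "205 * real n ^ 3 * W * x = 205 * real n ^ 2"
        using n W by (simp add: x_def power2_eq_square power3_eq_cube)
      ultimately have tx: "205 * real n ^ 2 \<le> real \<tau> * x" by simp
      have "(1 - x) ^ \<tau> \<le> exp (- x) ^ \<tau>"
        using x exp_ge_add_one_self[of "-x"] by (intro power_mono) auto
      also have "\<dots> = exp (- (real \<tau> * x))" by (simp flip: exp_of_nat_mult)
      also have "\<dots> \<le> exp (- (205 * real n ^ 2))" using tx by simp
      finally have p1: "(1 - x) ^ \<tau> \<le> exp (- (205 * real n ^ 2))" .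
      have p2: "2 ^ n \<le> exp (real n ^ 2)"
      proof -
        have "(2::real) \<le> exp 1" using exp_ge_add_one_self[of 1] by simp
        hence "(2::real) ^ n \<le> exp 1 ^ n" by (intro power_mono) auto
        also have "\<dots> = exp (real n)" by (simp flip: exp_of_nat_mult)
        also have "\<dots> \<le> exp (real n ^ 2)" using n1 by (simp add: self_le_power)
        finally show ?thesis .
      qed
      have "(1 - x) ^ \<tau> * (2 ^ n * exp (2 * (101 * real n ^ 2))) \<le> exp (- (205 * real n ^ 2)) * (exp (real n ^ 2) * exp (2 * (101 * real n ^ 2)))"
        by (intro mult_mono p1 p2) auto
      also have "\<dots> = exp (- (real n ^ 2)) ^ 2" by (simp add: power2_eq_square flip: exp_add)
      finally show ?thesis by (simp add: x_def W_def)
    qed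
    show "real (card {..<n}) * (2 * (1/2) ^ n + 4 * exp (- (real n ^ 2))) \<le> 1 / (2 * exp 1)" using num by simp
  qed (use n EV \<beta> b J in \<open>auto simp: lessThan_empty_iff\<close>)
  thus ?thesis unfolding \<tau>_def W_def .
qed

text \<open>Large enough that \<open>exp (- r) \<le> 1 / (ln n)^2\<close>, which beats the factor
  \<open>3 * ln n\<close> in the sphere sizes, and small enough that \<open>2 ^ s\<^sup>2\<close>
  with \<open>s = 4 * Suc r\<close> stays below every positive power of \<open>n\<close>.\<close>

definition radius :: "nat \<Rightarrow> nat" where "radius n = nat \<lceil>2 * ln (ln (real n))\<rceil>"

text \<open>The three terms bound the probabilities that some small vertex set spans too many edges, that some
  short path meets more than \<open>3 ln n\<close> further edges, and that some sphere is too large.\<close>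

definition failure_bound :: "real \<Rightarrow> nat \<Rightarrow> real" where
  "failure_bound d n = real (Suc (4 * Suc (radius n))) * 2 ^ (4 * Suc (radius n))\<^sup>2 * d ^ Suc (4 * Suc (radius n)) / real n
     + real (radius n) * real n * (d ^ radius n * exp (2 * d * real (radius n))) * exp (- (3 * ln (real n)))
     + real n * exp (1 - 3 * ln (real n))"

lemma radius_bounds:
  assumes "0 \<le> ln (ln (real n))"
  shows "2 * ln (ln (real n)) \<le> real (radius n)" "real (radius n) \<le> 2 * ln (ln (real n)) + 1"
  using assms unfolding radius_def by linarith+

text \<open>All exponents are dominated by polynomials in \<open>ln (ln n)\<close>, hence are
  \<open>o(ln n)\<close>, and the three terms retain a factor \<open>1 / n\<close>,
  \<open>1 / n^2\<close> and \<open>1 / n^2\<close>.\<close>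

lemma failure_bound_tendsto:
  assumes d: "1 \<le> d" shows "failure_bound d \<longlonglongrightarrow> 0"
proof -
  define c where "c = 1 + ln d + 2 * d"
  have c: "c > 0" using d by (simp add: c_def add_nonneg_pos)
  define x where "x n = 2 * ln (ln (real n)) + 1" for n :: nat
  define b where "b n = exp (c * (4 * x n + 5) + (4 * x n + 4)\<^sup>2) / real n + exp (c * x n) / real n ^ 2 + exp 1 / real n ^ 2" for n
  have lim: "b \<longlonglongrightarrow> 0" unfolding b_def x_def using c by real_asymp
  have ev: "eventually (\<lambda>n. ln (ln (real n)) \<ge> 0 \<and> n \<ge> 1) sequentially"
    by (intro eventually_conj eventually_ge_at_top) real_asymp
  have "eventually (\<lambda>n. norm (failure_bound d n) \<le> b n) sequentially"
    using ev
  proof eventually_elim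
    case (elim n)
    define r where "r = radius n"
    have r: "real r \<le> x n" using radius_bounds[of n] elim by (simp add: r_def x_def)
    have n: "real n > 0" using elim by simp
    have x0: "x n \<ge> 0" using elim by (simp add: x_def)
    have le_exp: "y \<le> exp y" for y :: real using exp_ge_add_one_self[of y] by linarith
    have dpow: "d ^ k = exp (ln d * real k)" for k using d by (simp add: exp_of_nat2_mult)
    define s where "s = 4 * Suc r"
    have s: "real s \<le> 4 * x n + 4" using r by (simp add: s_def)
    have two: "(2::real) ^ s\<^sup>2 \<le> exp (real s ^ 2)"
    proof -
      have "(2::real) \<le> exp 1" using exp_ge_add_one_self[of 1] by simp
      hence "(2::real) ^ s\<^sup>2 \<le> exp 1 ^ s\<^sup>2" by (intro power_mono) auto
      also have "\<dots> = exp (real s ^ 2)" by (simp flip: exp_of_nat_mult)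
      finally show ?thesis .
    qed
    have n3: "exp (- (3 * ln (real n))) = 1 / real n ^ 3"
    proof -
      have "exp (3 * ln (real n)) = real n ^ 3" using n exp_of_nat_mult[of 3 "ln (real n)"] by simp
      thus ?thesis by (simp add: exp_minus inverse_eq_divide)
    qed
    have "real (Suc s) * 2 ^ s\<^sup>2 * d ^ Suc s \<le> exp (real (Suc s)) * exp (real s ^ 2) * exp (ln d * real (Suc s))"
      unfolding dpow using two le_exp[of "real (Suc s)"] by (intro mult_mono) auto
    also have "\<dots> = exp ((1 + ln d) * real (Suc s) + real s ^ 2)" by (simp add: algebra_simps flip: exp_add)
    also have "\<dots> \<le> exp (c * (4 * x n + 5) + (4 * x n + 4)\<^sup>2)"
      unfolding exp_le_cancel_iff using s d x0
      by (intro add_mono mult_mono power_mono) (auto simp: c_def)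
    finally have t1: "real (Suc s) * 2 ^ s\<^sup>2 * d ^ Suc s / real n \<le> exp (c * (4 * x n + 5) + (4 * x n + 4)\<^sup>2) / real n"
      using n by (intro divide_right_mono) auto
    have "real r * (d ^ r * exp (2 * d * real r)) \<le> exp (real r) * (exp (ln d * real r) * exp (2 * d * real r))"
      unfolding dpow using le_exp[of "real r"] by (intro mult_right_mono) auto
    also have "\<dots> = exp (c * real r)" by (simp add: c_def algebra_simps flip: exp_add)
    also have "\<dots> \<le> exp (c * x n)" using c r by simp
    finally have t2: "real r * (d ^ r * exp (2 * d * real r)) / real n ^ 2 \<le> exp (c * x n) / real n ^ 2"
      using n by (intro divide_right_mono) auto
    have t2': "real r * real n * (d ^ r * exp (2 * d * real r)) * exp (- (3 * ln (real n)))
       = real r * (d ^ r * exp (2 * d * real r)) / real n ^ 2"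
      unfolding n3 using n by (simp add: power2_eq_square power3_eq_cube)
    have t3: "real n * exp (1 - 3 * ln (real n)) = exp 1 / real n ^ 2"
    proof -
      have "exp (1 - 3 * ln (real n)) = exp 1 * exp (- (3 * ln (real n)))" by (simp flip: exp_add)
      thus ?thesis unfolding n3 using n by (simp add: power2_eq_square power3_eq_cube)
    qed
    have "failure_bound d n \<le> b n"
      unfolding failure_bound_def r_def[symmetric] s_def[symmetric] t2' t3 b_def using t1 t2 by simp
    moreover have "failure_bound d n \<ge> 0"
      unfolding failure_bound_def using d by (intro add_nonneg_nonneg) auto
    ultimately show ?case by simp
  qed
  thus ?thesis using lim by (rule Lim_null_comparison)
qed

text \<open>None of the three exceptional events \<open>B1\<close>, \<open>B2\<close>,
  \<open>B3\<close> mentions the interactions or the fields. So a single typical graph serves all of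
  them, and the quantifier over \<open>J\<close> and \<open>h\<close> may stand inside the
  event.\<close>

lemma eventually_mixing_polynomial:
  assumes d: "1 \<le> d" and \<beta>: "0 \<le> \<beta>" "tanh \<beta> < 1 / ((exp 1)\<^sup>2 * d)"
  shows "eventually (\<lambda>n. measure_pmf.prob (gnp n (d / real n))
      {E. \<not> (\<forall>J h. (\<forall>e\<in>E. 0 \<le> J e) \<and> (E \<noteq> {} \<longrightarrow> Max (J ` E) = \<beta>) \<and> (\<forall>v<n. \<bar>h v\<bar> \<le> 100 * \<beta> * real n) \<longrightarrow>
          ereal_of_enat (glauber_mixing_time {..<n} E J h) \<le> ereal (206 * real n powr (4 + 7 * ln 42)))}
      \<le> failure_bound d n) sequentially"
proof -
  define t where "t = tanh \<beta>"
  have t0: "0 \<le> t" using \<beta> by (simp add: t_def)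
  have e5: "(5::real) \<le> (exp 1)\<^sup>2" by (rule exp_1_square_ge)
  have td: "t * d \<le> 1 / (exp 1)\<^sup>2"
    using \<beta>(2) d e5 by (simp add: t_def field_simps)
  have t5: "tanh \<beta> \<le> 1 / 5"
  proof -
    have "t * 1 \<le> t * d" using t0 d by (intro mult_left_mono) auto
    moreover have "1 / (exp 1)\<^sup>2 \<le> (1 / 5 :: real)" using e5 by (intro divide_left_mono) auto
    ultimately have "t \<le> 1 / 5" using td by linarith
    thus ?thesis by (simp add: t_def)
  qed
  \<comment> \<open>One factor \<open>exp 1\<close> of the hypothesis absorbs the 2 in the growth
    rate \<open>2 * d\<close>; the other remains as decay per level.\<close>
  have q: "2 * d * t \<le> exp (- 1)"
  proof -
    have "2 * (t * d) \<le> exp 1 * (1 / (exp 1)\<^sup>2)"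
      using td exp_ge_add_one_self[of "1::real"] t0 d by (intro mult_mono) auto
    also have "\<dots> = exp (-1)" by (simp add: power2_eq_square exp_minus inverse_eq_divide)
    finally show ?thesis by (simp add: mult_ac)
  qed
  have "eventually (\<lambda>n. d \<le> real n) sequentially"
    using filterlim_real_sequentially by (auto simp: filterlim_at_top)
  moreover have "eventually (\<lambda>n. 1 \<le> n) sequentially" by (rule eventually_ge_at_top)
  moreover have "eventually (\<lambda>n::nat. 0 < ln (ln (real n))) sequentially" by real_asymp
  moreover have "eventually (\<lambda>n::nat. 30 \<le> ln (real n)) sequentially" by real_asymp
  moreover have "eventually (\<lambda>n::nat. 6 * ln (ln (real n)) + 3 \<le> ln (real n)) sequentially" by real_asymp
  moreover have "eventually (\<lambda>n::nat. real n * (2 * (1/2) ^ n + 4 * exp (- (real n ^ 2))) \<le> 1 / (2 * exp 1)) sequentially"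
  proof -
    have "(\<lambda>n::nat. real n * (2 * (1/2) ^ n + 4 * exp (- (real n ^ 2)))) \<longlonglongrightarrow> 0" by real_asymp
    moreover have "0 < 1 / (2 * exp 1 :: real)" by simp
    ultimately have "eventually (\<lambda>n::nat. real n * (2 * (1/2) ^ n + 4 * exp (- (real n ^ 2))) < 1 / (2 * exp 1)) sequentially"
      by (rule order_tendstoD(2))
    thus ?thesis by eventually_elim simp
  qed
  ultimately show ?thesis
  proof eventually_elim
    case (elim n)
    note dn = elim(1) and n1 = elim(2) and lln = elim(3) and ln30 = elim(4) and ln6 = elim(5) and num = elim(6)
    define r where "r = radius n"
    \<comment> \<open>This makes \<open>exp (- Suc m)\<close> at most \<open>1 / n^3\<close>, enough
      for the union bound over paths, and keeps \<open>42 ^ (2 * m)\<close> polynomial in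
      \<open>n\<close>.\<close>
    define m where "m = nat \<lfloor>3 * ln (real n)\<rfloor>"
    have r: "2 * ln (ln (real n)) \<le> real r" "real r \<le> 2 * ln (ln (real n)) + 1"
      using radius_bounds[of n] lln by (auto simp: r_def)
    have r1: "1 \<le> r" using r(1) lln by (cases r) auto
    have m: "real m \<le> 3 * ln (real n)" "3 * ln (real n) \<le> real (Suc m)" unfolding m_def using ln30 by linarith+
    \<comment> \<open>\<open>2 * m\<close> takes up to six times \<open>ln n\<close>;
      \<open>3 * r\<close> is of order \<open>ln (ln n)\<close> and fits into the seventh.\<close>
    have expo: "real (3 * r + 2 * m) \<le> 7 * ln (real n)" using r(2) m(1) ln6 by simp
    define B1 where "B1 = {E. E \<subseteq> potential_edges {..<n} \<and> \<not> locally_sparse (4 * Suc r) {..<n} E}"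
    define B2 where "B2 = {E. E \<subseteq> potential_edges {..<n} \<and> \<not> thin_paths r m {..<n} E}"
    define B3 where "B3 = {E. \<exists>v\<in>{..<n}. 3 * ln (real n) * (2 * d) ^ r \<le> real (card (layer E {v} ({..<n} - {v}) r))}"
    define Good where "Good E \<longleftrightarrow> (\<forall>J h. (\<forall>e\<in>E. 0 \<le> J e) \<and> (E \<noteq> {} \<longrightarrow> Max (J ` E) = \<beta>) \<and> (\<forall>v<n. \<bar>h v\<bar> \<le> 100 * \<beta> * real n) \<longrightarrow>
          ereal_of_enat (glauber_mixing_time {..<n} E J h) \<le> ereal (206 * real n powr (4 + 7 * ln 42)))" for E
    have good: "Good E" if EV: "E \<subseteq> potential_edges {..<n}" and nB: "E \<notin> B1" "E \<notin> B2" "E \<notin> B3" for E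
      unfolding Good_def
    proof (intro allI impI, elim conjE)
      fix J :: "nat set \<Rightarrow> real" and h :: "nat \<Rightarrow> real"
      assume J: "\<forall>e\<in>E. 0 \<le> J e" "E \<noteq> {} \<longrightarrow> Max (J ` E) = \<beta>" and h: "\<forall>v<n. \<bar>h v\<bar> \<le> 100 * \<beta> * real n"
      have fE: "finite E" using EV finite_potential_edges[of "{..<n}"] finite_subset by blast
      have J': "0 \<le> J e \<and> J e \<le> \<beta>" if "e \<in> E" for e
      proof -
        have "J e \<le> Max (J ` E)" using that fE by (intro Max_ge) auto
        thus ?thesis using J that by auto
      qed
      have growth: "real (card (layer E {v} ({..<n} - {v}) r)) * tanh \<beta> ^ r \<le> 1 / 10" if "v < n" for v
      proof -
        have "real (card (layer E {v} ({..<n} - {v}) r)) \<le> 3 * ln (real n) * (2 * d) ^ r"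
          using nB(3) that unfolding B3_def by (auto simp: not_le intro: less_imp_le)
        hence "real (card (layer E {v} ({..<n} - {v}) r)) * t ^ r \<le> 3 * ln (real n) * (2 * d) ^ r * t ^ r"
          using t0 by (intro mult_right_mono) auto
        also have "\<dots> = 3 * ln (real n) * (2 * d * t) ^ r" by (simp add: power_mult_distrib)
        also have "\<dots> \<le> 3 * ln (real n) * exp (- 1) ^ r"
          using q t0 d ln30 by (intro mult_left_mono power_mono) auto
        also have "exp (- 1 :: real) ^ r = exp (- real r)" by (simp flip: exp_of_nat_mult)
        also have "3 * ln (real n) * exp (- real r) \<le> 3 * ln (real n) * exp (- (2 * ln (ln (real n))))"
          using r(1) ln30 by (intro mult_left_mono) auto
        also have "exp (- (2 * ln (ln (real n)))) = 1 / ln (real n) ^ 2"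
        proof -
          have "exp (2 * ln (ln (real n))) = ln (real n) ^ 2"
            using ln30 exp_of_nat_mult[of 2 "ln (ln (real n))"] by simp
          thus ?thesis by (simp add: exp_minus inverse_eq_divide)
        qed
        also have "3 * ln (real n) * (1 / ln (real n) ^ 2) = 3 / ln (real n)"
          using ln30 by (simp add: power2_eq_square)
        also have "\<dots> \<le> 1 / 10" using ln30 by (simp add: divide_le_eq)
        finally show ?thesis by (simp add: t_def)
      qed
      have mix: "glauber_mixing_time {..<n} E J h \<le> enat (n * nat \<lceil>205 * real n ^ 3 * 42 ^ (3 * r + 2 * m)\<rceil>)"
        by (rule glauber_mixing_time_good_graph[OF n1 r1 EV \<beta>(1) t5 _ _ growth J' _ num])
          (use nB(1,2) EV h in \<open>auto simp: B1_def B2_def\<close>)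
      define W :: real where "W = 42 ^ (3 * r + 2 * m)"
      have W1: "W \<ge> 1" by (simp add: W_def)
      have W: "W \<le> real n powr (7 * ln 42)"
      proof -
        have "W = exp (ln 42 * real (3 * r + 2 * m))" unfolding W_def exp_of_nat2_mult by simp
        also have "\<dots> \<le> exp (ln 42 * (7 * ln (real n)))" using expo by simp
        also have "\<dots> = real n powr (7 * ln 42)" using n1 by (simp add: powr_def mult_ac)
        finally show ?thesis .
      qed
      have nn: "real n \<ge> 1" using n1 by simp
      have "real (n * nat \<lceil>205 * real n ^ 3 * W\<rceil>) \<le> real n * (205 * real n ^ 3 * W + 1)"
      proof -
        have "0 \<le> 205 * real n ^ 3 * W" using W1 by simp
        hence "real (nat \<lceil>205 * real n ^ 3 * W\<rceil>) \<le> 205 * real n ^ 3 * W + 1" by linarith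
        thus ?thesis by (simp add: mult_left_mono)
      qed
      also have "\<dots> \<le> real n * (206 * real n ^ 3 * W)"
      \<comment> \<open>The increase from 205 to 206 absorbs the rounding of the number of
        steps.\<close>
      proof (rule mult_left_mono)
        have "1 * 1 \<le> real n ^ 3 * W" using nn W1 by (intro mult_mono one_le_power) auto
        thus "205 * real n ^ 3 * W + 1 \<le> 206 * real n ^ 3 * W" by linarith
      qed simp
      also have "\<dots> = 206 * real n ^ 4 * W" by (simp add: power4_eq_xxxx power3_eq_cube)
      also have "\<dots> \<le> 206 * real n ^ 4 * real n powr (7 * ln 42)" by (intro mult_left_mono W) auto
      also have "\<dots> = 206 * real n powr (4 + 7 * ln 42)"
        using nn by (simp add: powr_add powr_numeral)
      finally have fin: "real (n * nat \<lceil>205 * real n ^ 3 * W\<rceil>) \<le> 206 * real n powr (4 + 7 * ln 42)" .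
      have "ereal_of_enat (glauber_mixing_time {..<n} E J h) \<le> ereal_of_enat (enat (n * nat \<lceil>205 * real n ^ 3 * W\<rceil>))"
        using mix unfolding W_def by (simp only: ereal_of_enat_le_iff)
      also have "\<dots> \<le> ereal (206 * real n powr (4 + 7 * ln 42))" using fin by simp
      finally show "ereal_of_enat (glauber_mixing_time {..<n} E J h) \<le> ereal (206 * real n powr (4 + 7 * ln 42))" .
    qed
    have "measure_pmf.prob (gnp n (d / real n)) {E. \<not> Good E} \<le> measure_pmf.prob (gnp n (d / real n)) (B1 \<union> B2 \<union> B3)"
    proof (rule measure_pmf.finite_measure_mono_AE)
      show "AE E in measure_pmf (gnp n (d / real n)). E \<in> {E. \<not> Good E} \<longrightarrow> E \<in> B1 \<union> B2 \<union> B3"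
        unfolding AE_measure_pmf_iff using good set_gnp by blast
    qed simp
    also have "\<dots> \<le> measure_pmf.prob (gnp n (d / real n)) B1 + measure_pmf.prob (gnp n (d / real n)) B2 + measure_pmf.prob (gnp n (d / real n)) B3"
      using measure_Un_le[of "B1 \<union> B2" "measure_pmf (gnp n (d / real n))" B3]
        measure_Un_le[of B1 "measure_pmf (gnp n (d / real n))" B2] by simp
    also have "\<dots> \<le> failure_bound d n"
      unfolding failure_bound_def r_def[symmetric]
    proof (intro add_mono)
      have "measure_pmf.prob (gnp n (d / real n)) B2 \<le> real r * real n * (d ^ r * exp (2 * d * real r)) * exp (- real (Suc m))"
        unfolding B2_def by (rule gnp_thin[OF d dn])
      also have "\<dots> \<le> real r * real n * (d ^ r * exp (2 * d * real r)) * exp (- (3 * ln (real n)))"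
        using m(2) d by (intro mult_left_mono) auto
      finally show "measure_pmf.prob (gnp n (d / real n)) B2
        \<le> real r * real n * (d ^ r * exp (2 * d * real r)) * exp (- (3 * ln (real n)))" .
    qed (unfold B1_def B3_def, (rule gnp_sparse[OF d dn] gnp_growth[OF d dn])+)
    finally show ?case unfolding Good_def .
  qed
qed

theorem theorem1p5:
  fixes d :: real
  assumes "d \<ge> 1"
  shows "\<exists>C::real. \<forall>\<beta>\<ge>0. tanh \<beta> < 1 / ((exp 1)\<^sup>2 * d) \<longrightarrow>
    (\<exists>K::real.
      (\<lambda>n::nat. measure_pmf.prob (gnp n (d / real n))
         {E. ereal_of_enat (glauber_mixing_time {..<n} E (\<lambda>_. \<beta>) (\<lambda>_. 0))
               \<le> ereal (K * real n powr C)}) \<longlonglongrightarrow> 1) \<and>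
    (\<exists>K::real.
      (\<lambda>n::nat. measure_pmf.prob (gnp n (d / real n))
         {E. \<forall>(J :: nat set \<Rightarrow> real) (h :: nat \<Rightarrow> real).
               (\<forall>e\<in>E. J e \<ge> 0) \<and> (E \<noteq> {} \<longrightarrow> Max (J ` E) = \<beta>) \<and>
               (\<forall>v<n. \<bar>h v\<bar> \<le> 100 * \<beta> * real n) \<longrightarrow>
               ereal_of_enat (glauber_mixing_time {..<n} E J h)
                 \<le> ereal (K * real n powr C)}) \<longlonglongrightarrow> 1)"
proof (rule exI[of _ "4 + 7 * ln 42"], intro allI impI)
  \<comment> \<open>In the exponent, 4 stems from \<open>n\<close> rounds of order
    \<open>n^3 * W\<close> steps and \<open>7 * ln 42\<close> from the Poincare factor
    \<open>W = 42 ^ (3 * r + 2 * m)\<close>.\<close>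
  fix \<beta> :: real assume \<beta>: "0 \<le> \<beta>" "tanh \<beta> < 1 / ((exp 1)\<^sup>2 * d)"
  define G1 where "G1 n = {E. ereal_of_enat (glauber_mixing_time {..<n} E (\<lambda>_. \<beta>) (\<lambda>_. 0))
               \<le> ereal (206 * real n powr (4 + 7 * ln 42))}" for n
  define G2 where "G2 n = {E. \<forall>(J :: nat set \<Rightarrow> real) (h :: nat \<Rightarrow> real).
               (\<forall>e\<in>E. J e \<ge> 0) \<and> (E \<noteq> {} \<longrightarrow> Max (J ` E) = \<beta>) \<and>
               (\<forall>v<n. \<bar>h v\<bar> \<le> 100 * \<beta> * real n) \<longrightarrow>
               ereal_of_enat (glauber_mixing_time {..<n} E J h)
                 \<le> ereal (206 * real n powr (4 + 7 * ln 42))}" for n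
  \<comment> \<open>The homogeneous model is the instance of constant interactions and zero fields.
    On a graph without edges the condition on the maximum is void.\<close>
  have sub: "G2 n \<subseteq> G1 n" for n
  proof
    fix E assume "E \<in> G2 n"
    note * = this[unfolded G2_def mem_Collect_eq, THEN spec, THEN spec, of "\<lambda>_. \<beta>" "\<lambda>_. 0"]
    show "E \<in> G1 n" unfolding G1_def mem_Collect_eq
      by (rule *[THEN mp]) (use \<beta> in \<open>simp add: image_constant_conv\<close>)
  qed
  have lim: "(\<lambda>n. 1 - failure_bound d n) \<longlonglongrightarrow> 1"
    using tendsto_diff[OF tendsto_const failure_bound_tendsto[OF assms], of 1] by simp
  have ev: "eventually (\<lambda>n. 1 - failure_bound d n \<le> measure_pmf.prob (gnp n (d / real n)) (G2 n)) sequentially"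
    using eventually_mixing_polynomial[OF assms \<beta>]
  proof eventually_elim
    case (elim n)
    have "measure_pmf.prob (gnp n (d / real n)) (- G2 n) \<le> failure_bound d n"
      using elim unfolding G2_def Collect_neg_eq .
    moreover have "measure_pmf.prob (gnp n (d / real n)) (- G2 n) = 1 - measure_pmf.prob (gnp n (d / real n)) (G2 n)"
      using measure_pmf.prob_compl[of "G2 n" "gnp n (d / real n)"] by (simp add: Compl_eq_Diff_UNIV)
    ultimately show ?case by linarith
  qed
  have l2: "(\<lambda>n. measure_pmf.prob (gnp n (d / real n)) (G2 n)) \<longlonglongrightarrow> 1"
    by (rule tendsto_sandwich[OF ev _ lim tendsto_const]) simp
  have "eventually (\<lambda>n. 1 - failure_bound d n \<le> measure_pmf.prob (gnp n (d / real n)) (G1 n)) sequentially"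
    using ev
  proof eventually_elim
    case (elim n)
    have "measure_pmf.prob (gnp n (d / real n)) (G2 n) \<le> measure_pmf.prob (gnp n (d / real n)) (G1 n)"
      using sub by (intro measure_pmf.finite_measure_mono) auto
    thus ?case using elim by linarith
  qed
  hence l1: "(\<lambda>n. measure_pmf.prob (gnp n (d / real n)) (G1 n)) \<longlonglongrightarrow> 1"
    by (rule tendsto_sandwich[OF _ _ lim tendsto_const]) simp
  show "(\<exists>K::real.
      (\<lambda>n::nat. measure_pmf.prob (gnp n (d / real n))
         {E. ereal_of_enat (glauber_mixing_time {..<n} E (\<lambda>_. \<beta>) (\<lambda>_. 0))
               \<le> ereal (K * real n powr (4 + 7 * ln 42))}) \<longlonglongrightarrow> 1) \<and>
    (\<exists>K::real.
      (\<lambda>n::nat. measure_pmf.prob (gnp n (d / real n))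
         {E. \<forall>(J :: nat set \<Rightarrow> real) (h :: nat \<Rightarrow> real).
               (\<forall>e\<in>E. J e \<ge> 0) \<and> (E \<noteq> {} \<longrightarrow> Max (J ` E) = \<beta>) \<and>
               (\<forall>v<n. \<bar>h v\<bar> \<le> 100 * \<beta> * real n) \<longrightarrow>
               ereal_of_enat (glauber_mixing_time {..<n} E J h)
                 \<le> ereal (K * real n powr (4 + 7 * ln 42))}) \<longlonglongrightarrow> 1)"
    by (intro conjI exI[of _ 206]) (rule l1[unfolded G1_def] l2[unfolded G2_def])+
qed

end
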